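(* Let $A$ and $B$ be unital rings and let ${}_BM_A$ be a unital bimodule. If ${}_BM_A$ is a QF bimodule, then the ring homomorphism $\lambda: B\to E=\mathrm{End}\,M_A$, given by $\lambda_b(m)=bm$, is a QF extension.
   Context: $X^{(n)}$ denotes the direct sum of $n$ copies of $X$. For bimodules $X,Y$ over the same pair of rings, $X\,|\,Y$ ($X$ divides $Y$) means $X\oplus P\cong Y^{(n)}$ for some bimodule $P$ and some $n\in\mathbb{N}$, and $X\sim Y$ ($X$ and $Y$ are similar) means $X\,|\,Y$ and $Y\,|\,X$. For a bimodule ${}_BM_A$, $({}_BM)^*=\mathrm{Hom}({}_BM,{}_BB)$ is the left $B$-dual and $(M_A)^*=\mathrm{Hom}(M_A,A_A)$ is the right $A$-dual; both are $(A,B)$-bimodules in the natural way: $(a\cdot f\cdot b)(m)=f(ma)b$ on $({}_BM)^*$ and $(a\cdot g\cdot b)(m)=a\,g(bm)$ on $(M_A)^*$. QF bimodule: ${}_BM_A$ is a quasi-Frobenius (QF) bimodule if ${}_BM$ and $M_A$ are both finitely generated projective and $({}_BM)^*\sim (M_A)^*$ as $(A,B)$-bimodules. A ring extension $A/B$ is a unital ring homomorphism $\varphi:B\to A$ (not necessarily injective), via which $A$ is a natural $B$-bimodule. It is a left QF extension if ${}_BA$ is finitely generated projective and $A\,|\,({}_BA)^*$ as $(A,B)$-bimodules; a right QF extension if $A_B$ is finitely generated projective and $A\,|\,(A_B)^*$ as $(B,A)$-bimodules; and a QF extension if it is both left and right QF. Here $({}_BA)^*$ has $(A,B)$-bimodule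 structure $(a\cdot f\cdot b)(x)=f(xa)b$ and $(A_B)^*$ has $(B,A)$-bimodule structure $(b\cdot g\cdot a)(x)=b\,g(ax)$. *)

theory Defs
  imports "HOL-Algebra.Module" "HOL-Algebra.RingHom"
begin

section \<open>Modules and bimodules over noncommutative rings\<close>

text \<open>
  The field \<open>smult\<close> inherited from the library record is the left action. One-sided modules
  use the same record and ignore the other action. As for the library's modules, the fields
  \<open>mult\<close> and \<open>one\<close> carry no information; they are \<open>undefined\<close> below.
\<close>

record ('b, 'a, 'm) bimodule = "('b, 'm) module" +
  rsmult :: "['m, 'a] \<Rightarrow> 'm"  (infixl \<open>\<odot>\<^sub>r\<index>\<close> 70)

text \<open>The library locale \<open>module\<close> assumes a commutative base ring, which is too restrictive here.\<close>

locale left_module = B?: ring B + M?: abelian_group M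
  for B :: "('b, 'r) ring_scheme" (structure) and M :: "('b, 'm, 's) module_scheme" (structure) +
  assumes lsmult_closed:
      "\<lbrakk>b \<in> carrier B; x \<in> carrier M\<rbrakk> \<Longrightarrow> b \<odot>\<^bsub>M\<^esub> x \<in> carrier M"
    and lsmult_l_distr:
      "\<lbrakk>b \<in> carrier B; c \<in> carrier B; x \<in> carrier M\<rbrakk> \<Longrightarrow>
       (b \<oplus>\<^bsub>B\<^esub> c) \<odot>\<^bsub>M\<^esub> x = b \<odot>\<^bsub>M\<^esub> x \<oplus>\<^bsub>M\<^esub> c \<odot>\<^bsub>M\<^esub> x"
    and lsmult_r_distr:
      "\<lbrakk>b \<in> carrier B; x \<in> carrier M; y \<in> carrier M\<rbrakk> \<Longrightarrow>
       b \<odot>\<^bsub>M\<^esub> (x \<oplus>\<^bsub>M\<^esub> y) = b \<odot>\<^bsub>M\<^esub> x \<oplus>\<^bsub>M\<^esub> b \<odot>\<^bsub>M\<^esub> y"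
    and lsmult_assoc:
      "\<lbrakk>b \<in> carrier B; c \<in> carrier B; x \<in> carrier M\<rbrakk> \<Longrightarrow>
       (b \<otimes>\<^bsub>B\<^esub> c) \<odot>\<^bsub>M\<^esub> x = b \<odot>\<^bsub>M\<^esub> (c \<odot>\<^bsub>M\<^esub> x)"
    and lsmult_one:
      "x \<in> carrier M \<Longrightarrow> \<one>\<^bsub>B\<^esub> \<odot>\<^bsub>M\<^esub> x = x"

locale right_module = A?: ring A + M?: abelian_group M
  for A :: "('a, 'q) ring_scheme" (structure)
    and M :: "('b, 'a, 'm, 's) bimodule_scheme" (structure) +
  assumes rsmult_closed:
      "\<lbrakk>x \<in> carrier M; a \<in> carrier A\<rbrakk> \<Longrightarrow> x \<odot>\<^sub>r\<^bsub>M\<^esub> a \<in> carrier M"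
    and rsmult_r_distr:
      "\<lbrakk>x \<in> carrier M; a \<in> carrier A; c \<in> carrier A\<rbrakk> \<Longrightarrow>
       x \<odot>\<^sub>r\<^bsub>M\<^esub> (a \<oplus>\<^bsub>A\<^esub> c) = x \<odot>\<^sub>r\<^bsub>M\<^esub> a \<oplus>\<^bsub>M\<^esub> x \<odot>\<^sub>r\<^bsub>M\<^esub> c"
    and rsmult_l_distr:
      "\<lbrakk>x \<in> carrier M; y \<in> carrier M; a \<in> carrier A\<rbrakk> \<Longrightarrow>
       (x \<oplus>\<^bsub>M\<^esub> y) \<odot>\<^sub>r\<^bsub>M\<^esub> a = x \<odot>\<^sub>r\<^bsub>M\<^esub> a \<oplus>\<^bsub>M\<^esub> y \<odot>\<^sub>r\<^bsub>M\<^esub> a"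
    and rsmult_assoc:
      "\<lbrakk>x \<in> carrier M; a \<in> carrier A; c \<in> carrier A\<rbrakk> \<Longrightarrow>
       x \<odot>\<^sub>r\<^bsub>M\<^esub> (a \<otimes>\<^bsub>A\<^esub> c) = (x \<odot>\<^sub>r\<^bsub>M\<^esub> a) \<odot>\<^sub>r\<^bsub>M\<^esub> c"
    and rsmult_one:
      "x \<in> carrier M \<Longrightarrow> x \<odot>\<^sub>r\<^bsub>M\<^esub> \<one>\<^bsub>A\<^esub> = x"

locale bimodule = left_module B M + right_module A M
  for B :: "('b, 'r) ring_scheme" (structure) and A :: "('a, 'q) ring_scheme" (structure)
    and M :: "('b, 'a, 'm, 's) bimodule_scheme" (structure) +
  assumes smult_rsmult_assoc:
      "\<lbrakk>b \<in> carrier B; x \<in> carrier M; a \<in> carrier A\<rbrakk> \<Longrightarrow>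
       (b \<odot>\<^bsub>M\<^esub> x) \<odot>\<^sub>r\<^bsub>M\<^esub> a = b \<odot>\<^bsub>M\<^esub> (x \<odot>\<^sub>r\<^bsub>M\<^esub> a)"

section \<open>Homomorphisms and isomorphisms\<close>

text \<open>
  Homomorphisms are extensional (\<open>undefined\<close> outside the carrier), so that equality of
  homomorphisms is equality of functions and Hom-sets can serve as carriers.
\<close>

definition left_hom ::
  "('b, 'r) ring_scheme \<Rightarrow> ('b, 'm, 's) module_scheme \<Rightarrow> ('b, 'n, 't) module_scheme \<Rightarrow> ('m \<Rightarrow> 'n) set"
  where "left_hom B M N =
    {f \<in> carrier M \<rightarrow>\<^sub>E carrier N.
       (\<forall>x\<in>carrier M. \<forall>y\<in>carrier M. f (x \<oplus>\<^bsub>M\<^esub> y) = f x \<oplus>\<^bsub>N\<^esub> f y) \<and>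
       (\<forall>b\<in>carrier B. \<forall>x\<in>carrier M. f (b \<odot>\<^bsub>M\<^esub> x) = b \<odot>\<^bsub>N\<^esub> f x)}"

definition right_hom ::
  "('a, 'r) ring_scheme \<Rightarrow> ('b, 'a, 'm, 's) bimodule_scheme \<Rightarrow> ('c, 'a, 'n, 't) bimodule_scheme
    \<Rightarrow> ('m \<Rightarrow> 'n) set"
  where "right_hom A M N =
    {f \<in> carrier M \<rightarrow>\<^sub>E carrier N.
       (\<forall>x\<in>carrier M. \<forall>y\<in>carrier M. f (x \<oplus>\<^bsub>M\<^esub> y) = f x \<oplus>\<^bsub>N\<^esub> f y) \<and>
       (\<forall>a\<in>carrier A. \<forall>x\<in>carrier M. f (x \<odot>\<^sub>r\<^bsub>M\<^esub> a) = f x \<odot>\<^sub>r\<^bsub>N\<^esub> a)}"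

definition left_isomorphic ::
  "('b, 'r) ring_scheme \<Rightarrow> ('b, 'm, 's) module_scheme \<Rightarrow> ('b, 'n, 't) module_scheme \<Rightarrow> bool"
  where "left_isomorphic B M N \<longleftrightarrow>
    (\<exists>h \<in> left_hom B M N. bij_betw h (carrier M) (carrier N))"

definition right_isomorphic ::
  "('a, 'r) ring_scheme \<Rightarrow> ('b, 'a, 'm, 's) bimodule_scheme \<Rightarrow> ('c, 'a, 'n, 't) bimodule_scheme \<Rightarrow> bool"
  where "right_isomorphic A M N \<longleftrightarrow>
    (\<exists>h \<in> right_hom A M N. bij_betw h (carrier M) (carrier N))"

definition bimod_isomorphic ::
  "('b, 'r) ring_scheme \<Rightarrow> ('a, 'q) ring_scheme \<Rightarrow> ('b, 'a, 'm, 's) bimodule_scheme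
    \<Rightarrow> ('b, 'a, 'n, 't) bimodule_scheme \<Rightarrow> bool"
  where "bimod_isomorphic B A M N \<longleftrightarrow>
    (\<exists>h \<in> left_hom B M N \<inter> right_hom A M N. bij_betw h (carrier M) (carrier N))"

section \<open>Direct sums and divisibility\<close>

definition dsum ::
  "('b, 'a, 'm, 's) bimodule_scheme \<Rightarrow> ('b, 'a, 'n, 't) bimodule_scheme \<Rightarrow> ('b, 'a, 'm \<times> 'n) bimodule"
  where "dsum M N = \<lparr>
    carrier = carrier M \<times> carrier N,
    mult = undefined, one = undefined,
    zero = (\<zero>\<^bsub>M\<^esub>, \<zero>\<^bsub>N\<^esub>),
    add = (\<lambda>(x, y) (x', y'). (x \<oplus>\<^bsub>M\<^esub> x', y \<oplus>\<^bsub>N\<^esub> y')),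
    smult = (\<lambda>b (x, y). (b \<odot>\<^bsub>M\<^esub> x, b \<odot>\<^bsub>N\<^esub> y)),
    rsmult = (\<lambda>(x, y) a. (x \<odot>\<^sub>r\<^bsub>M\<^esub> a, y \<odot>\<^sub>r\<^bsub>N\<^esub> a)) \<rparr>"

text \<open>The direct sum of copies of \<open>M\<close> indexed by \<open>I\<close>; the carrier follows \<open>sum_group\<close>.\<close>

definition copies ::
  "'i set \<Rightarrow> ('b, 'a, 'm, 's) bimodule_scheme \<Rightarrow> ('b, 'a, 'i \<Rightarrow> 'm) bimodule"
  where "copies I M = \<lparr>
    carrier = {f \<in> I \<rightarrow>\<^sub>E carrier M. finite {i \<in> I. f i \<noteq> \<zero>\<^bsub>M\<^esub>}},
    mult = undefined, one = undefined,
    zero = (\<lambda>i\<in>I. \<zero>\<^bsub>M\<^esub>),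
    add = (\<lambda>f g. \<lambda>i\<in>I. f i \<oplus>\<^bsub>M\<^esub> g i),
    smult = (\<lambda>b f. \<lambda>i\<in>I. b \<odot>\<^bsub>M\<^esub> f i),
    rsmult = (\<lambda>f a. \<lambda>i\<in>I. f i \<odot>\<^sub>r\<^bsub>M\<^esub> a) \<rparr>"

text \<open>
  A complement of \<open>X\<close> in \<open>Y\<^sup>(\<^sup>n\<^sup>)\<close> is isomorphic to a sub-bimodule of \<open>Y\<^sup>(\<^sup>n\<^sup>)\<close>, so nothing is lost by
  letting \<open>P\<close> live on the type of elements of \<open>Y\<^sup>(\<^sup>n\<^sup>)\<close>.
\<close>

definition bimod_divides ::
  "('b, 'r) ring_scheme \<Rightarrow> ('a, 'q) ring_scheme \<Rightarrow> ('b, 'a, 'x, 's) bimodule_scheme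
    \<Rightarrow> ('b, 'a, 'y, 't) bimodule_scheme \<Rightarrow> bool"
  where "bimod_divides B A X Y \<longleftrightarrow>
    (\<exists>(n::nat) (P :: ('b, 'a, nat \<Rightarrow> 'y) bimodule).
       bimodule B A P \<and> bimod_isomorphic B A (dsum X P) (copies {..<n} Y))"

definition bimod_similar ::
  "('b, 'r) ring_scheme \<Rightarrow> ('a, 'q) ring_scheme \<Rightarrow> ('b, 'a, 'x, 's) bimodule_scheme
    \<Rightarrow> ('b, 'a, 'y, 't) bimodule_scheme \<Rightarrow> bool"
  where "bimod_similar B A X Y \<longleftrightarrow> bimod_divides B A X Y \<and> bimod_divides B A Y X"

section \<open>Rings as bimodules\<close>

text \<open>
  \<open>via_bimod \<phi> \<psi> A\<close> is the ring \<open>A\<close> with scalars acting on the left through \<open>\<phi>\<close> and on the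
  right through \<open>\<psi>\<close>.
\<close>

definition via_bimod ::
  "('b \<Rightarrow> 'a) \<Rightarrow> ('c \<Rightarrow> 'a) \<Rightarrow> ('a, 'r) ring_scheme \<Rightarrow> ('b, 'c, 'a) bimodule"
  where "via_bimod \<phi> \<psi> A = \<lparr>
    carrier = carrier A, mult = undefined, one = undefined, zero = \<zero>\<^bsub>A\<^esub>, add = add A,
    smult = (\<lambda>b x. \<phi> b \<otimes>\<^bsub>A\<^esub> x),
    rsmult = (\<lambda>x c. x \<otimes>\<^bsub>A\<^esub> \<psi> c) \<rparr>"

abbreviation regular :: "('a, 'r) ring_scheme \<Rightarrow> ('a, 'a, 'a) bimodule"
  where "regular A \<equiv> via_bimod id id A"

section \<open>Finitely generated and projective modules\<close>

definition left_fin_gen :: "('b, 'r) ring_scheme \<Rightarrow> ('b, 'm, 's) module_scheme \<Rightarrow> bool"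
  where "left_fin_gen B M \<longleftrightarrow>
    (\<exists>G. finite G \<and> G \<subseteq> carrier M \<and>
       (\<forall>x\<in>carrier M. \<exists>c \<in> G \<rightarrow> carrier B. x = (\<Oplus>\<^bsub>M\<^esub>g\<in>G. c g \<odot>\<^bsub>M\<^esub> g)))"

definition right_fin_gen :: "('a, 'r) ring_scheme \<Rightarrow> ('b, 'a, 'm, 's) bimodule_scheme \<Rightarrow> bool"
  where "right_fin_gen A M \<longleftrightarrow>
    (\<exists>G. finite G \<and> G \<subseteq> carrier M \<and>
       (\<forall>x\<in>carrier M. \<exists>c \<in> G \<rightarrow> carrier A. x = (\<Oplus>\<^bsub>M\<^esub>g\<in>G. g \<odot>\<^sub>r\<^bsub>M\<^esub> c g)))"

text \<open>
  Projective means: direct summand of a free module. If \<open>M\<close> is projective, it is a summand of the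
  free module on its own elements, and the complement embeds in that module, so the types of
  \<open>I\<close> and \<open>Q\<close> are no restriction.
\<close>

definition left_projective :: "('b, 'r) ring_scheme \<Rightarrow> ('b, 'a, 'm, 's) bimodule_scheme \<Rightarrow> bool"
  where "left_projective B M \<longleftrightarrow>
    (\<exists>(I :: 'm set) (Q :: ('b, 'a, 'm \<Rightarrow> 'b) bimodule).
       left_module B Q \<and> left_isomorphic B (dsum M Q) (copies I (regular B)))"

definition right_projective :: "('a, 'r) ring_scheme \<Rightarrow> ('b, 'a, 'm, 's) bimodule_scheme \<Rightarrow> bool"
  where "right_projective A M \<longleftrightarrow>
    (\<exists>(I :: 'm set) (Q :: ('b, 'a, 'm \<Rightarrow> 'a) bimodule).
       right_module A Q \<and> right_isomorphic A (dsum M Q) (copies I (regular A)))"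

section \<open>Duals and endomorphisms\<close>

definition left_dual ::
  "('b, 'r) ring_scheme \<Rightarrow> ('b, 'a, 'm, 's) bimodule_scheme \<Rightarrow> ('a, 'b, 'm \<Rightarrow> 'b) bimodule"
  where "left_dual B M = \<lparr>
    carrier = left_hom B M (regular B),
    mult = undefined, one = undefined,
    zero = (\<lambda>m\<in>carrier M. \<zero>\<^bsub>B\<^esub>),
    add = (\<lambda>f g. \<lambda>m\<in>carrier M. f m \<oplus>\<^bsub>B\<^esub> g m),
    smult = (\<lambda>a f. \<lambda>m\<in>carrier M. f (m \<odot>\<^sub>r\<^bsub>M\<^esub> a)),
    rsmult = (\<lambda>f b. \<lambda>m\<in>carrier M. f m \<otimes>\<^bsub>B\<^esub> b) \<rparr>"

definition right_dual ::
  "('a, 'r) ring_scheme \<Rightarrow> ('b, 'a, 'm, 's) bimodule_scheme \<Rightarrow> ('a, 'b, 'm \<Rightarrow> 'a) bimodule"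
  where "right_dual A M = \<lparr>
    carrier = right_hom A M (regular A),
    mult = undefined, one = undefined,
    zero = (\<lambda>m\<in>carrier M. \<zero>\<^bsub>A\<^esub>),
    add = (\<lambda>f g. \<lambda>m\<in>carrier M. f m \<oplus>\<^bsub>A\<^esub> g m),
    smult = (\<lambda>a g. \<lambda>m\<in>carrier M. a \<otimes>\<^bsub>A\<^esub> g m),
    rsmult = (\<lambda>g b. \<lambda>m\<in>carrier M. g (b \<odot>\<^bsub>M\<^esub> m)) \<rparr>"

definition right_End ::
  "('a, 'r) ring_scheme \<Rightarrow> ('b, 'a, 'm, 's) bimodule_scheme \<Rightarrow> ('m \<Rightarrow> 'm) ring"
  where "right_End A M = \<lparr>
    carrier = right_hom A M M,
    mult = compose (carrier M),
    one = (\<lambda>m\<in>carrier M. m),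
    zero = (\<lambda>m\<in>carrier M. \<zero>\<^bsub>M\<^esub>),
    add = (\<lambda>f g. \<lambda>m\<in>carrier M. f m \<oplus>\<^bsub>M\<^esub> g m) \<rparr>"

definition left_mult_map :: "('b, 'm, 's) module_scheme \<Rightarrow> 'b \<Rightarrow> 'm \<Rightarrow> 'm"
  where "left_mult_map M b = (\<lambda>m\<in>carrier M. b \<odot>\<^bsub>M\<^esub> m)"

section \<open>Quasi-Frobenius bimodules and extensions\<close>

definition QF_bimodule ::
  "('b, 'r) ring_scheme \<Rightarrow> ('a, 'q) ring_scheme \<Rightarrow> ('b, 'a, 'm, 's) bimodule_scheme \<Rightarrow> bool"
  where "QF_bimodule B A M \<longleftrightarrow>
    bimodule B A M \<and>
    left_fin_gen B M \<and> left_projective B M \<and>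
    right_fin_gen A M \<and> right_projective A M \<and>
    bimod_similar A B (left_dual B M) (right_dual A M)"

text \<open>
  For an extension \<open>\<phi>: B \<rightarrow> A\<close>, the left dual is that of \<open>A\<close> as a \<open>(B, A)\<close>-bimodule and the
  right dual is that of \<open>A\<close> as an \<open>(A, B)\<close>-bimodule.
\<close>

definition left_QF_extension ::
  "('b, 'r) ring_scheme \<Rightarrow> ('a, 'q) ring_scheme \<Rightarrow> ('b \<Rightarrow> 'a) \<Rightarrow> bool"
  where "left_QF_extension B A \<phi> \<longleftrightarrow>
    ring_hom_ring B A \<phi> \<and>
    left_fin_gen B (via_bimod \<phi> id A) \<and> left_projective B (via_bimod \<phi> id A) \<and>
    bimod_divides A B (via_bimod id \<phi> A) (left_dual B (via_bimod \<phi> id A))"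

definition right_QF_extension ::
  "('b, 'r) ring_scheme \<Rightarrow> ('a, 'q) ring_scheme \<Rightarrow> ('b \<Rightarrow> 'a) \<Rightarrow> bool"
  where "right_QF_extension B A \<phi> \<longleftrightarrow>
    ring_hom_ring B A \<phi> \<and>
    right_fin_gen B (via_bimod id \<phi> A) \<and> right_projective B (via_bimod id \<phi> A) \<and>
    bimod_divides B A (via_bimod \<phi> id A) (right_dual B (via_bimod id \<phi> A))"

definition QF_extension ::
  "('b, 'r) ring_scheme \<Rightarrow> ('a, 'q) ring_scheme \<Rightarrow> ('b \<Rightarrow> 'a) \<Rightarrow> bool"
  where "QF_extension B A \<phi> \<longleftrightarrow> left_QF_extension B A \<phi> \<and> right_QF_extension B A \<phi>"

end

theory Submission
  imports Defs
begin

text \<open>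
  Since \<open>M\<close> is finitely generated projective over \<open>A\<close>, \<open>E = M \<otimes>\<^sub>A M\<^sup>*\<close> is spanned by the maps
  \<open>T m f = m f(-)\<close>, so an additive map on \<open>E\<close> is determined by its values on them. A homomorphism
  \<open>s\<close> from the right dual \<open>M\<^sup>*\<close> to the left dual \<open>\<^sup>*M\<close> sends \<open>e \<in> E\<close> to the functional
  \<open>T m f \<mapsto> s (f e) m\<close> in the left dual of \<open>E\<close>. A homomorphism \<open>t\<close> in the other direction sends a
  functional \<open>\<phi>\<close> on \<open>E\<close> to the endomorphism \<open>e\<close> with \<open>f e = t (m \<mapsto> \<phi> (T m f))\<close> for all \<open>f \<in> M\<^sup>*\<close>.
  If \<open>\<Sum> t\<^sub>i s\<^sub>i = id\<close>, then the induced composites add up to the identity of \<open>E\<close>. Similarly,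
  \<open>v : M\<^sup>* \<rightarrow> \<^sup>*M\<close> and \<open>u : \<^sup>*M \<rightarrow> M\<^sup>*\<close> with \<open>\<Sum> v\<^sub>i u\<^sub>i = id\<close> exhibit \<open>E\<close> as a summand of a power of its
  right dual, through \<open>T m f \<mapsto> v f (e m)\<close> and \<open>d (e m) = \<gamma> (T m (u d))\<close> for \<open>d \<in> \<^sup>*M\<close>.
\<close>

subsection \<open>Additive maps\<close>

text \<open>Composition identifies \<open>E\<close> with the left \<open>A\<close>-linear maps from
  the right dual of \<open>M\<close> to itself, and currying identifies the left dual of
  \<open>E\<close> with those from the right dual to the left dual of \<open>M\<close>. The left
  half is thus an additive covariant functor applied to the divisibility of right dual by left dual.
  The right half is contravariant: \<open>M\<close> is reflexive over \<open>B\<close>, hence the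
  right \<open>B\<close>-dual of its left dual, so \<open>E\<close> and its right dual are the right
  \<open>A\<close>-linear maps from \<open>M\<close> into the right \<open>B\<close>-duals of the
  left and of the right dual of \<open>M\<close>. This is why it consumes the opposite divisibility.
  No tensor product is formed. A map on \<open>E\<close> is written as a finite sum over a dual
  basis of \<open>M\<close>, and its value on \<open>T m f\<close> shows that the choice of basis
  does not matter. Finiteness is asymmetric: on the left, \<open>E\<close> is a summand of a power
  of \<open>M\<close>; on the right, of a power of the right dual, whose finiteness over
  \<open>B\<close> comes through its divisibility into the left dual.\<close>

definition add_hom :: "('m, 's) ring_scheme \<Rightarrow> ('n, 't) ring_scheme \<Rightarrow> ('m \<Rightarrow> 'n) set"
  where "add_hom M N = {f \<in> carrier M \<rightarrow> carrier N.
    \<forall>x\<in>carrier M. \<forall>y\<in>carrier M. f (x \<oplus>\<^bsub>M\<^esub> y) = f x \<oplus>\<^bsub>N\<^esub> f y}"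

lemma add_homI:
  assumes "\<And>x. x \<in> carrier M \<Longrightarrow> f x \<in> carrier N"
    and "\<And>x y. \<lbrakk>x \<in> carrier M; y \<in> carrier M\<rbrakk> \<Longrightarrow> f (x \<oplus>\<^bsub>M\<^esub> y) = f x \<oplus>\<^bsub>N\<^esub> f y"
  shows "f \<in> add_hom M N"
  using assms by (auto simp: add_hom_def)

lemma add_hom_closed: "\<lbrakk>f \<in> add_hom M N; x \<in> carrier M\<rbrakk> \<Longrightarrow> f x \<in> carrier N"
  and add_hom_add: "\<lbrakk>f \<in> add_hom M N; x \<in> carrier M; y \<in> carrier M\<rbrakk> \<Longrightarrow>
    f (x \<oplus>\<^bsub>M\<^esub> y) = f x \<oplus>\<^bsub>N\<^esub> f y"
  by (auto simp: add_hom_def)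

lemma add_hom_zero:
  assumes "abelian_group M" "abelian_group N" and f: "f \<in> add_hom M N"
  shows "f \<zero>\<^bsub>M\<^esub> = \<zero>\<^bsub>N\<^esub>"
proof -
  interpret M: abelian_group M by fact
  interpret N: abelian_group N by fact
  have "f \<zero>\<^bsub>M\<^esub> \<oplus>\<^bsub>N\<^esub> f \<zero>\<^bsub>M\<^esub> = f \<zero>\<^bsub>M\<^esub>"
    using add_hom_add[OF f, of "\<zero>\<^bsub>M\<^esub>" "\<zero>\<^bsub>M\<^esub>"] by simp
  then show ?thesis
    using add_hom_closed[OF f M.zero_closed] N.add.l_cancel_one by blast
qed

lemma add_hom_neg:
  assumes "abelian_group M" "abelian_group N" and f: "f \<in> add_hom M N" and x: "x \<in> carrier M"
  shows "f (\<ominus>\<^bsub>M\<^esub> x) = \<ominus>\<^bsub>N\<^esub> f x"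
proof -
  interpret M: abelian_group M by fact
  interpret N: abelian_group N by fact
  have "f (\<ominus>\<^bsub>M\<^esub> x) \<oplus>\<^bsub>N\<^esub> f x = \<zero>\<^bsub>N\<^esub>"
    using add_hom_add[OF f, of "\<ominus>\<^bsub>M\<^esub> x" x] add_hom_zero[OF assms(1-3)] x by (simp add: M.l_neg)
  then show ?thesis
    using add_hom_closed[OF f] x by (metis M.a_inv_closed N.minus_equality)
qed

text \<open>Every interchange of a map with a dual basis sum is an instance of this. Members of
  \<open>add_hom\<close> need not be extensional, so evaluations and scalar actions can be plugged
  in as plain lambda terms.\<close>

lemma add_hom_finsum:
  assumes "abelian_group M" "abelian_group N" and f: "f \<in> add_hom M N"
    and "g \<in> I \<rightarrow> carrier M"
  shows "f (\<Oplus>\<^bsub>M\<^esub>i\<in>I. g i) = (\<Oplus>\<^bsub>N\<^esub>i\<in>I. f (g i))"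
proof -
  interpret M: abelian_group M by fact
  interpret N: abelian_group N by fact
  note zero = add_hom_zero[OF assms(1-3)]
  show ?thesis using assms(4)
  \<comment> \<open>For infinite \<open>I\<close> both sums are zero by convention, so no finiteness
    has to be carried along.\<close>
  proof (induction I rule: infinite_finite_induct)
    case (insert i I)
    then have "g i \<in> carrier M" "g \<in> I \<rightarrow> carrier M" "(\<lambda>i. f (g i)) \<in> I \<rightarrow> carrier N" "f (g i) \<in> carrier N"
      using add_hom_closed[OF f] by auto
    with insert show ?case
      by (simp add: M.finsum_insert N.finsum_insert add_hom_add[OF f])
  qed (auto simp: zero)
qed

lemma finsum_eqI:
  assumes "abelian_group M" "\<And>i. i \<in> I \<Longrightarrow> f i = g i" "\<And>i. i \<in> I \<Longrightarrow> g i \<in> carrier M"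
  shows "(\<Oplus>\<^bsub>M\<^esub>i\<in>I. f i) = (\<Oplus>\<^bsub>M\<^esub>i\<in>I. g i)"
proof -
  interpret abelian_group M by fact
  show ?thesis using assms(2,3) by (intro finsum_cong') auto
qed

lemma abelian_group_cong:
  assumes "abelian_group R" "carrier S = carrier R" "add S = add R" "zero S = zero R"
  shows "abelian_group S"
  using assms(2-4) abelian_groupE[OF assms(1)] by (intro abelian_groupI) auto

text \<open>\<open>finsum\<close> reads only these three fields, so sums in \<open>opp_mod M\<close>
  or \<open>via_bimod\<close> are sums in the underlying group.\<close>

lemma finsum_record_cong:
  assumes "carrier S = carrier R" "add S = add R" "zero S = zero R"
  shows "finsum S = finsum R"
  using assms by (intro ext) (simp add: finsum_def finprod_def)

text \<open>Duals, endomorphism rings and \<open>copies\<close> all carry pointwise addition.\<close>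

lemma pointwise_abelian_group:
  assumes "abelian_group N" and sub: "carrier R \<subseteq> S \<rightarrow>\<^sub>E carrier N"
    and add: "\<And>f g. \<lbrakk>f \<in> carrier R; g \<in> carrier R\<rbrakk> \<Longrightarrow> f \<oplus>\<^bsub>R\<^esub> g = (\<lambda>m\<in>S. f m \<oplus>\<^bsub>N\<^esub> g m)"
    and zero: "\<zero>\<^bsub>R\<^esub> = (\<lambda>m\<in>S. \<zero>\<^bsub>N\<^esub>)"
    and cl: "\<And>f g. \<lbrakk>f \<in> carrier R; g \<in> carrier R\<rbrakk> \<Longrightarrow> (\<lambda>m\<in>S. f m \<oplus>\<^bsub>N\<^esub> g m) \<in> carrier R"
    and z: "(\<lambda>m\<in>S. \<zero>\<^bsub>N\<^esub>) \<in> carrier R"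
    and neg: "\<And>f. f \<in> carrier R \<Longrightarrow> (\<lambda>m\<in>S. \<ominus>\<^bsub>N\<^esub> f m) \<in> carrier R"
  shows "abelian_group R"
proof -
  interpret N: abelian_group N by fact
  have val: "f m \<in> carrier N" if "f \<in> carrier R" "m \<in> S" for f m
    using that sub by auto
  have ext: "f m = undefined" if "f \<in> carrier R" "m \<notin> S" for f m
    using that sub by (auto simp: PiE_def extensional_def)
  show ?thesis
  proof (rule abelian_groupI)
    fix f g assume fg: "f \<in> carrier R" "g \<in> carrier R"
    show "f \<oplus>\<^bsub>R\<^esub> g \<in> carrier R" using fg cl by (simp add: add)
    show "f \<oplus>\<^bsub>R\<^esub> g = g \<oplus>\<^bsub>R\<^esub> f"
      using fg by (auto simp: add val fun_eq_iff N.a_comm)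
    fix h assume h: "h \<in> carrier R"
    show "f \<oplus>\<^bsub>R\<^esub> g \<oplus>\<^bsub>R\<^esub> h = f \<oplus>\<^bsub>R\<^esub> (g \<oplus>\<^bsub>R\<^esub> h)"
      using fg h by (auto simp: add cl val fun_eq_iff N.a_assoc)
  next
    show "\<zero>\<^bsub>R\<^esub> \<in> carrier R" using z by (simp add: zero)
    fix f assume f: "f \<in> carrier R"
    show "\<zero>\<^bsub>R\<^esub> \<oplus>\<^bsub>R\<^esub> f = f"
      using f z by (auto simp: add zero val ext fun_eq_iff)
    show "\<exists>g\<in>carrier R. g \<oplus>\<^bsub>R\<^esub> f = \<zero>\<^bsub>R\<^esub>"
      using f by (intro bexI[OF _ neg[OF f]]) (auto simp: add zero neg val fun_eq_iff N.l_neg)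
  qed
qed

subsection \<open>Homomorphisms of modules\<close>

lemma left_homD:
  assumes "f \<in> left_hom B M N"
  shows left_hom_add_hom: "f \<in> add_hom M N"
    and left_hom_closed: "x \<in> carrier M \<Longrightarrow> f x \<in> carrier N"
    and left_hom_add: "\<lbrakk>x \<in> carrier M; y \<in> carrier M\<rbrakk> \<Longrightarrow> f (x \<oplus>\<^bsub>M\<^esub> y) = f x \<oplus>\<^bsub>N\<^esub> f y"
    and left_hom_smult: "\<lbrakk>b \<in> carrier B; x \<in> carrier M\<rbrakk> \<Longrightarrow> f (b \<odot>\<^bsub>M\<^esub> x) = b \<odot>\<^bsub>N\<^esub> f x"
    and left_hom_extensional: "f \<in> extensional (carrier M)"
  using assms by (auto simp: left_hom_def add_hom_def PiE_def)

lemma right_homD: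
  assumes "f \<in> right_hom A M N"
  shows right_hom_add_hom: "f \<in> add_hom M N"
    and right_hom_closed: "x \<in> carrier M \<Longrightarrow> f x \<in> carrier N"
    and right_hom_add: "\<lbrakk>x \<in> carrier M; y \<in> carrier M\<rbrakk> \<Longrightarrow> f (x \<oplus>\<^bsub>M\<^esub> y) = f x \<oplus>\<^bsub>N\<^esub> f y"
    and right_hom_rsmult: "\<lbrakk>x \<in> carrier M; a \<in> carrier A\<rbrakk> \<Longrightarrow> f (x \<odot>\<^sub>r\<^bsub>M\<^esub> a) = f x \<odot>\<^sub>r\<^bsub>N\<^esub> a"
    and right_hom_extensional: "f \<in> extensional (carrier M)"
  using assms by (auto simp: right_hom_def add_hom_def PiE_def)

lemma left_homI:
  assumes "left_module B M"
    and "\<And>x. x \<in> carrier M \<Longrightarrow> f x \<in> carrier N"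
    and "\<And>x y. \<lbrakk>x \<in> carrier M; y \<in> carrier M\<rbrakk> \<Longrightarrow> f (x \<oplus>\<^bsub>M\<^esub> y) = f x \<oplus>\<^bsub>N\<^esub> f y"
    and "\<And>b x. \<lbrakk>b \<in> carrier B; x \<in> carrier M\<rbrakk> \<Longrightarrow> f (b \<odot>\<^bsub>M\<^esub> x) = b \<odot>\<^bsub>N\<^esub> f x"
  shows "(\<lambda>x\<in>carrier M. f x) \<in> left_hom B M N"
proof -
  interpret left_module B M by fact
  show ?thesis
    using assms(2-) by (auto simp: left_hom_def lsmult_closed)
qed

lemma right_homI:
  assumes "right_module A M"
    and "\<And>x. x \<in> carrier M \<Longrightarrow> f x \<in> carrier N"
    and "\<And>x y. \<lbrakk>x \<in> carrier M; y \<in> carrier M\<rbrakk> \<Longrightarrow> f (x \<oplus>\<^bsub>M\<^esub> y) = f x \<oplus>\<^bsub>N\<^esub> f y"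
    and "\<And>a x. \<lbrakk>a \<in> carrier A; x \<in> carrier M\<rbrakk> \<Longrightarrow> f (x \<odot>\<^sub>r\<^bsub>M\<^esub> a) = f x \<odot>\<^sub>r\<^bsub>N\<^esub> a"
  shows "(\<lambda>x\<in>carrier M. f x) \<in> right_hom A M N"
proof -
  interpret right_module A M by fact
  show ?thesis
    using assms(2-) by (auto simp: right_hom_def rsmult_closed)
qed

lemma (in left_module) smult_add_hom: "b \<in> carrier B \<Longrightarrow> (\<lambda>x. b \<odot>\<^bsub>M\<^esub> x) \<in> add_hom M M"
  by (auto intro!: add_homI lsmult_closed lsmult_r_distr)

lemma (in left_module) smult_add_hom_scalar: "x \<in> carrier M \<Longrightarrow> (\<lambda>b. b \<odot>\<^bsub>M\<^esub> x) \<in> add_hom B M"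
  by (auto intro!: add_homI lsmult_closed lsmult_l_distr)

lemma (in right_module) rsmult_add_hom: "a \<in> carrier A \<Longrightarrow> (\<lambda>x. x \<odot>\<^sub>r\<^bsub>M\<^esub> a) \<in> add_hom M M"
  by (auto intro!: add_homI rsmult_closed rsmult_l_distr)

lemma (in left_module) smult_zero: "b \<in> carrier B \<Longrightarrow> b \<odot>\<^bsub>M\<^esub> \<zero>\<^bsub>M\<^esub> = \<zero>\<^bsub>M\<^esub>"
  using add_hom_zero[OF M.abelian_group_axioms M.abelian_group_axioms smult_add_hom] by simp

lemma (in left_module) zero_smult: "x \<in> carrier M \<Longrightarrow> \<zero>\<^bsub>B\<^esub> \<odot>\<^bsub>M\<^esub> x = \<zero>\<^bsub>M\<^esub>"
  using add_hom_zero[OF B.abelian_group_axioms M.abelian_group_axioms smult_add_hom_scalar] by simp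

lemma (in right_module) rsmult_zero: "a \<in> carrier A \<Longrightarrow> \<zero>\<^bsub>M\<^esub> \<odot>\<^sub>r\<^bsub>M\<^esub> a = \<zero>\<^bsub>M\<^esub>"
  using add_hom_zero[OF M.abelian_group_axioms M.abelian_group_axioms rsmult_add_hom] by simp

lemma (in right_module) rsmult_neg:
  "\<lbrakk>a \<in> carrier A; x \<in> carrier M\<rbrakk> \<Longrightarrow> (\<ominus>\<^bsub>M\<^esub> x) \<odot>\<^sub>r\<^bsub>M\<^esub> a = \<ominus>\<^bsub>M\<^esub> (x \<odot>\<^sub>r\<^bsub>M\<^esub> a)"
  using add_hom_neg[OF M.abelian_group_axioms M.abelian_group_axioms rsmult_add_hom] by simp

subsection \<open>Opposite rings and modules\<close>

text \<open>Most right-handed statements below are left-handed ones read over this ring. The record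
  is rebuilt without extension fields, so taking opposites twice is not literally the
  identity.\<close>

definition opp_ring :: "('a, 'r) ring_scheme \<Rightarrow> 'a ring"
  where "opp_ring R = \<lparr>carrier = carrier R, mult = (\<lambda>x y. y \<otimes>\<^bsub>R\<^esub> x), one = \<one>\<^bsub>R\<^esub>,
    zero = \<zero>\<^bsub>R\<^esub>, add = add R\<rparr>"

definition opp_mod :: "('b, 'a, 'm, 's) bimodule_scheme \<Rightarrow> ('a, 'b, 'm) bimodule"
  where "opp_mod M = \<lparr>carrier = carrier M, mult = undefined, one = undefined,
    zero = \<zero>\<^bsub>M\<^esub>, add = add M, smult = (\<lambda>a x. x \<odot>\<^sub>r\<^bsub>M\<^esub> a), rsmult = (\<lambda>x b. b \<odot>\<^bsub>M\<^esub> x)\<rparr>"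

lemma opp_ring_simps [simp]:
  "carrier (opp_ring R) = carrier R" "x \<otimes>\<^bsub>opp_ring R\<^esub> y = y \<otimes>\<^bsub>R\<^esub> x" "\<one>\<^bsub>opp_ring R\<^esub> = \<one>\<^bsub>R\<^esub>"
  "\<zero>\<^bsub>opp_ring R\<^esub> = \<zero>\<^bsub>R\<^esub>" "add (opp_ring R) = add R"
  by (simp_all add: opp_ring_def)

lemma opp_mod_simps [simp]:
  "carrier (opp_mod M) = carrier M" "\<zero>\<^bsub>opp_mod M\<^esub> = \<zero>\<^bsub>M\<^esub>" "add (opp_mod M) = add M"
  "a \<odot>\<^bsub>opp_mod M\<^esub> x = x \<odot>\<^sub>r\<^bsub>M\<^esub> a" "x \<odot>\<^sub>r\<^bsub>opp_mod M\<^esub> b = b \<odot>\<^bsub>M\<^esub> x"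
  by (simp_all add: opp_mod_def)

lemma ring_opp_ring:
  assumes "ring R" shows "ring (opp_ring R)"
proof -
  interpret ring R by fact
  show ?thesis
    by (intro ringI abelian_group_cong[OF abelian_group_axioms] monoidI)
      (auto simp: m_assoc l_distr r_distr)
qed

lemma right_module_iff_opp:
  assumes "ring A"
  shows "right_module A M \<longleftrightarrow> left_module (opp_ring A) (opp_mod M)"
proof
  assume "right_module A M"
  then interpret right_module A M .
  show "left_module (opp_ring A) (opp_mod M)"
    by (intro left_module.intro left_module_axioms.intro ring_opp_ring
        abelian_group_cong[OF M.abelian_group_axioms] A.ring_axioms)
      (auto simp: rsmult_closed rsmult_r_distr rsmult_l_distr rsmult_assoc rsmult_one)
next
  assume "left_module (opp_ring A) (opp_mod M)"
  then interpret L: left_module "opp_ring A" "opp_mod M" .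
  have M: "abelian_group M"
    by (rule abelian_group_cong[OF L.M.abelian_group_axioms]) simp_all
  show "right_module A M"
    by (rule right_module.intro[OF assms M]; unfold_locales)
      (use L.lsmult_closed L.lsmult_l_distr L.lsmult_r_distr L.lsmult_assoc L.lsmult_one in auto)
qed

lemma right_hom_opp: "right_hom A M N = left_hom (opp_ring A) (opp_mod M) (opp_mod N)"
  by (simp add: right_hom_def left_hom_def)

lemma opp_mod_copies: "opp_mod (copies I M) = copies I (opp_mod M)"
  by (simp add: opp_mod_def copies_def)

lemma opp_mod_dsum: "opp_mod (dsum M N) = dsum (opp_mod M) (opp_mod N)"
  by (simp add: opp_mod_def dsum_def fun_eq_iff)

text \<open>An equality of records, because both constructions leave the same fields
  \<open>undefined\<close>. Free modules over \<open>opp_ring A\<close> can therefore simply be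
  rewritten.\<close>

lemma regular_opp_ring: "regular (opp_ring A) = opp_mod (regular A)"
  by (simp add: opp_mod_def via_bimod_def fun_eq_iff)

lemma right_isomorphic_opp:
  "right_isomorphic A M N \<longleftrightarrow> left_isomorphic (opp_ring A) (opp_mod M) (opp_mod N)"
  by (simp add: right_isomorphic_def left_isomorphic_def right_hom_opp)

lemma right_fin_gen_opp: "right_fin_gen A M \<longleftrightarrow> left_fin_gen (opp_ring A) (opp_mod M)"
  by (simp add: right_fin_gen_def left_fin_gen_def finsum_record_cong[of "opp_mod M" M])

lemma right_projective_opp:
  fixes A :: "('a, 'q) ring_scheme" and M :: "('b, 'a, 'c, 's) bimodule_scheme"
  assumes "ring A"
  shows "right_projective A M \<longleftrightarrow> left_projective (opp_ring A) (opp_mod M)"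
proof
  assume "right_projective A M"
  then obtain I :: "'c set" and Q :: "('b, 'a, 'c \<Rightarrow> 'a) bimodule"
    where "right_module A Q" "right_isomorphic A (dsum M Q) (copies I (regular A))"
    unfolding right_projective_def by blast
  then have "left_module (opp_ring A) (opp_mod Q)"
    "left_isomorphic (opp_ring A) (dsum (opp_mod M) (opp_mod Q)) (copies I (regular (opp_ring A)))"
    by (simp_all add: right_module_iff_opp[OF assms] right_isomorphic_opp opp_mod_dsum opp_mod_copies
        regular_opp_ring)
  then show "left_projective (opp_ring A) (opp_mod M)"
    unfolding left_projective_def by blast
next
  assume "left_projective (opp_ring A) (opp_mod M)"
  then obtain I :: "'c set" and Q :: "('a, 'b, 'c \<Rightarrow> 'a) bimodule"
    where Q: "left_module (opp_ring A) Q"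
      "left_isomorphic (opp_ring A) (dsum (opp_mod M) Q) (copies I (regular (opp_ring A)))"
    unfolding left_projective_def by blast
  interpret Q: left_module "opp_ring A" Q by fact
  \<comment> \<open>\<open>opp_mod (opp_mod Q)\<close> may differ from \<open>Q\<close>, since
    \<open>mult\<close> and \<open>one\<close> are reset to \<open>undefined\<close>. Hence the
    axioms are checked again, while the isomorphism is kept because \<open>dsum\<close> ignores
    those two fields of its arguments.\<close>
  have "left_module (opp_ring A) (opp_mod (opp_mod Q))"
    by (intro left_module.intro left_module_axioms.intro Q.B.ring_axioms
        abelian_group_cong[OF Q.M.abelian_group_axioms])
      (use Q.lsmult_closed Q.lsmult_l_distr Q.lsmult_r_distr Q.lsmult_assoc Q.lsmult_one in auto)
  then have "right_module A (opp_mod Q)"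
    by (simp add: right_module_iff_opp[OF assms])
  moreover have "dsum (opp_mod M) (opp_mod (opp_mod Q)) = dsum (opp_mod M) Q"
    by (simp add: dsum_def)
  then have "right_isomorphic A (dsum M (opp_mod Q)) (copies I (regular A))"
    using Q(2) by (simp add: right_isomorphic_opp opp_mod_dsum opp_mod_copies regular_opp_ring)
  ultimately show "right_projective A M"
    unfolding right_projective_def by blast
qed

subsection \<open>Copies and retracts\<close>

lemma copies_simps [simp]:
  "carrier (copies I M) = {f \<in> I \<rightarrow>\<^sub>E carrier M. finite {i \<in> I. f i \<noteq> \<zero>\<^bsub>M\<^esub>}}"
  "\<zero>\<^bsub>copies I M\<^esub> = (\<lambda>i\<in>I. \<zero>\<^bsub>M\<^esub>)"
  "f \<oplus>\<^bsub>copies I M\<^esub> g = (\<lambda>i\<in>I. f i \<oplus>\<^bsub>M\<^esub> g i)"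
  "b \<odot>\<^bsub>copies I M\<^esub> f = (\<lambda>i\<in>I. b \<odot>\<^bsub>M\<^esub> f i)"
  "f \<odot>\<^sub>r\<^bsub>copies I M\<^esub> a = (\<lambda>i\<in>I. f i \<odot>\<^sub>r\<^bsub>M\<^esub> a)"
  by (simp_all add: copies_def)

lemma dsum_simps [simp]:
  "carrier (dsum M N) = carrier M \<times> carrier N"
  "\<zero>\<^bsub>dsum M N\<^esub> = (\<zero>\<^bsub>M\<^esub>, \<zero>\<^bsub>N\<^esub>)"
  "(x, y) \<oplus>\<^bsub>dsum M N\<^esub> (x', y') = (x \<oplus>\<^bsub>M\<^esub> x', y \<oplus>\<^bsub>N\<^esub> y')"
  "b \<odot>\<^bsub>dsum M N\<^esub> (x, y) = (b \<odot>\<^bsub>M\<^esub> x, b \<odot>\<^bsub>N\<^esub> y)"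
  "(x, y) \<odot>\<^sub>r\<^bsub>dsum M N\<^esub> a = (x \<odot>\<^sub>r\<^bsub>M\<^esub> a, y \<odot>\<^sub>r\<^bsub>N\<^esub> a)"
  by (simp_all add: dsum_def)

lemma via_bimod_simps [simp]:
  "carrier (via_bimod \<phi> \<psi> R) = carrier R" "\<zero>\<^bsub>via_bimod \<phi> \<psi> R\<^esub> = \<zero>\<^bsub>R\<^esub>"
  "add (via_bimod \<phi> \<psi> R) = add R"
  "b \<odot>\<^bsub>via_bimod \<phi> \<psi> R\<^esub> x = \<phi> b \<otimes>\<^bsub>R\<^esub> x" "x \<odot>\<^sub>r\<^bsub>via_bimod \<phi> \<psi> R\<^esub> c = x \<otimes>\<^bsub>R\<^esub> \<psi> c"
  by (simp_all add: via_bimod_def)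

lemma abelian_group_copies:
  assumes "abelian_group M" shows "abelian_group (copies I M)"
proof -
  interpret M: abelian_group M by fact
  show ?thesis
  proof (rule pointwise_abelian_group[OF assms, where S = I])
    fix f g assume fg: "f \<in> carrier (copies I M)" "g \<in> carrier (copies I M)"
    have "finite {i \<in> I. f i \<oplus>\<^bsub>M\<^esub> g i \<noteq> \<zero>\<^bsub>M\<^esub>}"
      by (rule finite_subset[of _ "{i \<in> I. f i \<noteq> \<zero>\<^bsub>M\<^esub>} \<union> {i \<in> I. g i \<noteq> \<zero>\<^bsub>M\<^esub>}"]) (use fg in auto)
    then show "(\<lambda>i\<in>I. f i \<oplus>\<^bsub>M\<^esub> g i) \<in> carrier (copies I M)"
      using fg by (auto cong: conj_cong)
  next
    fix f assume f: "f \<in> carrier (copies I M)"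
    have "finite {i \<in> I. \<ominus>\<^bsub>M\<^esub> f i \<noteq> \<zero>\<^bsub>M\<^esub>}"
      by (rule finite_subset[of _ "{i \<in> I. f i \<noteq> \<zero>\<^bsub>M\<^esub>}"]) (use f in auto)
    then show "(\<lambda>i\<in>I. \<ominus>\<^bsub>M\<^esub> f i) \<in> carrier (copies I M)"
      using f by (auto cong: conj_cong)
  qed (auto cong: conj_cong)
qed

lemma left_module_copies:
  assumes "left_module B M" shows "left_module B (copies I M)"
proof -
  interpret left_module B M by fact
  interpret C: abelian_group "copies I M" by (rule abelian_group_copies) (rule M.abelian_group_axioms)
  show ?thesis
  proof (intro left_module.intro left_module_axioms.intro B.ring_axioms C.abelian_group_axioms)
    fix b f assume b: "b \<in> carrier B" and f: "f \<in> carrier (copies I M)"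
    have "finite {i \<in> I. b \<odot>\<^bsub>M\<^esub> f i \<noteq> \<zero>\<^bsub>M\<^esub>}"
      by (rule finite_subset[of _ "{i \<in> I. f i \<noteq> \<zero>\<^bsub>M\<^esub>}"]) (use f b in \<open>auto simp: smult_zero\<close>)
    then show "b \<odot>\<^bsub>copies I M\<^esub> f \<in> carrier (copies I M)"
      using f b by (auto simp: lsmult_closed PiE_iff cong: conj_cong)
    fix c assume c: "c \<in> carrier B"
    show "(b \<oplus>\<^bsub>B\<^esub> c) \<odot>\<^bsub>copies I M\<^esub> f = b \<odot>\<^bsub>copies I M\<^esub> f \<oplus>\<^bsub>copies I M\<^esub> c \<odot>\<^bsub>copies I M\<^esub> f"
      using f b c by (auto simp: fun_eq_iff lsmult_l_distr PiE_iff)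
    show "b \<otimes>\<^bsub>B\<^esub> c \<odot>\<^bsub>copies I M\<^esub> f = b \<odot>\<^bsub>copies I M\<^esub> (c \<odot>\<^bsub>copies I M\<^esub> f)"
      using f b c by (auto simp: fun_eq_iff lsmult_assoc PiE_iff)
  next
    fix b f g assume "b \<in> carrier B" "f \<in> carrier (copies I M)" "g \<in> carrier (copies I M)"
    then show "b \<odot>\<^bsub>copies I M\<^esub> (f \<oplus>\<^bsub>copies I M\<^esub> g) = b \<odot>\<^bsub>copies I M\<^esub> f \<oplus>\<^bsub>copies I M\<^esub> b \<odot>\<^bsub>copies I M\<^esub> g"
      by (auto simp: fun_eq_iff lsmult_r_distr PiE_iff)
  next
    fix f assume "f \<in> carrier (copies I M)"
    then show "\<one>\<^bsub>B\<^esub> \<odot>\<^bsub>copies I M\<^esub> f = f"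
      by (auto simp: fun_eq_iff lsmult_one PiE_iff extensional_def)
  qed
qed

lemma right_module_copies:
  assumes "right_module A M" shows "right_module A (copies I M)"
proof -
  interpret right_module A M by fact
  show ?thesis
    using left_module_copies[of "opp_ring A" "opp_mod M" I] assms
    by (simp add: right_module_iff_opp[OF A.ring_axioms] opp_mod_copies)
qed

lemma bimodule_copies:
  assumes "bimodule B A M" shows "bimodule B A (copies I M)"
proof -
  interpret bimodule B A M by fact
  show ?thesis
    by (intro bimodule.intro bimodule_axioms.intro left_module_copies right_module_copies
        left_module_axioms right_module_axioms)
      (auto simp: fun_eq_iff smult_rsmult_assoc PiE_iff)
qed

section \<open>Coordinate maps into and out of a sum of copies\<close>

definition copies_proj :: "'i set \<Rightarrow> ('m, 's) ring_scheme \<Rightarrow> 'i \<Rightarrow> ('i \<Rightarrow> 'm) \<Rightarrow> 'm"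
  where "copies_proj I M i = (\<lambda>f\<in>{f \<in> I \<rightarrow>\<^sub>E carrier M. finite {i \<in> I. f i \<noteq> \<zero>\<^bsub>M\<^esub>}}. f i)"

definition copies_inj :: "'i set \<Rightarrow> ('m, 's) ring_scheme \<Rightarrow> 'i \<Rightarrow> 'm \<Rightarrow> ('i \<Rightarrow> 'm)"
  where "copies_inj I M i = (\<lambda>x\<in>carrier M. \<lambda>j\<in>I. if j = i then x else \<zero>\<^bsub>M\<^esub>)"

lemma copies_proj_left_hom:
  assumes "left_module B M" "i \<in> I"
  shows "copies_proj I M i \<in> left_hom B (copies I M) M"
  using left_homI[OF left_module_copies[OF assms(1)], of I "\<lambda>f. f i" M] assms(2)
  by (simp add: copies_proj_def PiE_iff)

lemma copies_proj_right_hom: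
  assumes "right_module A M" "i \<in> I"
  shows "copies_proj I M i \<in> right_hom A (copies I M) M"
  using right_homI[OF right_module_copies[OF assms(1)], of I "\<lambda>f. f i" M] assms(2)
  by (simp add: copies_proj_def PiE_iff)

lemma copies_inj_left_hom:
  assumes "left_module B M"
  shows "copies_inj I M i \<in> left_hom B M (copies I M)"
proof -
  interpret left_module B M by fact
  show ?thesis unfolding copies_inj_def
  proof (rule left_homI[OF assms])
    fix x assume "x \<in> carrier M"
    moreover have "finite {j \<in> I. (if j = i then x else \<zero>\<^bsub>M\<^esub>) \<noteq> \<zero>\<^bsub>M\<^esub>}"
      by (rule finite_subset[of _ "{i}"]) auto
    ultimately show "(\<lambda>j\<in>I. if j = i then x else \<zero>\<^bsub>M\<^esub>) \<in> carrier (copies I M)"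
      by (auto cong: conj_cong)
  qed (auto simp: smult_zero)
qed

lemma copies_inj_right_hom:
  assumes "right_module A M"
  shows "copies_inj I M i \<in> right_hom A M (copies I M)"
proof -
  interpret right_module A M by fact
  have "copies_inj I (opp_mod M) i = copies_inj I M i"
    by (simp add: copies_inj_def cong: if_cong)
  then show ?thesis
    using copies_inj_left_hom[of "opp_ring A" "opp_mod M" I i] assms
    by (simp add: right_module_iff_opp[OF A.ring_axioms] right_hom_opp opp_mod_copies)
qed

text \<open>Compare coordinates: in position \<open>i\<close> only the summand \<open>j = i\<close>
  survives. A finite \<open>J\<close> containing the support, rather than the support itself, lets
  one index set serve all elements at once.\<close>

lemma copies_expand:
  assumes "abelian_group M" and z: "z \<in> carrier (copies I M)"
    and J: "finite J" "J \<subseteq> I" "\<And>i. i \<in> I - J \<Longrightarrow> z i = \<zero>\<^bsub>M\<^esub>"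
  shows "z = (\<Oplus>\<^bsub>copies I M\<^esub>j\<in>J. copies_inj I M j (z j))"
proof -
  interpret M: abelian_group M by fact
  interpret C: abelian_group "copies I M" by (rule abelian_group_copies) fact
  have inj: "copies_inj I M j (z j) \<in> carrier (copies I M)" if "j \<in> J" for j
  proof -
    have "finite {k \<in> I. (if k = j then z j else \<zero>\<^bsub>M\<^esub>) \<noteq> \<zero>\<^bsub>M\<^esub>}"
      by (rule finite_subset[of _ "{j}"]) auto
    then show ?thesis
      using that J(2) z by (auto simp: copies_inj_def PiE_iff cong: conj_cong)
  qed
  have zc: "z j \<in> carrier M" if "j \<in> I" for j
    using that z by auto
  let ?s = "\<Oplus>\<^bsub>copies I M\<^esub>j\<in>J. copies_inj I M j (z j)"
  have s: "?s \<in> carrier (copies I M)"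
    using inj by (intro C.finsum_closed) auto
  have "z i = ?s i" if i: "i \<in> I" for i
  proof -
    have "(\<lambda>f. f i) \<in> add_hom (copies I M) M"
      using i by (intro add_homI) auto
    then have "?s i = (\<Oplus>\<^bsub>M\<^esub>j\<in>J. copies_inj I M j (z j) i)"
      using inj by (subst add_hom_finsum[of "copies I M" M "\<lambda>f. f i"])
        (auto intro: C.abelian_group_axioms M.abelian_group_axioms)
    also have "\<dots> = (\<Oplus>\<^bsub>M\<^esub>j\<in>J. if i = j then z j else \<zero>\<^bsub>M\<^esub>)"
      using i J(2) zc by (intro finsum_eqI M.abelian_group_axioms) (auto simp: copies_inj_def)
    also have "\<dots> = z i"
    proof (cases "i \<in> J")
      case True
      then show ?thesis using J zc by (intro M.finsum_singleton) auto
    next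
      case False
      then have "(\<Oplus>\<^bsub>M\<^esub>j\<in>J. if i = j then z j else \<zero>\<^bsub>M\<^esub>) = (\<Oplus>\<^bsub>M\<^esub>j\<in>J. \<zero>\<^bsub>M\<^esub>)"
        by (intro finsum_eqI M.abelian_group_axioms) auto
      with False i J(3) show ?thesis by simp
    qed
    finally show ?thesis by simp
  qed
  then show ?thesis
    using z s by (intro PiE_ext[of z I "\<lambda>_. carrier M"]) auto
qed

text \<open>Finiteness of \<open>I\<close> gives the tuple finite support.\<close>

lemma into_copies_left_hom:
  assumes "left_module B X" "finite I" "\<And>i. i \<in> I \<Longrightarrow> f i \<in> left_hom B X Y"
  shows "(\<lambda>x\<in>carrier X. \<lambda>i\<in>I. f i x) \<in> left_hom B X (copies I Y)"
  using assms(2) left_homD[OF assms(3)] by (intro left_homI[OF assms(1)]) (auto simp: fun_eq_iff)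

lemma into_copies_right_hom:
  assumes "right_module A X" "finite I" "\<And>i. i \<in> I \<Longrightarrow> f i \<in> right_hom A X Y"
  shows "(\<lambda>x\<in>carrier X. \<lambda>i\<in>I. f i x) \<in> right_hom A X (copies I Y)"
  using assms(2) right_homD[OF assms(3)] by (intro right_homI[OF assms(1)]) (auto simp: fun_eq_iff)

lemma from_copies_left_hom:
  assumes "left_module B X" "left_module B Y" and g: "\<And>i. i \<in> I \<Longrightarrow> g i \<in> left_hom B Y X"
  shows "(\<lambda>z\<in>carrier (copies I Y). \<Oplus>\<^bsub>X\<^esub>i\<in>I. g i (z i)) \<in> left_hom B (copies I Y) X"
proof -
  interpret X: left_module B X by fact
  interpret Y: left_module B Y by fact
  have cl: "g i (z i) \<in> carrier X" if "i \<in> I" "z \<in> carrier (copies I Y)" for i z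
    using that left_hom_closed[OF g] by auto
  show ?thesis
  proof (rule left_homI[OF left_module_copies[OF assms(2)]])
    fix z assume z: "z \<in> carrier (copies I Y)"
    show "(\<Oplus>\<^bsub>X\<^esub>i\<in>I. g i (z i)) \<in> carrier X"
      using cl z by (intro X.M.finsum_closed) auto
    fix w assume w: "w \<in> carrier (copies I Y)"
    have "(\<Oplus>\<^bsub>X\<^esub>i\<in>I. g i ((z \<oplus>\<^bsub>copies I Y\<^esub> w) i)) = (\<Oplus>\<^bsub>X\<^esub>i\<in>I. g i (z i) \<oplus>\<^bsub>X\<^esub> g i (w i))"
      using cl z w left_hom_add[OF g] by (intro finsum_eqI X.M.abelian_group_axioms) (auto simp: PiE_iff)
    also have "\<dots> = (\<Oplus>\<^bsub>X\<^esub>i\<in>I. g i (z i)) \<oplus>\<^bsub>X\<^esub> (\<Oplus>\<^bsub>X\<^esub>i\<in>I. g i (w i))"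
      using cl z w by (intro X.M.finsum_addf) auto
    finally show "(\<Oplus>\<^bsub>X\<^esub>i\<in>I. g i ((z \<oplus>\<^bsub>copies I Y\<^esub> w) i)) =
      (\<Oplus>\<^bsub>X\<^esub>i\<in>I. g i (z i)) \<oplus>\<^bsub>X\<^esub> (\<Oplus>\<^bsub>X\<^esub>i\<in>I. g i (w i))" .
  next
    fix b z assume b: "b \<in> carrier B" and z: "z \<in> carrier (copies I Y)"
    have "(\<Oplus>\<^bsub>X\<^esub>i\<in>I. g i ((b \<odot>\<^bsub>copies I Y\<^esub> z) i)) = (\<Oplus>\<^bsub>X\<^esub>i\<in>I. b \<odot>\<^bsub>X\<^esub> g i (z i))"
      using cl z b left_hom_smult[OF g]
      by (intro finsum_eqI X.M.abelian_group_axioms) (auto simp: PiE_iff X.lsmult_closed)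
    also have "\<dots> = b \<odot>\<^bsub>X\<^esub> (\<Oplus>\<^bsub>X\<^esub>i\<in>I. g i (z i))"
      using cl z by (intro add_hom_finsum[symmetric] X.M.abelian_group_axioms X.smult_add_hom b) auto
    finally show "(\<Oplus>\<^bsub>X\<^esub>i\<in>I. g i ((b \<odot>\<^bsub>copies I Y\<^esub> z) i)) = b \<odot>\<^bsub>X\<^esub> (\<Oplus>\<^bsub>X\<^esub>i\<in>I. g i (z i))" .
  qed
qed

lemma from_copies_right_hom:
  assumes "right_module A X" "right_module A Y" and g: "\<And>i. i \<in> I \<Longrightarrow> g i \<in> right_hom A Y X"
  shows "(\<lambda>z\<in>carrier (copies I Y). \<Oplus>\<^bsub>X\<^esub>i\<in>I. g i (z i)) \<in> right_hom A (copies I Y) X"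
proof -
  interpret right_module A X by fact
  show ?thesis
    using from_copies_left_hom[of "opp_ring A" "opp_mod X" "opp_mod Y" I g] assms
    by (simp add: right_module_iff_opp[OF A.ring_axioms] right_hom_opp opp_mod_copies
        finsum_record_cong[of "opp_mod X" X])
qed

text \<open>The right action is a parameter so that the kernel of a one-sided homomorphism can be given
  any type of right scalars.\<close>

definition hom_kernel ::
  "('b, 'z, 't) module_scheme \<Rightarrow> ('x, 's) ring_scheme \<Rightarrow> ('z \<Rightarrow> 'x) \<Rightarrow> ('z \<Rightarrow> 'a \<Rightarrow> 'z) \<Rightarrow> ('b, 'a, 'z) bimodule"
  where "hom_kernel Z X g r = \<lparr>carrier = {z \<in> carrier Z. g z = \<zero>\<^bsub>X\<^esub>}, mult = undefined, one = undefined,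
    zero = \<zero>\<^bsub>Z\<^esub>, add = add Z, smult = smult Z, rsmult = r\<rparr>"

text \<open>The standard splitting of \<open>Z\<close> into the image of \<open>f\<close> and the
  kernel of \<open>g\<close>, for \<open>g\<close> a left inverse of \<open>f\<close>. Only the
  additive records enter, so one function is the isomorphism for the left and the right
  structure.\<close>

definition retract_iso ::
  "('x, 's) ring_scheme \<Rightarrow> ('z, 't) ring_scheme \<Rightarrow> ('x \<Rightarrow> 'z) \<Rightarrow> ('z \<Rightarrow> 'x) \<Rightarrow> 'x \<times> 'z \<Rightarrow> 'z"
  where "retract_iso X Z f g =
    (\<lambda>p\<in>carrier X \<times> {z \<in> carrier Z. g z = \<zero>\<^bsub>X\<^esub>}. f (fst p) \<oplus>\<^bsub>Z\<^esub> snd p)"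

lemma hom_kernel_simps [simp]:
  "carrier (hom_kernel Z X g r) = {z \<in> carrier Z. g z = \<zero>\<^bsub>X\<^esub>}"
  "\<zero>\<^bsub>hom_kernel Z X g r\<^esub> = \<zero>\<^bsub>Z\<^esub>" "add (hom_kernel Z X g r) = add Z"
  "smult (hom_kernel Z X g r) = smult Z" "rsmult (hom_kernel Z X g r) = r"
  by (simp_all add: hom_kernel_def)

lemma opp_mod_hom_kernel:
  "opp_mod (hom_kernel Z X g (rsmult Z)) = hom_kernel (opp_mod Z) (opp_mod X) g (rsmult (opp_mod Z))"
  by (simp add: hom_kernel_def opp_mod_def)

lemma bij_betw_retract_iso:
  assumes "abelian_group X" "abelian_group Z" and f: "f \<in> add_hom X Z" and g: "g \<in> add_hom Z X"
    and gf: "\<And>x. x \<in> carrier X \<Longrightarrow> g (f x) = x"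
  shows "bij_betw (retract_iso X Z f g) (carrier X \<times> {z \<in> carrier Z. g z = \<zero>\<^bsub>X\<^esub>}) (carrier Z)"
proof -
  interpret X: abelian_group X by fact
  interpret Z: abelian_group Z by fact
  note fc = add_hom_closed[OF f] and gc = add_hom_closed[OF g]
  note gn = add_hom_neg[OF assms(2,1) g]
  show ?thesis
  \<comment> \<open>The inverse peels off the component \<open>f (g z)\<close> in the image of
    \<open>f\<close>; the remainder is killed by \<open>g\<close> because
    \<open>g (f x) = x\<close>.\<close>
  proof (rule bij_betw_byWitness[where f' = "\<lambda>z. (g z, z \<ominus>\<^bsub>Z\<^esub> f (g z))"])
    show "\<forall>p\<in>carrier X \<times> {z \<in> carrier Z. g z = \<zero>\<^bsub>X\<^esub>}.
      (g (retract_iso X Z f g p), retract_iso X Z f g p \<ominus>\<^bsub>Z\<^esub> f (g (retract_iso X Z f g p))) = p"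
    proof
      fix p assume "p \<in> carrier X \<times> {z \<in> carrier Z. g z = \<zero>\<^bsub>X\<^esub>}"
      then obtain x z where p: "p = (x, z)" and x: "x \<in> carrier X" and z: "z \<in> carrier Z" "g z = \<zero>\<^bsub>X\<^esub>"
        by blast
      have "g (f x \<oplus>\<^bsub>Z\<^esub> z) = x"
        using x z fc by (simp add: add_hom_add[OF g] gf)
      moreover have "(f x \<oplus>\<^bsub>Z\<^esub> z) \<ominus>\<^bsub>Z\<^esub> f x = z"
        using x z fc by (simp add: Z.minus_eq Z.a_comm[of "f x" z] Z.a_assoc Z.r_neg)
      ultimately show "(g (retract_iso X Z f g p), retract_iso X Z f g p \<ominus>\<^bsub>Z\<^esub> f (g (retract_iso X Z f g p))) = p"
        using x z by (simp add: p retract_iso_def)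
    qed
    have k: "g (z \<ominus>\<^bsub>Z\<^esub> f (g z)) = \<zero>\<^bsub>X\<^esub>" if "z \<in> carrier Z" for z
      using that fc gc by (simp add: Z.minus_eq add_hom_add[OF g] gn gf X.r_neg)
    show "\<forall>z\<in>carrier Z. retract_iso X Z f g (g z, z \<ominus>\<^bsub>Z\<^esub> f (g z)) = z"
    proof
      fix z assume z: "z \<in> carrier Z"
      then have "f (g z) \<oplus>\<^bsub>Z\<^esub> (z \<ominus>\<^bsub>Z\<^esub> f (g z)) = z"
        using fc gc by (simp add: Z.minus_eq Z.a_lcomm[of "f (g z)" z] Z.r_neg)
      then show "retract_iso X Z f g (g z, z \<ominus>\<^bsub>Z\<^esub> f (g z)) = z"
        using z fc gc k by (simp add: retract_iso_def)
    qed
    show "retract_iso X Z f g ` (carrier X \<times> {z \<in> carrier Z. g z = \<zero>\<^bsub>X\<^esub>}) \<subseteq> carrier Z"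
      using fc by (auto simp: retract_iso_def)
    show "(\<lambda>z. (g z, z \<ominus>\<^bsub>Z\<^esub> f (g z))) ` carrier Z \<subseteq> carrier X \<times> {z \<in> carrier Z. g z = \<zero>\<^bsub>X\<^esub>}"
      using fc gc k by auto
  qed
qed

lemma hom_kernel_left_module:
  assumes "left_module B X" "left_module B Z" and g: "g \<in> left_hom B Z X"
  shows "left_module B (hom_kernel Z X g r)"
proof -
  interpret X: left_module B X by fact
  interpret Z: left_module B Z by fact
  have "abelian_group (hom_kernel Z X g r)"
  proof (rule abelian_groupI)
    show "\<zero>\<^bsub>hom_kernel Z X g r\<^esub> \<in> carrier (hom_kernel Z X g r)"
      using add_hom_zero[OF Z.M.abelian_group_axioms X.M.abelian_group_axioms left_hom_add_hom[OF g]] by simp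
    fix z assume z: "z \<in> carrier (hom_kernel Z X g r)"
    then show "\<exists>y\<in>carrier (hom_kernel Z X g r). y \<oplus>\<^bsub>hom_kernel Z X g r\<^esub> z = \<zero>\<^bsub>hom_kernel Z X g r\<^esub>"
      using add_hom_neg[OF Z.M.abelian_group_axioms X.M.abelian_group_axioms left_hom_add_hom[OF g], of z]
      by (intro bexI[of _ "\<ominus>\<^bsub>Z\<^esub> z"]) (auto simp: Z.M.l_neg)
  qed (auto simp: left_hom_add[OF g] Z.M.a_ac)
  then show ?thesis
    by (intro left_module.intro left_module_axioms.intro X.B.ring_axioms)
      (auto simp: left_hom_smult[OF g] X.smult_zero Z.lsmult_closed Z.lsmult_l_distr Z.lsmult_r_distr
        Z.lsmult_assoc Z.lsmult_one)
qed

lemma retract_iso_left_hom: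
  assumes "left_module B X" "left_module B Z" and f: "f \<in> left_hom B X Z" and g: "g \<in> left_hom B Z X"
  shows "retract_iso X Z f g \<in> left_hom B (dsum X (hom_kernel Z X g r)) Z"
proof -
  interpret X: left_module B X by fact
  interpret Z: left_module B Z by fact
  interpret K: left_module B "hom_kernel Z X g r"
    by (rule hom_kernel_left_module) fact+
  note fc = left_hom_closed[OF f]
  have addc: "z \<oplus>\<^bsub>Z\<^esub> w \<in> carrier Z \<and> g (z \<oplus>\<^bsub>Z\<^esub> w) = \<zero>\<^bsub>X\<^esub>"
    if "z \<in> carrier Z" "g z = \<zero>\<^bsub>X\<^esub>" "w \<in> carrier Z" "g w = \<zero>\<^bsub>X\<^esub>" for z w
    using that K.M.a_closed[of z w] by simp
  have smultc: "b \<odot>\<^bsub>Z\<^esub> z \<in> carrier Z \<and> g (b \<odot>\<^bsub>Z\<^esub> z) = \<zero>\<^bsub>X\<^esub>"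
    if "b \<in> carrier B" "z \<in> carrier Z" "g z = \<zero>\<^bsub>X\<^esub>" for b z
    using that K.lsmult_closed[of b z] by simp
  show ?thesis
    unfolding left_hom_def
    by (auto simp: retract_iso_def fc left_hom_add[OF f] left_hom_smult[OF f] addc smultc
        X.lsmult_closed Z.lsmult_closed Z.lsmult_r_distr Z.M.a_ac)
qed

lemma hom_kernel_right_module:
  assumes "right_module A X" "right_module A Z" and g: "g \<in> right_hom A Z X"
  shows "right_module A (hom_kernel Z X g (rsmult Z))"
proof -
  interpret right_module A X by fact
  show ?thesis
    using hom_kernel_left_module[of "opp_ring A" "opp_mod X" "opp_mod Z" g "rsmult (opp_mod Z)"] assms
    by (simp add: right_module_iff_opp[OF A.ring_axioms] right_hom_opp opp_mod_hom_kernel)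
qed

lemma retract_iso_right_hom:
  assumes "right_module A X" "right_module A Z" and f: "f \<in> right_hom A X Z" and g: "g \<in> right_hom A Z X"
  shows "retract_iso X Z f g \<in> right_hom A (dsum X (hom_kernel Z X g (rsmult Z))) Z"
proof -
  interpret right_module A X by fact
  have "retract_iso (opp_mod X) (opp_mod Z) f g = retract_iso X Z f g"
    by (simp add: retract_iso_def)
  then show ?thesis
    using retract_iso_left_hom[of "opp_ring A" "opp_mod X" "opp_mod Z" f g "rsmult (opp_mod Z)"] assms
    by (simp add: right_module_iff_opp[OF A.ring_axioms] right_hom_opp opp_mod_hom_kernel opp_mod_dsum)
qed

section \<open>From a direct sum decomposition to a section and a retraction\<close>

definition dsum_section :: "('x, 's) ring_scheme \<Rightarrow> ('p, 't) ring_scheme \<Rightarrow> ('x \<times> 'p \<Rightarrow> 'z) \<Rightarrow> 'x \<Rightarrow> 'z"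
  where "dsum_section X P h = (\<lambda>x\<in>carrier X. h (x, \<zero>\<^bsub>P\<^esub>))"

definition dsum_retraction ::
  "('x, 's) ring_scheme \<Rightarrow> ('p, 't) ring_scheme \<Rightarrow> ('z, 'u) ring_scheme \<Rightarrow> ('x \<times> 'p \<Rightarrow> 'z) \<Rightarrow> 'z \<Rightarrow> 'x"
  where "dsum_retraction X P Z h = (\<lambda>z\<in>carrier Z. fst (inv_into (carrier X \<times> carrier P) h z))"

lemma dsum_retraction_section:
  assumes "abelian_group P" "bij_betw h (carrier X \<times> carrier P) (carrier Z)" "x \<in> carrier X"
  shows "dsum_retraction X P Z h (dsum_section X P h x) = x"
proof -
  interpret P: abelian_group P by fact
  have "h (x, \<zero>\<^bsub>P\<^esub>) \<in> carrier Z"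
    using assms by (auto simp: bij_betw_def)
  then show ?thesis
    using assms(3) bij_betw_inv_into_left[OF assms(2), of "(x, \<zero>\<^bsub>P\<^esub>)"]
    by (simp add: dsum_retraction_def dsum_section_def)
qed

lemma dsum_section_left_hom:
  assumes "left_module B X" "left_module B P" and h: "h \<in> left_hom B (dsum X P) Z"
  shows "dsum_section X P h \<in> left_hom B X Z"
  unfolding dsum_section_def
proof (rule left_homI[OF assms(1)])
  interpret P: left_module B P by fact
  fix x assume x: "x \<in> carrier X"
  then show "h (x, \<zero>\<^bsub>P\<^esub>) \<in> carrier Z"
    using left_hom_closed[OF h] by simp
  show "h (x \<oplus>\<^bsub>X\<^esub> y, \<zero>\<^bsub>P\<^esub>) = h (x, \<zero>\<^bsub>P\<^esub>) \<oplus>\<^bsub>Z\<^esub> h (y, \<zero>\<^bsub>P\<^esub>)" if "y \<in> carrier X" for y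
    using left_hom_add[OF h, of "(x, \<zero>\<^bsub>P\<^esub>)" "(y, \<zero>\<^bsub>P\<^esub>)"] x that by simp
  show "h (b \<odot>\<^bsub>X\<^esub> x, \<zero>\<^bsub>P\<^esub>) = b \<odot>\<^bsub>Z\<^esub> h (x, \<zero>\<^bsub>P\<^esub>)" if "b \<in> carrier B" for b
    using left_hom_smult[OF h that, of "(x, \<zero>\<^bsub>P\<^esub>)"] x that by (simp add: P.smult_zero)
qed

text \<open>The inverse of a bijective homomorphism is a homomorphism: write each element of
  \<open>Z\<close> as \<open>h (x, p)\<close>, compute there and project.\<close>

lemma dsum_retraction_left_hom:
  assumes "left_module B X" "left_module B P" "left_module B Z" and h: "h \<in> left_hom B (dsum X P) Z"
    and bij: "bij_betw h (carrier X \<times> carrier P) (carrier Z)"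
  shows "dsum_retraction X P Z h \<in> left_hom B Z X"
  unfolding dsum_retraction_def
proof (rule left_homI[OF assms(3)])
  interpret X: left_module B X by fact
  interpret P: left_module B P by fact
  interpret Z: left_module B Z by fact
  let ?k = "inv_into (carrier X \<times> carrier P) h"
  have inv: "?k (h p) = p" if "p \<in> carrier X \<times> carrier P" for p
    using bij_betw_inv_into_left[OF bij that] .
  have surj: "\<exists>x p. x \<in> carrier X \<and> p \<in> carrier P \<and> z = h (x, p)" if "z \<in> carrier Z" for z
  proof -
    have "z \<in> h ` (carrier X \<times> carrier P)"
      using that bij by (simp add: bij_betw_def)
    then show ?thesis by blast
  qed
  fix z assume "z \<in> carrier Z"
  then obtain x p where xp: "x \<in> carrier X" "p \<in> carrier P" "z = h (x, p)"
    using surj by blast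
  then show "fst (?k z) \<in> carrier X" by (simp add: inv)
  show "fst (?k (z \<oplus>\<^bsub>Z\<^esub> w)) = fst (?k z) \<oplus>\<^bsub>X\<^esub> fst (?k w)" if w: "w \<in> carrier Z" for w
  proof -
    obtain y q where yq: "y \<in> carrier X" "q \<in> carrier P" "w = h (y, q)"
      using surj w by blast
    then have "z \<oplus>\<^bsub>Z\<^esub> w = h (x \<oplus>\<^bsub>X\<^esub> y, p \<oplus>\<^bsub>P\<^esub> q)"
      using xp left_hom_add[OF h, of "(x, p)" "(y, q)"] by simp
    with xp yq show ?thesis by (simp add: inv)
  qed
  show "fst (?k (b \<odot>\<^bsub>Z\<^esub> z)) = b \<odot>\<^bsub>X\<^esub> fst (?k z)" if b: "b \<in> carrier B" for b
  proof -
    have "b \<odot>\<^bsub>Z\<^esub> z = h (b \<odot>\<^bsub>X\<^esub> x, b \<odot>\<^bsub>P\<^esub> p)"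
      using xp left_hom_smult[OF h b, of "(x, p)"] by simp
    with xp b show ?thesis by (simp add: inv X.lsmult_closed P.lsmult_closed)
  qed
qed

lemma dsum_section_right_hom:
  assumes "right_module A X" "right_module A P" and h: "h \<in> right_hom A (dsum X P) Z"
  shows "dsum_section X P h \<in> right_hom A X Z"
proof -
  interpret right_module A X by fact
  have "dsum_section (opp_mod X) (opp_mod P) h = dsum_section X P h"
    by (simp add: dsum_section_def)
  then show ?thesis
    using dsum_section_left_hom[of "opp_ring A" "opp_mod X" "opp_mod P" h "opp_mod Z"] assms
    by (simp add: right_module_iff_opp[OF A.ring_axioms] right_hom_opp opp_mod_dsum)
qed

lemma dsum_retraction_right_hom:
  assumes "right_module A X" "right_module A P" "right_module A Z" and h: "h \<in> right_hom A (dsum X P) Z"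
    and bij: "bij_betw h (carrier X \<times> carrier P) (carrier Z)"
  shows "dsum_retraction X P Z h \<in> right_hom A Z X"
proof -
  interpret right_module A X by fact
  have "dsum_retraction (opp_mod X) (opp_mod P) (opp_mod Z) h = dsum_retraction X P Z h"
    by (simp add: dsum_retraction_def)
  then show ?thesis
    using dsum_retraction_left_hom[of "opp_ring A" "opp_mod X" "opp_mod P" "opp_mod Z" h] assms
    by (simp add: right_module_iff_opp[OF A.ring_axioms] right_hom_opp opp_mod_dsum)
qed

lemma compose_left_hom:
  assumes "f \<in> left_hom B X Y" "g \<in> left_hom B Y Z" "left_module B X"
  shows "compose (carrier X) g f \<in> left_hom B X Z"
  unfolding compose_def
  using left_homD[OF assms(1)] left_homD[OF assms(2)] by (intro left_homI assms(3)) auto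

lemma compose_right_hom:
  assumes "f \<in> right_hom A X Y" "g \<in> right_hom A Y Z" "right_module A X"
  shows "compose (carrier X) g f \<in> right_hom A X Z"
  unfolding compose_def
  using right_homD[OF assms(1)] right_homD[OF assms(2)] by (intro right_homI assms(3)) auto

section \<open>Divisibility as a finite family of bimodule maps\<close>

definition bimod_hom ::
  "('b, 'r) ring_scheme \<Rightarrow> ('a, 'q) ring_scheme \<Rightarrow> ('b, 'a, 'm, 's) bimodule_scheme
    \<Rightarrow> ('b, 'a, 'n, 't) bimodule_scheme \<Rightarrow> ('m \<Rightarrow> 'n) set"
  where "bimod_hom B A M N = left_hom B M N \<inter> right_hom A M N"

lemma bimod_homD:
  assumes "f \<in> bimod_hom B A M N"
  shows bimod_hom_left: "f \<in> left_hom B M N" and bimod_hom_right: "f \<in> right_hom A M N"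
  using assms by (auto simp: bimod_hom_def)

lemma compose_bimod_hom:
  assumes "f \<in> bimod_hom B A X Y" "g \<in> bimod_hom B A Y Z" "bimodule B A X"
  shows "compose (carrier X) g f \<in> bimod_hom B A X Z"
proof -
  interpret bimodule B A X by fact
  show ?thesis
    using assms left_module_axioms right_module_axioms
    by (auto simp: bimod_hom_def intro: compose_left_hom compose_right_hom)
qed

text \<open>The decomposition makes \<open>X\<close> a retract of the n-th power of
  \<open>Y\<close>; \<open>f\<close> and \<open>g\<close> are the section and the retraction cut
  into coordinates. No complement occurs in this form, so the maps can be carried over to
  \<open>E\<close> and its duals one index at a time.\<close>

lemma bimod_divides_imp_family:
  fixes X :: "('b, 'a, 'x, 's) bimodule_scheme" and Y :: "('b, 'a, 'y, 't) bimodule_scheme"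
  assumes X: "bimodule B A X" and Y: "bimodule B A Y" and "bimod_divides B A X Y"
  obtains n :: nat and f g
  where "\<And>i. i < n \<Longrightarrow> f i \<in> bimod_hom B A X Y" "\<And>i. i < n \<Longrightarrow> g i \<in> bimod_hom B A Y X"
    and "\<And>x. x \<in> carrier X \<Longrightarrow> x = (\<Oplus>\<^bsub>X\<^esub>i\<in>{..<n}. g i (f i x))"
proof -
  interpret X: bimodule B A X by fact
  interpret Y: bimodule B A Y by fact
  obtain n :: nat and P :: "('b, 'a, nat \<Rightarrow> 'y) bimodule"
    where P: "bimodule B A P" and iso: "bimod_isomorphic B A (dsum X P) (copies {..<n} Y)"
    using assms(3) unfolding bimod_divides_def by blast
  define Z where "Z = copies {..<n} Y"
  obtain h where h: "h \<in> left_hom B (dsum X P) Z" "h \<in> right_hom A (dsum X P) Z"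
      and "bij_betw h (carrier (dsum X P)) (carrier Z)"
    using iso unfolding Z_def bimod_isomorphic_def by blast
  then have bij: "bij_betw h (carrier X \<times> carrier P) (carrier Z)"
    by simp
  interpret P: bimodule B A P by fact
  interpret Z: bimodule B A Z unfolding Z_def by (rule bimodule_copies) fact
  define s where "s = dsum_section X P h"
  define r where "r = dsum_retraction X P Z h"
  define p where "p = copies_proj {..<n} Y"
  define \<iota> where "\<iota> = copies_inj {..<n} Y"
  have s: "s \<in> bimod_hom B A X Z"
    unfolding s_def bimod_hom_def
    by (intro IntI dsum_section_left_hom dsum_section_right_hom h X.left_module_axioms X.right_module_axioms
        P.left_module_axioms P.right_module_axioms)
  have r: "r \<in> bimod_hom B A Z X"
    unfolding r_def bimod_hom_def
    by (intro IntI dsum_retraction_left_hom dsum_retraction_right_hom h bij X.left_module_axioms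
        X.right_module_axioms P.left_module_axioms P.right_module_axioms Z.left_module_axioms
        Z.right_module_axioms)
  have p: "p i \<in> bimod_hom B A Z Y" if "i < n" for i
    unfolding p_def bimod_hom_def Z_def
    by (intro IntI copies_proj_left_hom copies_proj_right_hom Y.left_module_axioms Y.right_module_axioms)
      (use that in simp_all)
  have \<iota>: "\<iota> i \<in> bimod_hom B A Y Z" for i
    unfolding \<iota>_def bimod_hom_def Z_def
    by (intro IntI copies_inj_left_hom copies_inj_right_hom Y.left_module_axioms Y.right_module_axioms)
  note sc = left_hom_closed[OF bimod_hom_left[OF s]] and rc = left_hom_closed[OF bimod_hom_left[OF r]]
    and ic = left_hom_closed[OF bimod_hom_left[OF \<iota>]]
  show ?thesis
  proof (rule that[where f = "\<lambda>i. compose (carrier X) (p i) s" and g = "\<lambda>i. compose (carrier Y) r (\<iota> i)"])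
    fix i assume "i < n"
    then show "compose (carrier X) (p i) s \<in> bimod_hom B A X Y" "compose (carrier Y) r (\<iota> i) \<in> bimod_hom B A Y X"
      by (intro compose_bimod_hom[OF s p X] compose_bimod_hom[OF \<iota> r Y]; assumption)+
  next
    fix x assume x: "x \<in> carrier X"
    have comp: "s x i \<in> carrier Y" if "i < n" for i
      using sc[OF x] that unfolding Z_def by auto
    have "s x = (\<Oplus>\<^bsub>Z\<^esub>i\<in>{..<n}. \<iota> i (s x i))"
      using copies_expand[OF Y.M.abelian_group_axioms sc[OF x, unfolded Z_def], of "{..<n}"]
      unfolding Z_def \<iota>_def by simp
    then have "r (s x) = (\<Oplus>\<^bsub>X\<^esub>i\<in>{..<n}. r (\<iota> i (s x i)))"
      using add_hom_finsum[OF Z.M.abelian_group_axioms X.M.abelian_group_axioms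
          left_hom_add_hom[OF bimod_hom_left[OF r]], of "\<lambda>i. \<iota> i (s x i)" "{..<n}"] ic comp by auto
    also have "\<dots> = (\<Oplus>\<^bsub>X\<^esub>i\<in>{..<n}. compose (carrier Y) r (\<iota> i) (compose (carrier X) (p i) s x))"
    proof (rule sym, intro finsum_eqI X.M.abelian_group_axioms)
      fix i assume "i \<in> {..<n}"
      moreover have "compose (carrier X) (p i) s x = s x i"
        using sc[OF x] x by (simp add: compose_def p_def copies_proj_def Z_def)
      ultimately show "compose (carrier Y) r (\<iota> i) (compose (carrier X) (p i) s x) = r (\<iota> i (s x i))"
        "r (\<iota> i (s x i)) \<in> carrier X"
        using comp by (simp_all add: compose_def rc ic)
    qed
    finally show "x = (\<Oplus>\<^bsub>X\<^esub>i\<in>{..<n}. compose (carrier Y) r (\<iota> i) (compose (carrier X) (p i) s x))"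
      using dsum_retraction_section[OF P.M.abelian_group_axioms bij x] by (simp add: r_def s_def)
  qed
qed

text \<open>Bundled together, the families give maps \<open>F\<close> into and \<open>G\<close> out
  of the n-th power with \<open>G\<close> after \<open>F\<close> the identity. The complement is the
  kernel of \<open>G\<close>, whose elements are functions on \<open>nat\<close>, as
  \<open>bimod_divides\<close> demands.\<close>

lemma bimod_dividesI:
  fixes f :: "nat \<Rightarrow> 'x \<Rightarrow> 'y"
  assumes X: "bimodule B A X" and Y: "bimodule B A Y"
    and f: "\<And>i. i < n \<Longrightarrow> f i \<in> bimod_hom B A X Y" and g: "\<And>i. i < n \<Longrightarrow> g i \<in> bimod_hom B A Y X"
    and gf: "\<And>x. x \<in> carrier X \<Longrightarrow> (\<Oplus>\<^bsub>X\<^esub>i\<in>{..<n}. g i (f i x)) = x"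
  shows "bimod_divides B A X Y"
proof -
  interpret X: bimodule B A X by fact
  interpret Y: bimodule B A Y by fact
  define Z where "Z = copies {..<n} Y"
  interpret Z: bimodule B A Z unfolding Z_def by (rule bimodule_copies) fact
  define F where "F = (\<lambda>x\<in>carrier X. \<lambda>i\<in>{..<n}. f i x)"
  define G where "G = (\<lambda>z\<in>carrier Z. \<Oplus>\<^bsub>X\<^esub>i\<in>{..<n}. g i (z i))"
  have F: "F \<in> left_hom B X Z" "F \<in> right_hom A X Z"
    unfolding F_def Z_def using bimod_homD[OF f]
    by (intro into_copies_left_hom into_copies_right_hom X.left_module_axioms X.right_module_axioms; simp)+
  have G: "G \<in> left_hom B Z X" "G \<in> right_hom A Z X"
    unfolding G_def Z_def using bimod_homD[OF g]
    by (intro from_copies_left_hom from_copies_right_hom X.left_module_axioms X.right_module_axioms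
        Y.left_module_axioms Y.right_module_axioms; simp)+
  have GF: "G (F x) = x" if x: "x \<in> carrier X" for x
  proof -
    have "G (F x) = (\<Oplus>\<^bsub>X\<^esub>i\<in>{..<n}. g i (F x i))"
      using left_hom_closed[OF F(1) x] by (simp add: G_def)
    also have "\<dots> = (\<Oplus>\<^bsub>X\<^esub>i\<in>{..<n}. g i (f i x))"
    proof (intro finsum_eqI X.M.abelian_group_axioms)
      fix i assume "i \<in> {..<n}"
      then show "g i (F x i) = g i (f i x)" "g i (f i x) \<in> carrier X"
        using x left_hom_closed[OF bimod_hom_left[OF g]] left_hom_closed[OF bimod_hom_left[OF f]]
        by (simp_all add: F_def)
    qed
    finally show ?thesis using gf[OF x] by simp
  qed
  define K where "K = hom_kernel Z X G (rsmult Z)"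
  have "bimodule B A K"
    unfolding K_def
    by (intro bimodule.intro bimodule_axioms.intro hom_kernel_left_module hom_kernel_right_module
        X.left_module_axioms X.right_module_axioms Z.left_module_axioms Z.right_module_axioms G)
      (simp add: Z.smult_rsmult_assoc)
  moreover have "bimod_isomorphic B A (dsum X K) Z"
    unfolding bimod_isomorphic_def
  proof (intro bexI IntI)
    show "retract_iso X Z F G \<in> left_hom B (dsum X K) Z"
      unfolding K_def by (intro retract_iso_left_hom X.left_module_axioms Z.left_module_axioms F G)
    show "retract_iso X Z F G \<in> right_hom A (dsum X K) Z"
      unfolding K_def by (intro retract_iso_right_hom X.right_module_axioms Z.right_module_axioms F G)
    show "bij_betw (retract_iso X Z F G) (carrier (dsum X K)) (carrier Z)"
      using bij_betw_retract_iso[OF X.M.abelian_group_axioms Z.M.abelian_group_axioms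
          left_hom_add_hom[OF F(1)] left_hom_add_hom[OF G(1)]] GF
      by (simp add: K_def)
  qed
  ultimately show ?thesis
    unfolding bimod_divides_def Z_def by blast
qed

subsection \<open>Dual bimodules\<close>

lemma left_dual_simps [simp]:
  "carrier (left_dual B M) = left_hom B M (regular B)"
  "\<zero>\<^bsub>left_dual B M\<^esub> = (\<lambda>m\<in>carrier M. \<zero>\<^bsub>B\<^esub>)"
  "f \<oplus>\<^bsub>left_dual B M\<^esub> g = (\<lambda>m\<in>carrier M. f m \<oplus>\<^bsub>B\<^esub> g m)"
  "a \<odot>\<^bsub>left_dual B M\<^esub> f = (\<lambda>m\<in>carrier M. f (m \<odot>\<^sub>r\<^bsub>M\<^esub> a))"
  "f \<odot>\<^sub>r\<^bsub>left_dual B M\<^esub> b = (\<lambda>m\<in>carrier M. f m \<otimes>\<^bsub>B\<^esub> b)"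
  by (simp_all add: left_dual_def)

lemma right_dual_simps [simp]:
  "carrier (right_dual A M) = right_hom A M (regular A)"
  "\<zero>\<^bsub>right_dual A M\<^esub> = (\<lambda>m\<in>carrier M. \<zero>\<^bsub>A\<^esub>)"
  "f \<oplus>\<^bsub>right_dual A M\<^esub> g = (\<lambda>m\<in>carrier M. f m \<oplus>\<^bsub>A\<^esub> g m)"
  "a \<odot>\<^bsub>right_dual A M\<^esub> f = (\<lambda>m\<in>carrier M. a \<otimes>\<^bsub>A\<^esub> f m)"
  "f \<odot>\<^sub>r\<^bsub>right_dual A M\<^esub> b = (\<lambda>m\<in>carrier M. f (b \<odot>\<^bsub>M\<^esub> m))"
  by (simp_all add: right_dual_def)

lemma left_hom_regularD:
  assumes "f \<in> left_hom B M (regular B)"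
  shows left_hom_regular_closed: "x \<in> carrier M \<Longrightarrow> f x \<in> carrier B"
    and left_hom_regular_add: "\<lbrakk>x \<in> carrier M; y \<in> carrier M\<rbrakk> \<Longrightarrow> f (x \<oplus>\<^bsub>M\<^esub> y) = f x \<oplus>\<^bsub>B\<^esub> f y"
    and left_hom_regular_smult: "\<lbrakk>b \<in> carrier B; x \<in> carrier M\<rbrakk> \<Longrightarrow> f (b \<odot>\<^bsub>M\<^esub> x) = b \<otimes>\<^bsub>B\<^esub> f x"
    and left_hom_regular_add_hom: "f \<in> add_hom M B"
  using assms by (auto simp: left_hom_def add_hom_def)

lemma right_hom_regularD:
  assumes "f \<in> right_hom A M (regular A)"
  shows right_hom_regular_closed: "x \<in> carrier M \<Longrightarrow> f x \<in> carrier A"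
    and right_hom_regular_add: "\<lbrakk>x \<in> carrier M; y \<in> carrier M\<rbrakk> \<Longrightarrow> f (x \<oplus>\<^bsub>M\<^esub> y) = f x \<oplus>\<^bsub>A\<^esub> f y"
    and right_hom_regular_rsmult: "\<lbrakk>x \<in> carrier M; a \<in> carrier A\<rbrakk> \<Longrightarrow> f (x \<odot>\<^sub>r\<^bsub>M\<^esub> a) = f x \<otimes>\<^bsub>A\<^esub> a"
    and right_hom_regular_add_hom: "f \<in> add_hom M A"
  using assms by (auto simp: right_hom_def add_hom_def)

lemma left_hom_regularI:
  assumes "left_module B M"
    and "\<And>x. x \<in> carrier M \<Longrightarrow> f x \<in> carrier B"
    and "\<And>x y. \<lbrakk>x \<in> carrier M; y \<in> carrier M\<rbrakk> \<Longrightarrow> f (x \<oplus>\<^bsub>M\<^esub> y) = f x \<oplus>\<^bsub>B\<^esub> f y"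
    and "\<And>b x. \<lbrakk>b \<in> carrier B; x \<in> carrier M\<rbrakk> \<Longrightarrow> f (b \<odot>\<^bsub>M\<^esub> x) = b \<otimes>\<^bsub>B\<^esub> f x"
  shows "(\<lambda>x\<in>carrier M. f x) \<in> left_hom B M (regular B)"
  by (rule left_homI) (simp_all add: assms)

lemma right_hom_regularI:
  assumes "right_module A M"
    and "\<And>x. x \<in> carrier M \<Longrightarrow> f x \<in> carrier A"
    and "\<And>x y. \<lbrakk>x \<in> carrier M; y \<in> carrier M\<rbrakk> \<Longrightarrow> f (x \<oplus>\<^bsub>M\<^esub> y) = f x \<oplus>\<^bsub>A\<^esub> f y"
    and "\<And>a x. \<lbrakk>a \<in> carrier A; x \<in> carrier M\<rbrakk> \<Longrightarrow> f (x \<odot>\<^sub>r\<^bsub>M\<^esub> a) = f x \<otimes>\<^bsub>A\<^esub> a"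
  shows "(\<lambda>x\<in>carrier M. f x) \<in> right_hom A M (regular A)"
  by (rule right_homI) (simp_all add: assms)

lemma abelian_group_left_dual:
  assumes "left_module B M" shows "abelian_group (left_dual B M)"
proof -
  interpret left_module B M by fact
  show ?thesis
    by (rule pointwise_abelian_group[OF B.abelian_group_axioms, where S = "carrier M"])
      (auto simp: left_hom_def PiE_iff extensional_def lsmult_closed smult_zero B.a_ac B.r_distr B.minus_add B.r_minus)
qed

lemma bimodule_left_dual:
  assumes "bimodule B A M" shows "bimodule A B (left_dual B M)"
proof -
  interpret bimodule B A M by fact
  have ag: "abelian_group (left_dual B M)"
    by (rule abelian_group_left_dual) (rule left_module_axioms)
  have "left_module A (left_dual B M)"
    by (intro left_module.intro left_module_axioms.intro A.ring_axioms ag)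
      (auto simp: left_hom_def lsmult_closed rsmult_closed rsmult_r_distr rsmult_l_distr
        rsmult_assoc[symmetric] rsmult_one smult_rsmult_assoc fun_eq_iff PiE_iff extensional_def)
  moreover have "right_module B (left_dual B M)"
    by (intro right_module.intro right_module_axioms.intro B.ring_axioms ag)
      (auto simp: left_hom_def lsmult_closed B.l_distr B.r_distr B.m_assoc fun_eq_iff PiE_iff
        extensional_def)
  ultimately show ?thesis
    by (intro bimodule.intro bimodule_axioms.intro) (auto simp: rsmult_closed)
qed

lemma bimodule_opp:
  assumes "bimodule B A M" shows "bimodule (opp_ring A) (opp_ring B) (opp_mod M)"
proof -
  interpret bimodule B A M by fact
  have "right_module (opp_ring B) (opp_mod M)"
    by (intro right_module.intro right_module_axioms.intro ring_opp_ring B.ring_axioms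
        abelian_group_cong[OF M.abelian_group_axioms])
      (auto simp: lsmult_closed lsmult_l_distr lsmult_r_distr lsmult_assoc lsmult_one)
  moreover have "left_module (opp_ring A) (opp_mod M)"
    using right_module_axioms by (simp add: right_module_iff_opp[OF A.ring_axioms])
  ultimately show ?thesis
    by (intro bimodule.intro bimodule_axioms.intro) (auto simp: smult_rsmult_assoc)
qed

text \<open>Shaped for \<open>right_dual_opp\<close>, which presents the right dual as
  \<open>opp_mod\<close> of a bimodule over the opposite rings.\<close>

lemma bimodule_if_opp:
  assumes "ring A" "ring B" "bimodule (opp_ring A) (opp_ring B) M" shows "bimodule B A (opp_mod M)"
proof -
  interpret bimodule "opp_ring A" "opp_ring B" M by fact
  have "left_module B (opp_mod M)"
    by (intro left_module.intro left_module_axioms.intro assms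
        abelian_group_cong[OF M.abelian_group_axioms])
      (use rsmult_closed rsmult_r_distr rsmult_l_distr rsmult_assoc rsmult_one in auto)
  moreover have "right_module A (opp_mod M)"
    by (intro right_module.intro right_module_axioms.intro assms
        abelian_group_cong[OF M.abelian_group_axioms])
      (use lsmult_closed lsmult_l_distr lsmult_r_distr lsmult_assoc lsmult_one in auto)
  ultimately show ?thesis
    by (intro bimodule.intro bimodule_axioms.intro) (use smult_rsmult_assoc in auto)
qed

text \<open>A right linear functional over \<open>A\<close> is a left linear one over
  \<open>opp_ring A\<close>, and the outer \<open>opp_mod\<close> swaps the two actions back. Being
  an equality of records, it transfers the bimodule axioms from left duals without a second
  verification.\<close>

lemma right_dual_opp: "right_dual A M = opp_mod (left_dual (opp_ring A) (opp_mod M))"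
  by (simp add: right_dual_def left_dual_def opp_mod_def right_hom_def left_hom_def via_bimod_def)

lemma bimodule_right_dual:
  assumes "bimodule B A M" shows "bimodule A B (right_dual A M)"
proof -
  interpret bimodule B A M by fact
  show ?thesis
    unfolding right_dual_opp
    by (intro bimodule_if_opp B.ring_axioms A.ring_axioms bimodule_left_dual bimodule_opp assms)
qed

subsection \<open>Dual bases\<close>

text \<open>On the carrier, these are the maps in the image of the tensor product of the dual with
  \<open>M\<close>. The index set consists of elements of \<open>M\<close>, as in
  \<open>left_fin_gen\<close>, so each element carries a single functional.\<close>

definition left_finite_rank :: "('b, 'r) ring_scheme \<Rightarrow> ('b, 'm, 's) module_scheme \<Rightarrow> ('m \<Rightarrow> 'm) \<Rightarrow> bool"
  where "left_finite_rank B M a \<longleftrightarrow> (\<exists>G q. finite G \<and> G \<subseteq> carrier M \<and> q \<in> G \<rightarrow> left_hom B M (regular B) \<and>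
    (\<forall>m\<in>carrier M. a m = (\<Oplus>\<^bsub>M\<^esub>g\<in>G. q g m \<odot>\<^bsub>M\<^esub> g)))"

lemma left_finite_rank_cong:
  assumes "left_finite_rank B M a" "\<And>m. m \<in> carrier M \<Longrightarrow> a' m = a m"
  shows "left_finite_rank B M a'"
  using assms(1) unfolding left_finite_rank_def by (simp add: assms(2) cong: ball_cong)

context left_module
begin

lemma left_finite_rank_closed:
  assumes "left_finite_rank B M a" "m \<in> carrier M"
  shows "a m \<in> carrier M"
proof -
  obtain G q where "G \<subseteq> carrier M" "q \<in> G \<rightarrow> left_hom B M (regular B)" "a m = (\<Oplus>\<^bsub>M\<^esub>g\<in>G. q g m \<odot>\<^bsub>M\<^esub> g)"
    using assms unfolding left_finite_rank_def by blast
  moreover have "q g m \<in> carrier B" if "g \<in> G" for g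
    using left_hom_regular_closed[of "q g" B M m] calculation(2) that assms(2) by blast
  ultimately show ?thesis
    by (auto intro!: M.finsum_closed lsmult_closed)
qed

lemma left_finite_rank_zero: "left_finite_rank B M (\<lambda>m. \<zero>\<^bsub>M\<^esub>)"
  unfolding left_finite_rank_def by (intro exI[of _ "{}"] exI[of _ "\<lambda>_. undefined"]) simp

lemma left_finite_rank_one:
  assumes "x \<in> carrier M" "q \<in> left_hom B M (regular B)"
  shows "left_finite_rank B M (\<lambda>m. q m \<odot>\<^bsub>M\<^esub> x)"
  unfolding left_finite_rank_def
proof (intro exI[of _ "{x}"] exI[of _ "\<lambda>_. q"] conjI ballI)
  fix m assume "m \<in> carrier M"
  then have "q m \<odot>\<^bsub>M\<^esub> x \<in> carrier M"
    using assms(1) left_hom_regular_closed[OF assms(2)] by (simp add: lsmult_closed)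
  then show "q m \<odot>\<^bsub>M\<^esub> x = (\<Oplus>\<^bsub>M\<^esub>g\<in>{x}. q m \<odot>\<^bsub>M\<^esub> g)"
    by (simp add: M.finsum_insert)
qed (use assms in auto)

text \<open>An element may lie in both \<open>G\<close> and \<open>H\<close>, so the two families of
  functionals are extended by zero to the union and then added.\<close>

lemma left_finite_rank_add:
  assumes a: "left_finite_rank B M a" and b: "left_finite_rank B M b"
  shows "left_finite_rank B M (\<lambda>m. a m \<oplus>\<^bsub>M\<^esub> b m)"
proof -
  have zero: "(\<lambda>m\<in>carrier M. \<zero>\<^bsub>B\<^esub>) \<in> left_hom B M (regular B)"
    by (rule left_hom_regularI[OF left_module_axioms]) auto
  obtain G q where G: "finite G" "G \<subseteq> carrier M" "q \<in> G \<rightarrow> left_hom B M (regular B)"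
    "\<And>m. m \<in> carrier M \<Longrightarrow> a m = (\<Oplus>\<^bsub>M\<^esub>g\<in>G. q g m \<odot>\<^bsub>M\<^esub> g)"
    using a unfolding left_finite_rank_def by blast
  obtain H r where H: "finite H" "H \<subseteq> carrier M" "r \<in> H \<rightarrow> left_hom B M (regular B)"
    "\<And>m. m \<in> carrier M \<Longrightarrow> b m = (\<Oplus>\<^bsub>M\<^esub>g\<in>H. r g m \<odot>\<^bsub>M\<^esub> g)"
    using b unfolding left_finite_rank_def by blast
  define q' where "q' g = (if g \<in> G then q g else (\<lambda>m\<in>carrier M. \<zero>\<^bsub>B\<^esub>))" for g
  define r' where "r' g = (if g \<in> H then r g else (\<lambda>m\<in>carrier M. \<zero>\<^bsub>B\<^esub>))" for g
  have q': "q' g \<in> left_hom B M (regular B)" for g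
    using G(3) zero by (auto simp: q'_def)
  have r': "r' g \<in> left_hom B M (regular B)" for g
    using H(3) zero by (auto simp: r'_def)
  note qc = left_hom_regular_closed[OF q'] and rc = left_hom_regular_closed[OF r']
  have "a m \<oplus>\<^bsub>M\<^esub> b m = (\<Oplus>\<^bsub>M\<^esub>g\<in>G \<union> H. (q' g m \<oplus>\<^bsub>B\<^esub> r' g m) \<odot>\<^bsub>M\<^esub> g)" if m: "m \<in> carrier M" for m
  proof -
    have "(\<Oplus>\<^bsub>M\<^esub>g\<in>G \<union> H. q' g m \<odot>\<^bsub>M\<^esub> g) = a m"
      unfolding G(4)[OF m]
      using G(1,2) H(1,2) m qc
      by (intro M.add.finprod_mono_neutral_cong_right) (auto simp: q'_def zero_smult intro!: lsmult_closed)
    moreover have "(\<Oplus>\<^bsub>M\<^esub>g\<in>G \<union> H. r' g m \<odot>\<^bsub>M\<^esub> g) = b m"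
      unfolding H(4)[OF m]
      using G(1,2) H(1,2) m rc
      by (intro M.add.finprod_mono_neutral_cong_right) (auto simp: r'_def zero_smult intro!: lsmult_closed)
    moreover have "(\<Oplus>\<^bsub>M\<^esub>g\<in>G \<union> H. (q' g m \<oplus>\<^bsub>B\<^esub> r' g m) \<odot>\<^bsub>M\<^esub> g) =
        (\<Oplus>\<^bsub>M\<^esub>g\<in>G \<union> H. q' g m \<odot>\<^bsub>M\<^esub> g \<oplus>\<^bsub>M\<^esub> r' g m \<odot>\<^bsub>M\<^esub> g)"
      using G(2) H(2) m qc rc
      by (intro finsum_eqI M.abelian_group_axioms) (auto simp: lsmult_l_distr intro!: lsmult_closed)
    moreover have "\<dots> = (\<Oplus>\<^bsub>M\<^esub>g\<in>G \<union> H. q' g m \<odot>\<^bsub>M\<^esub> g) \<oplus>\<^bsub>M\<^esub> (\<Oplus>\<^bsub>M\<^esub>g\<in>G \<union> H. r' g m \<odot>\<^bsub>M\<^esub> g)"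
      using G(2) H(2) m qc rc by (intro M.finsum_addf) (auto intro!: lsmult_closed)
    ultimately show ?thesis by simp
  qed
  moreover have "(\<lambda>m\<in>carrier M. q' g m \<oplus>\<^bsub>B\<^esub> r' g m) \<in> left_hom B M (regular B)" for g
    using qc rc
    by (intro left_hom_regularI[OF left_module_axioms])
      (simp_all add: left_hom_regular_add[OF q'] left_hom_regular_add[OF r'] left_hom_regular_smult[OF q']
        left_hom_regular_smult[OF r'] B.r_distr B.a_ac)
  ultimately show ?thesis
    unfolding left_finite_rank_def using G(1,2) H(1,2)
    by (intro exI[of _ "G \<union> H"] exI[of _ "\<lambda>g. \<lambda>m\<in>carrier M. q' g m \<oplus>\<^bsub>B\<^esub> r' g m"]) simp
qed

lemma left_finite_rank_finsum:
  assumes "finite I" "\<And>i. i \<in> I \<Longrightarrow> left_finite_rank B M (a i)"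
  shows "left_finite_rank B M (\<lambda>m. \<Oplus>\<^bsub>M\<^esub>i\<in>I. a i m)"
  using assms
proof (induction I)
  case empty
  then show ?case by (simp add: left_finite_rank_zero)
next
  case (insert i I)
  have "left_finite_rank B M (\<lambda>m. a i m \<oplus>\<^bsub>M\<^esub> (\<Oplus>\<^bsub>M\<^esub>i\<in>I. a i m))"
    using insert by (intro left_finite_rank_add) auto
  then show ?case
  proof (rule left_finite_rank_cong)
    fix m assume m: "m \<in> carrier M"
    have "a j m \<in> carrier M" if "j \<in> insert i I" for j
      using insert.prems[OF that] m by (rule left_finite_rank_closed)
    then show "(\<Oplus>\<^bsub>M\<^esub>j\<in>insert i I. a j m) = a i m \<oplus>\<^bsub>M\<^esub> (\<Oplus>\<^bsub>M\<^esub>j\<in>I. a j m)"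
      using insert.hyps by (intro M.finsum_insert) auto
  qed
qed

end

text \<open>The dual basis criterion for finitely generated projective modules: the identity has
  finite rank.\<close>

definition has_left_dual_basis :: "('b, 'r) ring_scheme \<Rightarrow> ('b, 'm, 's) module_scheme \<Rightarrow> bool"
  where "has_left_dual_basis B M \<longleftrightarrow> left_finite_rank B M (\<lambda>m. m)"

text \<open>A dual basis of \<open>Y\<close> with elements \<open>h\<close> and functionals
  \<open>q h\<close> yields one of \<open>X\<close> with elements \<open>g i h\<close> and
  functionals \<open>q h\<close> after \<open>f i\<close>. Different indices may give the same
  element, hence the detour through sums of finite rank maps.\<close>

lemma has_left_dual_basis_retract:
  assumes "left_module B X" "left_module B Y" "has_left_dual_basis B Y" "finite I"
    and f: "\<And>i. i \<in> I \<Longrightarrow> f i \<in> left_hom B X Y" and g: "\<And>i. i \<in> I \<Longrightarrow> g i \<in> left_hom B Y X"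
    and gf: "\<And>x. x \<in> carrier X \<Longrightarrow> (\<Oplus>\<^bsub>X\<^esub>i\<in>I. g i (f i x)) = x"
  shows "has_left_dual_basis B X"
proof -
  interpret X: left_module B X by fact
  interpret Y: left_module B Y by fact
  obtain G q where G: "finite G" "G \<subseteq> carrier Y" "q \<in> G \<rightarrow> left_hom B Y (regular B)"
    and yq: "\<And>y. y \<in> carrier Y \<Longrightarrow> y = (\<Oplus>\<^bsub>Y\<^esub>h\<in>G. q h y \<odot>\<^bsub>Y\<^esub> h)"
    using assms(3) unfolding has_left_dual_basis_def left_finite_rank_def by blast
  have "left_finite_rank B X (\<lambda>x. g i (f i x))" if i: "i \<in> I" for i
  proof -
    let ?r = "\<lambda>h. compose (carrier X) (q h) (f i)"
    have "left_finite_rank B X (\<lambda>x. \<Oplus>\<^bsub>X\<^esub>h\<in>G. ?r h x \<odot>\<^bsub>X\<^esub> g i h)"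
      using G i
      by (intro X.left_finite_rank_finsum X.left_finite_rank_one compose_left_hom[OF f] left_hom_closed[OF g] assms) auto
    moreover have "g i (f i x) = (\<Oplus>\<^bsub>X\<^esub>h\<in>G. ?r h x \<odot>\<^bsub>X\<^esub> g i h)" if x: "x \<in> carrier X" for x
    proof -
      have fx: "f i x \<in> carrier Y" using left_hom_closed[OF f[OF i] x] .
      have qc: "q h (f i x) \<in> carrier B" if "h \<in> G" for h
        using left_hom_regular_closed[OF funcset_mem[OF G(3) that] fx] .
      have "g i (f i x) = (\<Oplus>\<^bsub>X\<^esub>h\<in>G. g i (q h (f i x) \<odot>\<^bsub>Y\<^esub> h))"
        using G qc by (subst yq[OF fx], intro add_hom_finsum Y.M.abelian_group_axioms X.M.abelian_group_axioms
            left_hom_add_hom[OF g] i) (auto intro!: Y.lsmult_closed)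
      also have "\<dots> = (\<Oplus>\<^bsub>X\<^esub>h\<in>G. ?r h x \<odot>\<^bsub>X\<^esub> g i h)"
        using G qc x left_hom_closed[OF g[OF i]] left_hom_smult[OF g[OF i]]
        by (intro finsum_eqI X.M.abelian_group_axioms) (auto simp: compose_def intro!: X.lsmult_closed)
      finally show ?thesis .
    qed
    ultimately show ?thesis by (rule left_finite_rank_cong)
  qed
  then have "left_finite_rank B X (\<lambda>x. \<Oplus>\<^bsub>X\<^esub>i\<in>I. g i (f i x))"
    by (intro X.left_finite_rank_finsum assms)
  then show ?thesis
    unfolding has_left_dual_basis_def by (rule left_finite_rank_cong) (simp add: gf)
qed

section \<open>The dual basis criterion, in both directions\<close>

lemma left_module_regular:
  assumes "ring B" shows "left_module B (via_bimod id \<psi> B)"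
proof -
  interpret ring B by fact
  show ?thesis
    by (intro left_module.intro left_module_axioms.intro ring_axioms abelian_group_cong[OF abelian_group_axioms])
      (auto simp: l_distr r_distr m_assoc)
qed

lemma has_left_dual_basis_imp_fin_gen:
  assumes "has_left_dual_basis B M" shows "left_fin_gen B M"
proof -
  obtain G q where G: "finite G" "G \<subseteq> carrier M" "q \<in> G \<rightarrow> left_hom B M (regular B)"
    and mq: "\<And>m. m \<in> carrier M \<Longrightarrow> m = (\<Oplus>\<^bsub>M\<^esub>g\<in>G. q g m \<odot>\<^bsub>M\<^esub> g)"
    using assms unfolding has_left_dual_basis_def left_finite_rank_def by blast
  show ?thesis
    unfolding left_fin_gen_def
  proof (intro exI[of _ G] conjI ballI)
    fix m assume m: "m \<in> carrier M"
    show "\<exists>c\<in>G \<rightarrow> carrier B. m = (\<Oplus>\<^bsub>M\<^esub>g\<in>G. c g \<odot>\<^bsub>M\<^esub> g)"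
      using mq[OF m] left_hom_regular_closed[OF funcset_mem[OF G(3)] m] by (intro bexI[of _ "\<lambda>g. q g m"]) auto
  qed (use G in auto)
qed

text \<open>The functionals map \<open>M\<close> into the free module on \<open>G\<close>, and
  forming the combination of the elements of \<open>G\<close> with given coefficients is a left
  inverse. As \<open>G\<close> consists of elements of \<open>M\<close>, the index set and the
  complement have the types fixed in \<open>left_projective\<close>.\<close>

lemma has_left_dual_basis_imp_projective:
  fixes B :: "('b, 'r) ring_scheme" and M :: "('b, 'a, 'm, 's) bimodule_scheme"
  assumes "left_module B M" "has_left_dual_basis B M" shows "left_projective B M"
proof -
  interpret M: left_module B M by fact
  obtain G q where G: "finite G" "G \<subseteq> carrier M" "q \<in> G \<rightarrow> left_hom B M (regular B)"
    and mq: "\<And>m. m \<in> carrier M \<Longrightarrow> m = (\<Oplus>\<^bsub>M\<^esub>g\<in>G. q g m \<odot>\<^bsub>M\<^esub> g)"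
    using assms unfolding has_left_dual_basis_def left_finite_rank_def by blast
  have R: "left_module B (regular B)" by (rule left_module_regular) (rule M.B.ring_axioms)
  define Z where "Z = copies G (regular B)"
  interpret Z: left_module B Z unfolding Z_def by (rule left_module_copies) (rule R)
  define s where "s g = (\<lambda>b\<in>carrier B. b \<odot>\<^bsub>M\<^esub> g)" for g
  have s: "s g \<in> left_hom B (regular B) M" if "g \<in> G" for g
    using left_homI[OF R, of "\<lambda>b. b \<odot>\<^bsub>M\<^esub> g" M] that G(2)
    by (auto simp: s_def M.lsmult_closed M.lsmult_l_distr M.lsmult_assoc subset_iff)
  define F where "F = (\<lambda>x\<in>carrier M. \<lambda>g\<in>G. q g x)"
  define E where "E = (\<lambda>z\<in>carrier Z. \<Oplus>\<^bsub>M\<^esub>g\<in>G. s g (z g))"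
  have F: "F \<in> left_hom B M Z"
    unfolding F_def Z_def using G by (intro into_copies_left_hom assms) auto
  have E: "E \<in> left_hom B Z M"
    unfolding E_def Z_def by (intro from_copies_left_hom assms R s)
  have EF: "E (F x) = x" if x: "x \<in> carrier M" for x
  proof -
    have "E (F x) = (\<Oplus>\<^bsub>M\<^esub>g\<in>G. s g (F x g))"
      using left_hom_closed[OF F x] by (simp add: E_def)
    also have "\<dots> = (\<Oplus>\<^bsub>M\<^esub>g\<in>G. q g x \<odot>\<^bsub>M\<^esub> g)"
      using x G(2) left_hom_regular_closed[OF funcset_mem[OF G(3)]]
      by (intro finsum_eqI M.M.abelian_group_axioms) (auto simp: F_def s_def intro!: M.lsmult_closed)
    finally show ?thesis using mq[OF x] by simp
  qed
  \<comment> \<open>The complement is a one-sided module stored in a bimodule record; the slot for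
    its right action is filled with \<open>undefined\<close>.\<close>
  define K :: "('b, 'a, 'm \<Rightarrow> 'b) bimodule" where "K = hom_kernel Z M E undefined"
  have "left_module B K"
    unfolding K_def by (intro hom_kernel_left_module assms Z.left_module_axioms E)
  moreover have "retract_iso M Z F E \<in> left_hom B (dsum M K) Z"
    unfolding K_def by (intro retract_iso_left_hom assms Z.left_module_axioms F E)
  moreover have "bij_betw (retract_iso M Z F E) (carrier (dsum M K)) (carrier Z)"
    using bij_betw_retract_iso[OF M.M.abelian_group_axioms Z.M.abelian_group_axioms
        left_hom_add_hom[OF F] left_hom_add_hom[OF E]] EF
    by (simp add: K_def)
  ultimately show ?thesis
    unfolding left_projective_def left_isomorphic_def Z_def by blast
qed

text \<open>The functionals are the coordinates of an embedding of \<open>M\<close> as a summand of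
  a free module, the elements are the images of the unit vectors under the retraction. The free
  module may have infinite rank, so finite generation has to bound the coordinates involved.\<close>

lemma has_left_dual_basisI:
  fixes B :: "('b, 'r) ring_scheme" and M :: "('b, 'a, 'm, 's) bimodule_scheme"
  assumes M: "left_module B M" and fg: "left_fin_gen B M" and pr: "left_projective B M"
  shows "has_left_dual_basis B M"
proof -
  interpret M: left_module B M by fact
  have R: "left_module B (regular B)" by (rule left_module_regular) (rule M.B.ring_axioms)
  interpret R: left_module B "regular B" by (rule R)
  obtain I :: "'m set" and Q :: "('b, 'a, 'm \<Rightarrow> 'b) bimodule"
    where Q: "left_module B Q" and iso: "left_isomorphic B (dsum M Q) (copies I (regular B))"
    using pr unfolding left_projective_def by blast
  define Z where "Z = copies I (regular B)"
  interpret Z: left_module B Z unfolding Z_def by (rule left_module_copies) (rule R)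
  interpret Q: left_module B Q by fact
  obtain h where h: "h \<in> left_hom B (dsum M Q) Z"
    and "bij_betw h (carrier (dsum M Q)) (carrier Z)"
    using iso unfolding left_isomorphic_def Z_def by blast
  then have bij: "bij_betw h (carrier M \<times> carrier Q) (carrier Z)" by simp
  define s where "s = dsum_section M Q h"
  define r where "r = dsum_retraction M Q Z h"
  have s: "s \<in> left_hom B M Z"
    unfolding s_def by (intro dsum_section_left_hom M Q h)
  have r: "r \<in> left_hom B Z M"
    unfolding r_def by (intro dsum_retraction_left_hom M Q h bij Z.left_module_axioms)
  have rs: "r (s m) = m" if "m \<in> carrier M" for m
    using dsum_retraction_section[OF Q.M.abelian_group_axioms bij that] by (simp add: r_def s_def)
  define p where "p i = compose (carrier M) (copies_proj I (regular B) i) s" for i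
  have p: "p i \<in> left_hom B M (regular B)" if "i \<in> I" for i
    unfolding p_def by (intro compose_left_hom[OF s] M)
      (unfold Z_def, intro copies_proj_left_hom R that)
  have p_eq: "p i m = s m i" if "m \<in> carrier M" for m i
    using that left_hom_closed[OF s that] by (simp add: p_def compose_def copies_proj_def Z_def)
  have sZ: "s m \<in> carrier Z" if "m \<in> carrier M" for m
    using that by (rule left_hom_closed[OF s])
  obtain G where G: "finite G" "G \<subseteq> carrier M"
    and gen: "\<And>m. m \<in> carrier M \<Longrightarrow> \<exists>c\<in>G \<rightarrow> carrier B. m = (\<Oplus>\<^bsub>M\<^esub>g\<in>G. c g \<odot>\<^bsub>M\<^esub> g)"
    using fg unfolding left_fin_gen_def by blast
  \<comment> \<open>Only the coordinates that are nonzero on some generator matter, and they are finitely many.\<close>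
  define J where "J = (\<Union>g\<in>G. {i \<in> I. s g i \<noteq> \<zero>\<^bsub>B\<^esub>})"
  have J: "finite J" "J \<subseteq> I"
    using G sZ by (auto simp: J_def Z_def)
  \<comment> \<open>The coordinate \<open>p i\<close> is linear and vanishes on every generator,
    hence on all of \<open>M\<close>.\<close>
  have supp: "s m i = \<zero>\<^bsub>B\<^esub>" if m: "m \<in> carrier M" and i: "i \<in> I - J" for m i
  proof -
    obtain c where c: "c \<in> G \<rightarrow> carrier B" "m = (\<Oplus>\<^bsub>M\<^esub>g\<in>G. c g \<odot>\<^bsub>M\<^esub> g)"
      using gen[OF m] by blast
    have iI: "i \<in> I" using i by blast
    have "p i m = (\<Oplus>\<^bsub>B\<^esub>g\<in>G. p i (c g \<odot>\<^bsub>M\<^esub> g))"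
      unfolding c(2) using c(1) G(2)
      by (intro add_hom_finsum M.M.abelian_group_axioms M.B.abelian_group_axioms
          left_hom_regular_add_hom[OF p[OF iI]]) (auto intro!: M.lsmult_closed)
    also have "\<dots> = (\<Oplus>\<^bsub>B\<^esub>g\<in>G. \<zero>\<^bsub>B\<^esub>)"
    proof (intro finsum_eqI M.B.abelian_group_axioms)
      fix g assume g: "g \<in> G"
      then have "p i g = \<zero>\<^bsub>B\<^esub>" using i G(2) by (auto simp: p_eq J_def)
      then show "p i (c g \<odot>\<^bsub>M\<^esub> g) = \<zero>\<^bsub>B\<^esub>"
        using g c(1) G(2) left_hom_regular_smult[OF p[OF iI], of "c g" g] by auto
    qed simp
    finally show ?thesis using m by (simp add: p_eq)
  qed
  define y where "y i = r (copies_inj I (regular B) i \<one>\<^bsub>B\<^esub>)" for i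
  have \<iota>: "copies_inj I (regular B) i \<in> left_hom B (regular B) Z" for i
    unfolding Z_def by (rule copies_inj_left_hom) (rule R)
  note \<iota>c = left_hom_closed[OF \<iota>, simplified]
  have yc: "y i \<in> carrier M" for i
    unfolding y_def by (intro left_hom_closed[OF r] \<iota>c) simp
  have "left_finite_rank B M (\<lambda>m. \<Oplus>\<^bsub>M\<^esub>i\<in>J. p i m \<odot>\<^bsub>M\<^esub> y i)"
    using J p yc by (intro M.left_finite_rank_finsum M.left_finite_rank_one) auto
  then show ?thesis
    unfolding has_left_dual_basis_def
  proof (rule left_finite_rank_cong)
    fix m assume m: "m \<in> carrier M"
    have smc: "s m i \<in> carrier B" if "i \<in> J" for i
      using sZ[OF m] that J(2) by (auto simp: Z_def)
    have "s m = (\<Oplus>\<^bsub>Z\<^esub>i\<in>J. copies_inj I (regular B) i (s m i))"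
      unfolding Z_def
      by (rule copies_expand) (use R.M.abelian_group_axioms sZ[OF m] J supp[OF m] in \<open>auto simp: Z_def\<close>)
    then have "m = r (\<Oplus>\<^bsub>Z\<^esub>i\<in>J. copies_inj I (regular B) i (s m i))"
      using rs[OF m] by simp
    also have "\<dots> = (\<Oplus>\<^bsub>M\<^esub>i\<in>J. r (copies_inj I (regular B) i (s m i)))"
      using smc \<iota>c
      by (intro add_hom_finsum[OF Z.M.abelian_group_axioms M.M.abelian_group_axioms left_hom_add_hom[OF r]]) auto
    also have "\<dots> = (\<Oplus>\<^bsub>M\<^esub>i\<in>J. p i m \<odot>\<^bsub>M\<^esub> y i)"
    proof (intro finsum_eqI M.M.abelian_group_axioms)
      fix i assume i: "i \<in> J"
      \<comment> \<open>A vector concentrated in position \<open>i\<close> is a scalar multiple of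
        the unit vector there, so linearity of \<open>r\<close> produces \<open>y i\<close>.\<close>
      have "copies_inj I (regular B) i (s m i) = s m i \<odot>\<^bsub>Z\<^esub> copies_inj I (regular B) i \<one>\<^bsub>B\<^esub>"
        using left_hom_smult[OF \<iota>, of "s m i" "\<one>\<^bsub>B\<^esub>" i] smc[OF i] by simp
      then show "r (copies_inj I (regular B) i (s m i)) = p i m \<odot>\<^bsub>M\<^esub> y i"
        using smc[OF i] m by (simp add: left_hom_smult[OF r] \<iota>c p_eq y_def)
      show "p i m \<odot>\<^bsub>M\<^esub> y i \<in> carrier M"
        using smc[OF i] m yc by (simp add: p_eq M.lsmult_closed)
    qed
    finally show "m = (\<Oplus>\<^bsub>M\<^esub>i\<in>J. p i m \<odot>\<^bsub>M\<^esub> y i)" .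
  qed
qed

subsection \<open>Right dual bases\<close>

definition has_right_dual_basis :: "('a, 'r) ring_scheme \<Rightarrow> ('b, 'a, 'm, 's) bimodule_scheme \<Rightarrow> bool"
  where "has_right_dual_basis A M \<longleftrightarrow> has_left_dual_basis (opp_ring A) (opp_mod M)"

lemma has_right_dual_basisI:
  assumes "right_module A M" "right_fin_gen A M" "right_projective A M"
  shows "has_right_dual_basis A M"
proof -
  interpret right_module A M by fact
  show ?thesis
    using assms has_left_dual_basisI[of "opp_ring A" "opp_mod M"]
    by (simp add: has_right_dual_basis_def right_module_iff_opp[OF A.ring_axioms] right_fin_gen_opp
        right_projective_opp[OF A.ring_axioms])
qed

lemma has_right_dual_basis_imp:
  assumes "right_module A M" "has_right_dual_basis A M"
  shows "right_fin_gen A M" "right_projective A M"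
proof -
  interpret right_module A M by fact
  show "right_fin_gen A M" "right_projective A M"
    using assms has_left_dual_basis_imp_fin_gen[of "opp_ring A" "opp_mod M"]
      has_left_dual_basis_imp_projective[of "opp_ring A" "opp_mod M"]
    by (simp_all add: has_right_dual_basis_def right_module_iff_opp[OF A.ring_axioms] right_fin_gen_opp
        right_projective_opp[OF A.ring_axioms])
qed

lemma has_left_dual_basisE:
  assumes "has_left_dual_basis B M"
  obtains H q where "finite H" "H \<subseteq> carrier M" "\<And>h. h \<in> H \<Longrightarrow> q h \<in> left_hom B M (regular B)"
    "\<And>m. m \<in> carrier M \<Longrightarrow> (\<Oplus>\<^bsub>M\<^esub>h\<in>H. q h m \<odot>\<^bsub>M\<^esub> h) = m"
proof -
  obtain H q where "finite H" "H \<subseteq> carrier M" "q \<in> H \<rightarrow> left_hom B M (regular B)"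
    "\<forall>m\<in>carrier M. m = (\<Oplus>\<^bsub>M\<^esub>h\<in>H. q h m \<odot>\<^bsub>M\<^esub> h)"
    using assms unfolding has_left_dual_basis_def left_finite_rank_def by blast
  then show ?thesis
    by (intro that[of H q]) (auto simp: Pi_iff)
qed

lemma has_right_dual_basisE:
  assumes "has_right_dual_basis A M"
  obtains G p where "finite G" "G \<subseteq> carrier M" "\<And>g. g \<in> G \<Longrightarrow> p g \<in> right_hom A M (regular A)"
    "\<And>m. m \<in> carrier M \<Longrightarrow> (\<Oplus>\<^bsub>M\<^esub>g\<in>G. g \<odot>\<^sub>r\<^bsub>M\<^esub> p g m) = m"
proof -
  obtain G p where "finite G" "G \<subseteq> carrier (opp_mod M)"
    "\<And>g. g \<in> G \<Longrightarrow> p g \<in> left_hom (opp_ring A) (opp_mod M) (regular (opp_ring A))"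
    "\<And>m. m \<in> carrier (opp_mod M) \<Longrightarrow> (\<Oplus>\<^bsub>opp_mod M\<^esub>g\<in>G. p g m \<odot>\<^bsub>opp_mod M\<^esub> g) = m"
    using has_left_dual_basisE[OF assms[unfolded has_right_dual_basis_def]] by blast
  then show ?thesis
    by (intro that[of G p])
      (simp_all add: regular_opp_ring right_hom_opp[symmetric] finsum_record_cong[of "opp_mod M" M])
qed

lemma has_right_dual_basis_retract:
  assumes "right_module A X" "right_module A Y" "has_right_dual_basis A Y" "finite I"
    and "\<And>i. i \<in> I \<Longrightarrow> f i \<in> right_hom A X Y" and "\<And>i. i \<in> I \<Longrightarrow> g i \<in> right_hom A Y X"
    and "\<And>x. x \<in> carrier X \<Longrightarrow> (\<Oplus>\<^bsub>X\<^esub>i\<in>I. g i (f i x)) = x"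
  shows "has_right_dual_basis A X"
proof -
  interpret right_module A X by fact
  show ?thesis
    unfolding has_right_dual_basis_def
    by (rule has_left_dual_basis_retract[of "opp_ring A" "opp_mod X" "opp_mod Y" I f g])
      (use assms in \<open>simp_all add: has_right_dual_basis_def right_module_iff_opp[OF A.ring_axioms] right_hom_opp
        finsum_record_cong[of "opp_mod X" X]\<close>)
qed

section \<open>Tools for extensional homomorphisms and for rings as bimodules\<close>

lemma left_hom_eqI:
  "\<lbrakk>f \<in> left_hom B M N; g \<in> left_hom B M N'; \<And>x. x \<in> carrier M \<Longrightarrow> f x = g x\<rbrakk> \<Longrightarrow> f = g"
  by (meson extensionalityI left_hom_extensional)

lemma right_hom_eqI:
  "\<lbrakk>f \<in> right_hom A M N; g \<in> right_hom A M N'; \<And>x. x \<in> carrier M \<Longrightarrow> f x = g x\<rbrakk> \<Longrightarrow> f = g"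
  by (meson extensionalityI right_hom_extensional)

lemma bimod_homI:
  assumes "bimodule B A M"
    and "\<And>x. x \<in> carrier M \<Longrightarrow> f x \<in> carrier N"
    and "\<And>x y. \<lbrakk>x \<in> carrier M; y \<in> carrier M\<rbrakk> \<Longrightarrow> f (x \<oplus>\<^bsub>M\<^esub> y) = f x \<oplus>\<^bsub>N\<^esub> f y"
    and "\<And>b x. \<lbrakk>b \<in> carrier B; x \<in> carrier M\<rbrakk> \<Longrightarrow> f (b \<odot>\<^bsub>M\<^esub> x) = b \<odot>\<^bsub>N\<^esub> f x"
    and "\<And>a x. \<lbrakk>a \<in> carrier A; x \<in> carrier M\<rbrakk> \<Longrightarrow> f (x \<odot>\<^sub>r\<^bsub>M\<^esub> a) = f x \<odot>\<^sub>r\<^bsub>N\<^esub> a"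
  shows "(\<lambda>x\<in>carrier M. f x) \<in> bimod_hom B A M N"
proof -
  interpret bimodule B A M by fact
  show ?thesis
    unfolding bimod_hom_def using assms(2-)
    by (intro IntI left_homI right_homI left_module_axioms right_module_axioms) auto
qed

lemma finsum_via_bimod [simp]: "finsum (via_bimod \<phi> \<psi> R) = finsum R"
  by (rule finsum_record_cong) simp_all

lemma bimodule_via_bimod:
  assumes "ring_hom_ring B R \<phi>" "ring_hom_ring C R \<psi>"
  shows "bimodule B C (via_bimod \<phi> \<psi> R)"
proof -
  interpret f: ring_hom_ring B R \<phi> by fact
  interpret g: ring_hom_ring C R \<psi> by fact
  have ag: "abelian_group (via_bimod \<phi> \<psi> R)"
    by (rule abelian_group_cong[OF f.S.abelian_group_axioms]) simp_all
  have "left_module B (via_bimod \<phi> \<psi> R)"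
    by (intro left_module.intro left_module_axioms.intro f.R.ring_axioms ag)
      (simp_all add: f.S.l_distr f.S.r_distr f.S.m_assoc)
  moreover have "right_module C (via_bimod \<phi> \<psi> R)"
    by (intro right_module.intro right_module_axioms.intro g.R.ring_axioms ag)
      (simp_all add: f.S.l_distr f.S.r_distr f.S.m_assoc)
  ultimately show ?thesis
    by (intro bimodule.intro bimodule_axioms.intro) (simp_all add: f.S.m_assoc)
qed

lemma ring_hom_ring_id: "ring R \<Longrightarrow> ring_hom_ring R R id"
  by (intro ring_hom_ringI) auto

lemma compose_apply: "x \<in> S \<Longrightarrow> compose S g f x = g (f x)"
  by (simp add: compose_def)

subsection \<open>The endomorphism ring\<close>

lemma right_End_simps [simp]:
  "carrier (right_End A M) = right_hom A M M"
  "mult (right_End A M) = compose (carrier M)"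
  "\<one>\<^bsub>right_End A M\<^esub> = (\<lambda>m\<in>carrier M. m)"
  "\<zero>\<^bsub>right_End A M\<^esub> = (\<lambda>m\<in>carrier M. \<zero>\<^bsub>M\<^esub>)"
  "e \<oplus>\<^bsub>right_End A M\<^esub> f = (\<lambda>m\<in>carrier M. e m \<oplus>\<^bsub>M\<^esub> f m)"
  by (simp_all add: right_End_def)

lemma ring_right_End:
  assumes "right_module A M" shows "ring (right_End A M)"
proof -
  interpret right_module A M by fact
  have "abelian_group (right_End A M)"
    by (rule pointwise_abelian_group[OF M.abelian_group_axioms, where S = "carrier M"])
      (auto simp: right_hom_def PiE_iff extensional_def rsmult_closed rsmult_zero rsmult_neg rsmult_l_distr
        M.a_ac M.minus_add)
  moreover have "monoid (right_End A M)"
    by (rule monoidI)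
      (auto simp: right_hom_def PiE_iff extensional_def rsmult_closed compose_def fun_eq_iff)
  ultimately show ?thesis
    by (rule ringI) (auto simp: right_hom_def PiE_iff compose_def fun_eq_iff)
qed

lemma left_mult_map_hom:
  assumes "bimodule B A M" shows "ring_hom_ring B (right_End A M) (left_mult_map M)"
proof -
  interpret bimodule B A M by fact
  show ?thesis
    by (rule ring_hom_ringI[OF B.ring_axioms ring_right_End[OF right_module_axioms]])
      (auto simp: left_mult_map_def right_hom_def lsmult_closed rsmult_closed lsmult_r_distr lsmult_l_distr
        lsmult_assoc lsmult_one smult_rsmult_assoc compose_def fun_eq_iff)
qed

section \<open>Rank-one endomorphisms and dual basis expansions\<close>

definition rank_one :: "('b, 'a, 'm, 's) bimodule_scheme \<Rightarrow> 'm \<Rightarrow> ('m \<Rightarrow> 'a) \<Rightarrow> 'm \<Rightarrow> 'm"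
  where "rank_one M m f = (\<lambda>x\<in>carrier M. m \<odot>\<^sub>r\<^bsub>M\<^esub> f x)"

text \<open>The dual basis is fixed as data, because the maps between \<open>E\<close> and its duals
  are defined by explicit sums over \<open>G\<close>.\<close>

locale bimodule_right_dual_basis = bimodule B A M
  for B :: "('b, 'r) ring_scheme" (structure) and A :: "('a, 'q) ring_scheme" (structure)
    and M :: "('b, 'a, 'm, 's) bimodule_scheme" (structure) +
  fixes G :: "'m set" and p :: "'m \<Rightarrow> 'm \<Rightarrow> 'a"
  assumes finite_G: "finite G" and G_sub: "G \<subseteq> carrier M"
    and p: "g \<in> G \<Longrightarrow> p g \<in> right_hom A M (regular A)"
    and dual_basis: "m \<in> carrier M \<Longrightarrow> (\<Oplus>\<^bsub>M\<^esub>g\<in>G. g \<odot>\<^sub>r\<^bsub>M\<^esub> p g m) = m"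
begin

abbreviation E :: "('m \<Rightarrow> 'm) ring" where "E \<equiv> right_End A M"
abbreviation lm :: "'b \<Rightarrow> 'm \<Rightarrow> 'm" where "lm \<equiv> left_mult_map M"
abbreviation RD :: "('a, 'b, 'm \<Rightarrow> 'a) bimodule" where "RD \<equiv> right_dual A M"
abbreviation LD :: "('a, 'b, 'm \<Rightarrow> 'b) bimodule" where "LD \<equiv> left_dual B M"
text \<open>In \<open>EEB\<close> and \<open>BEE\<close> the outer letters are the rings acting on
  the left and on the right, and the middle letter is the module; \<open>B\<close> acts through
  \<open>lm\<close>.\<close>

abbreviation EEB :: "('m \<Rightarrow> 'm, 'b, 'm \<Rightarrow> 'm) bimodule" where "EEB \<equiv> via_bimod id lm E"
abbreviation BEE :: "('b, 'm \<Rightarrow> 'm, 'm \<Rightarrow> 'm) bimodule" where "BEE \<equiv> via_bimod lm id E"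
abbreviation T :: "'m \<Rightarrow> ('m \<Rightarrow> 'a) \<Rightarrow> 'm \<Rightarrow> 'm" where "T \<equiv> rank_one M"
abbreviation comp :: "('m \<Rightarrow> 'c) \<Rightarrow> ('m \<Rightarrow> 'm) \<Rightarrow> 'm \<Rightarrow> 'c" (infixr \<open>\<circ>\<^sub>M\<close> 75)
  where "f \<circ>\<^sub>M e \<equiv> compose (carrier M) f e"

sublocale E: ring E by (rule ring_right_End) (rule right_module_axioms)
sublocale RD: bimodule A B RD by (rule bimodule_right_dual) (rule bimodule_axioms)
sublocale LD: bimodule A B LD by (rule bimodule_left_dual) (rule bimodule_axioms)

lemma EEB: "bimodule E B EEB"
  by (intro bimodule_via_bimod ring_hom_ring_id E.ring_axioms left_mult_map_hom bimodule_axioms)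

lemma BEE: "bimodule B E BEE"
  by (intro bimodule_via_bimod ring_hom_ring_id E.ring_axioms left_mult_map_hom bimodule_axioms)

lemma G_closed: "g \<in> G \<Longrightarrow> g \<in> carrier M"
  using G_sub by blast

lemma End_closed: "\<lbrakk>e \<in> carrier E; m \<in> carrier M\<rbrakk> \<Longrightarrow> e m \<in> carrier M"
  by (auto simp: right_hom_def)

lemma RD_closed: "\<lbrakk>f \<in> carrier RD; m \<in> carrier M\<rbrakk> \<Longrightarrow> f m \<in> carrier A"
  by (auto simp: right_hom_def)

lemma LD_closed: "\<lbrakk>f \<in> carrier LD; m \<in> carrier M\<rbrakk> \<Longrightarrow> f m \<in> carrier B"
  by (auto simp: left_hom_def)

lemma p_RD: "g \<in> G \<Longrightarrow> p g \<in> carrier RD"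
  by (simp add: p)

lemma End_eqI: "\<lbrakk>e \<in> carrier E; e' \<in> carrier E; \<And>m. m \<in> carrier M \<Longrightarrow> e m = e' m\<rbrakk> \<Longrightarrow> e = e'"
  by (simp add: right_hom_eqI)

lemma RD_eqI: "\<lbrakk>f \<in> carrier RD; f' \<in> carrier RD; \<And>m. m \<in> carrier M \<Longrightarrow> f m = f' m\<rbrakk> \<Longrightarrow> f = f'"
  by (simp add: right_hom_eqI)

lemma LD_eqI: "\<lbrakk>f \<in> carrier LD; f' \<in> carrier LD; \<And>m. m \<in> carrier M \<Longrightarrow> f m = f' m\<rbrakk> \<Longrightarrow> f = f'"
  by (simp add: left_hom_eqI)

lemma eval_End: "m \<in> carrier M \<Longrightarrow> (\<lambda>e. e m) \<in> add_hom E M"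
  by (rule add_homI) (auto simp: right_hom_def)

lemma eval_RD: "m \<in> carrier M \<Longrightarrow> (\<lambda>f. f m) \<in> add_hom RD A"
  by (rule add_homI) (auto simp: right_hom_def)

lemma eval_LD: "m \<in> carrier M \<Longrightarrow> (\<lambda>f. f m) \<in> add_hom LD B"
  by (rule add_homI) (auto simp: left_hom_def)

lemma RD_add_hom: "f \<in> carrier RD \<Longrightarrow> f \<in> add_hom M A"
  by (auto simp: right_hom_def add_hom_def)

lemma LD_add_hom: "f \<in> carrier LD \<Longrightarrow> f \<in> add_hom M B"
  by (auto simp: left_hom_def add_hom_def)

lemma lm_End: "b \<in> carrier B \<Longrightarrow> lm b \<in> carrier E"
  using ring_hom_closed[OF ring_hom_ring.homh[OF left_mult_map_hom[OF bimodule_axioms]]] .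

lemma comp_RD: "\<lbrakk>f \<in> carrier RD; e \<in> carrier E\<rbrakk> \<Longrightarrow> f \<circ>\<^sub>M e \<in> carrier RD"
  using compose_right_hom[of e A M M f "regular A"] right_module_axioms by simp

text \<open>\<open>E\<close> acts on \<open>RD\<close> from the right by precomposition, and the
  action of \<open>B\<close> is its restriction along \<open>lm\<close>. Right
  \<open>B\<close>-linearity thereby reduces to facts about composition.\<close>

lemma comp_lm: "b \<in> carrier B \<Longrightarrow> f \<circ>\<^sub>M lm b = f \<odot>\<^sub>r\<^bsub>RD\<^esub> b"
  by (auto simp: compose_def left_mult_map_def fun_eq_iff)

lemma comp_assoc: "e \<in> carrier E \<Longrightarrow> (f \<circ>\<^sub>M d) \<circ>\<^sub>M e = f \<circ>\<^sub>M (d \<circ>\<^sub>M e)"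
  by (auto simp: compose_def fun_eq_iff right_hom_def PiE_iff)

lemma comp_add_hom_left: "e \<in> carrier E \<Longrightarrow> (\<lambda>f. f \<circ>\<^sub>M e) \<in> add_hom RD RD"
  by (intro add_homI comp_RD) (auto simp: compose_def fun_eq_iff right_hom_def PiE_iff)

lemma comp_add_hom_right: "f \<in> carrier RD \<Longrightarrow> (\<lambda>e. f \<circ>\<^sub>M e) \<in> add_hom E RD"
  by (intro add_homI comp_RD) (auto simp: compose_def fun_eq_iff right_hom_def PiE_iff)

lemma comp_smult:
  "\<lbrakk>a \<in> carrier A; e \<in> carrier E\<rbrakk> \<Longrightarrow> (a \<odot>\<^bsub>RD\<^esub> f) \<circ>\<^sub>M e = a \<odot>\<^bsub>RD\<^esub> (f \<circ>\<^sub>M e)"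
  by (auto simp: compose_def fun_eq_iff right_hom_def PiE_iff)

lemma T_apply: "x \<in> carrier M \<Longrightarrow> T m f x = m \<odot>\<^sub>r\<^bsub>M\<^esub> f x"
  by (simp add: rank_one_def)

lemma T_closed: "\<lbrakk>m \<in> carrier M; f \<in> carrier RD\<rbrakk> \<Longrightarrow> T m f \<in> carrier E"
  unfolding right_End_simps rank_one_def
  by (rule right_homI[OF right_module_axioms])
    (auto simp: right_hom_def PiE_iff rsmult_closed rsmult_r_distr rsmult_assoc)

lemma T_add_hom_left: "f \<in> carrier RD \<Longrightarrow> (\<lambda>m. T m f) \<in> add_hom M E"
  by (intro add_homI T_closed) (auto simp: rank_one_def fun_eq_iff rsmult_l_distr right_hom_def PiE_iff)

lemma T_add_hom_right: "m \<in> carrier M \<Longrightarrow> (\<lambda>f. T m f) \<in> add_hom RD E"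
  by (intro add_homI T_closed) (auto simp: rank_one_def fun_eq_iff rsmult_r_distr right_hom_def PiE_iff)

text \<open>Balancedness, the relation that would define the tensor product over \<open>A\<close>.
  It yields the \<open>A\<close>-linearity of \<open>left_hat\<close> and of the endomorphisms
  \<open>End_of_right_dual u \<gamma>\<close>.\<close>

lemma T_rsmult:
  "\<lbrakk>m \<in> carrier M; a \<in> carrier A; f \<in> carrier RD\<rbrakk> \<Longrightarrow> T (m \<odot>\<^sub>r\<^bsub>M\<^esub> a) f = T m (a \<odot>\<^bsub>RD\<^esub> f)"
  by (auto simp: rank_one_def fun_eq_iff rsmult_assoc right_hom_def PiE_iff)

text \<open>Composing on the left moves the element, composing on the right (\<open>T_comp\<close>)
  moves the functional, so the two sides of \<open>E\<close> act on separate arguments of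
  \<open>T\<close>.\<close>

lemma comp_T: "\<lbrakk>e \<in> carrier E; m \<in> carrier M; f \<in> carrier RD\<rbrakk> \<Longrightarrow> e \<circ>\<^sub>M T m f = T (e m) f"
  by (auto simp: rank_one_def compose_def fun_eq_iff right_hom_def PiE_iff)

lemma T_comp: "e \<in> carrier E \<Longrightarrow> T m f \<circ>\<^sub>M e = T m (f \<circ>\<^sub>M e)"
  by (auto simp: rank_one_def compose_def fun_eq_iff right_hom_def PiE_iff)

lemma RD_comp_T:
  "\<lbrakk>f' \<in> carrier RD; m \<in> carrier M; f \<in> carrier RD\<rbrakk> \<Longrightarrow> f' \<circ>\<^sub>M T m f = f' m \<odot>\<^bsub>RD\<^esub> f"
  by (auto simp: rank_one_def compose_def fun_eq_iff right_hom_def PiE_iff)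

text \<open>The \<open>p g\<close> generate \<open>RD\<close> as a left \<open>A\<close>-module:
  evaluate at \<open>m\<close> and pull \<open>f\<close> through the dual basis expansion of
  \<open>m\<close>.\<close>

lemma RD_expand:
  assumes f: "f \<in> carrier RD"
  shows "(\<Oplus>\<^bsub>RD\<^esub>g\<in>G. f g \<odot>\<^bsub>RD\<^esub> p g) = f"
proof (rule RD_eqI)
  have c: "f g \<odot>\<^bsub>RD\<^esub> p g \<in> carrier RD" if "g \<in> G" for g
    by (intro RD.lsmult_closed RD_closed[OF f] p_RD G_closed that)
  then show "(\<Oplus>\<^bsub>RD\<^esub>g\<in>G. f g \<odot>\<^bsub>RD\<^esub> p g) \<in> carrier RD"
    by (intro RD.M.finsum_closed) auto
  fix m assume m: "m \<in> carrier M"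
  have "(\<Oplus>\<^bsub>RD\<^esub>g\<in>G. f g \<odot>\<^bsub>RD\<^esub> p g) m = (\<Oplus>\<^bsub>A\<^esub>g\<in>G. (f g \<odot>\<^bsub>RD\<^esub> p g) m)"
    using c by (intro add_hom_finsum[OF RD.M.abelian_group_axioms A.abelian_group_axioms eval_RD[OF m]]) auto
  also have "\<dots> = (\<Oplus>\<^bsub>A\<^esub>g\<in>G. f (g \<odot>\<^sub>r\<^bsub>M\<^esub> p g m))"
    using m f by (intro finsum_eqI A.abelian_group_axioms RD_closed[OF f])
      (simp_all add: right_hom_regular_rsmult[of f A M] G_closed RD_closed[OF p_RD] rsmult_closed)
  also have "\<dots> = f (\<Oplus>\<^bsub>M\<^esub>g\<in>G. g \<odot>\<^sub>r\<^bsub>M\<^esub> p g m)"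
    using m by (intro add_hom_finsum[symmetric, OF M.abelian_group_axioms A.abelian_group_axioms RD_add_hom[OF f]])
      (simp add: rsmult_closed G_closed RD_closed[OF p_RD])
  finally show "(\<Oplus>\<^bsub>RD\<^esub>g\<in>G. f g \<odot>\<^bsub>RD\<^esub> p g) m = f m"
    using dual_basis[OF m] by simp
qed (rule f)

text \<open>Apply \<open>e\<close> to the expansion of \<open>m\<close>: the elements are moved and
  the functionals stay. This version suits left multiplication on \<open>E\<close>.\<close>

lemma End_expand:
  assumes e: "e \<in> carrier E"
  shows "(\<Oplus>\<^bsub>E\<^esub>g\<in>G. T (e g) (p g)) = e"
proof (rule End_eqI)
  have c: "T (e g) (p g) \<in> carrier E" if "g \<in> G" for g
    by (intro T_closed End_closed[OF e] p_RD G_closed that)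
  then show "(\<Oplus>\<^bsub>E\<^esub>g\<in>G. T (e g) (p g)) \<in> carrier E"
    by (intro E.finsum_closed) auto
  fix m assume m: "m \<in> carrier M"
  have gp: "g \<odot>\<^sub>r\<^bsub>M\<^esub> p g m \<in> carrier M" if "g \<in> G" for g
    by (intro rsmult_closed G_closed RD_closed[OF p_RD] that m)
  have ea: "e \<in> add_hom M M" using e by (auto simp: right_hom_def add_hom_def)
  have "(\<Oplus>\<^bsub>E\<^esub>g\<in>G. T (e g) (p g)) m = (\<Oplus>\<^bsub>M\<^esub>g\<in>G. T (e g) (p g) m)"
    using c by (intro add_hom_finsum[OF E.abelian_group_axioms M.abelian_group_axioms eval_End[OF m]]) auto
  also have "\<dots> = (\<Oplus>\<^bsub>M\<^esub>g\<in>G. e (g \<odot>\<^sub>r\<^bsub>M\<^esub> p g m))"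
    using m e gp by (intro finsum_eqI M.abelian_group_axioms)
      (auto simp: T_apply right_hom_rsmult[of e A M M] G_closed RD_closed[OF p_RD] right_hom_closed[of e A M M] rsmult_closed)
  also have "\<dots> = e (\<Oplus>\<^bsub>M\<^esub>g\<in>G. g \<odot>\<^sub>r\<^bsub>M\<^esub> p g m)"
    using gp by (intro add_hom_finsum[symmetric, OF M.abelian_group_axioms M.abelian_group_axioms ea]) auto
  finally show "(\<Oplus>\<^bsub>E\<^esub>g\<in>G. T (e g) (p g)) m = e m"
    using dual_basis[OF m] by simp
qed (rule e)

text \<open>Expand \<open>e m\<close> instead of \<open>m\<close>: the functionals absorb
  \<open>e\<close> and the elements stay. This version suits right multiplication on
  \<open>E\<close>.\<close>

lemma End_expand':
  assumes e: "e \<in> carrier E"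
  shows "(\<Oplus>\<^bsub>E\<^esub>g\<in>G. T g (p g \<circ>\<^sub>M e)) = e"
proof (rule End_eqI)
  have c: "T g (p g \<circ>\<^sub>M e) \<in> carrier E" if "g \<in> G" for g
    using that by (intro T_closed comp_RD e p_RD G_closed)
  then show "(\<Oplus>\<^bsub>E\<^esub>g\<in>G. T g (p g \<circ>\<^sub>M e)) \<in> carrier E"
    by (intro E.finsum_closed) auto
  fix m assume m: "m \<in> carrier M"
  have "(\<Oplus>\<^bsub>E\<^esub>g\<in>G. T g (p g \<circ>\<^sub>M e)) m = (\<Oplus>\<^bsub>M\<^esub>g\<in>G. T g (p g \<circ>\<^sub>M e) m)"
    using c by (intro add_hom_finsum[OF E.abelian_group_axioms M.abelian_group_axioms eval_End[OF m]]) auto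
  also have "\<dots> = (\<Oplus>\<^bsub>M\<^esub>g\<in>G. g \<odot>\<^sub>r\<^bsub>M\<^esub> p g (e m))"
    using m by (intro finsum_eqI M.abelian_group_axioms)
      (simp_all add: T_apply compose_apply rsmult_closed G_closed RD_closed[OF p_RD] End_closed[OF e])
  finally show "(\<Oplus>\<^bsub>E\<^esub>g\<in>G. T g (p g \<circ>\<^sub>M e)) m = e m"
    using dual_basis[OF End_closed[OF e m]] by simp
qed (rule e)

text \<open>A consequence of \<open>End_expand\<close>. Assuming just additivity makes the criterion
  serve the functionals in both duals of \<open>E\<close>.\<close>

lemma add_hom_End_eqI:
  assumes "abelian_group N" "u \<in> add_hom E N" "v \<in> add_hom E N" and e: "e \<in> carrier E"
    and "\<And>m f. \<lbrakk>m \<in> carrier M; f \<in> carrier RD\<rbrakk> \<Longrightarrow> u (T m f) = v (T m f)"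
  shows "u e = v e"
proof -
  have c: "(\<lambda>g. T (e g) (p g)) \<in> G \<rightarrow> carrier E"
    by (intro Pi_I T_closed End_closed[OF e] p_RD G_closed)
  have "u (\<Oplus>\<^bsub>E\<^esub>g\<in>G. T (e g) (p g)) = (\<Oplus>\<^bsub>N\<^esub>g\<in>G. u (T (e g) (p g)))"
    by (rule add_hom_finsum[OF E.abelian_group_axioms assms(1,2) c])
  also have "\<dots> = (\<Oplus>\<^bsub>N\<^esub>g\<in>G. v (T (e g) (p g)))"
    by (intro finsum_eqI assms(1,5) add_hom_closed[OF assms(3)] T_closed End_closed[OF e] p_RD G_closed)
  also have "\<dots> = v (\<Oplus>\<^bsub>E\<^esub>g\<in>G. T (e g) (p g))"
    by (rule add_hom_finsum[OF E.abelian_group_axioms assms(1,3) c, symmetric])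
  finally show ?thesis by (simp only: End_expand[OF e])
qed

text \<open>\<open>End_expand'\<close> rebuilds \<open>e\<close> from the finitely many composites
  \<open>p g \<circ>\<^sub>M e\<close>. This is the equality test for endomorphisms of the form
  \<open>End_of_left_dual t \<phi>\<close>.\<close>

lemma End_eqI_RD:
  assumes e: "e \<in> carrier E" and e': "e' \<in> carrier E"
    and eq: "\<And>f. f \<in> carrier RD \<Longrightarrow> f \<circ>\<^sub>M e = f \<circ>\<^sub>M e'"
  shows "e = e'"
proof -
  have "(\<Oplus>\<^bsub>E\<^esub>g\<in>G. T g (p g \<circ>\<^sub>M e)) = (\<Oplus>\<^bsub>E\<^esub>g\<in>G. T g (p g \<circ>\<^sub>M e'))"
    by (intro finsum_eqI E.abelian_group_axioms T_closed comp_RD e' p_RD G_closed) (simp only: eq p_RD)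
  then show ?thesis by (simp only: End_expand' e e')
qed

text \<open>Over \<open>B\<close> on the left, \<open>E\<close> is a retract of a power of
  \<open>M\<close>: evaluate at each \<open>g\<close> and return by \<open>T m (p g)\<close>. The
  composite is the identity by \<open>End_expand\<close>.\<close>

lemma has_left_dual_basis_End:
  assumes "has_left_dual_basis B M" shows "has_left_dual_basis B BEE"
proof (rule has_left_dual_basis_retract[OF _ left_module_axioms assms finite_G])
  interpret BEE: bimodule B E BEE by (rule BEE)
  show "left_module B BEE" by (rule BEE.left_module_axioms)
  show "(\<lambda>e\<in>carrier BEE. e g) \<in> left_hom B BEE M" if "g \<in> G" for g
    using that by (intro left_homI BEE.left_module_axioms)
      (auto simp: G_closed compose_def left_mult_map_def right_hom_closed)
  show "(\<lambda>m\<in>carrier M. T m (p g)) \<in> left_hom B M BEE" if g: "g \<in> G" for g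
  proof (intro left_homI left_module_axioms)
    fix m assume m: "m \<in> carrier M"
    show "T m (p g) \<in> carrier BEE" using T_closed[OF m p_RD[OF g]] by simp
    show "T (m \<oplus>\<^bsub>M\<^esub> n) (p g) = T m (p g) \<oplus>\<^bsub>BEE\<^esub> T n (p g)" if "n \<in> carrier M" for n
      using add_hom_add[OF T_add_hom_left[OF p_RD[OF g]] m that] by simp
    show "T (b \<odot>\<^bsub>M\<^esub> m) (p g) = b \<odot>\<^bsub>BEE\<^esub> T m (p g)" if b: "b \<in> carrier B" for b
      using comp_T[OF lm_End[OF b] m p_RD[OF g]] m by (simp add: left_mult_map_def)
  qed
  fix e assume "e \<in> carrier BEE"
  then have e: "e \<in> carrier E" by simp
  have "(\<Oplus>\<^bsub>E\<^esub>g\<in>G. (\<lambda>m\<in>carrier M. T m (p g)) ((\<lambda>e\<in>carrier BEE. e g) e)) = (\<Oplus>\<^bsub>E\<^esub>g\<in>G. T (e g) (p g))"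
    using e by (intro finsum_eqI E.abelian_group_axioms T_closed End_closed[OF e] p_RD G_closed)
      (auto simp: G_closed right_hom_closed)
  then show "(\<Oplus>\<^bsub>BEE\<^esub>g\<in>G. (\<lambda>m\<in>carrier M. T m (p g)) ((\<lambda>e\<in>carrier BEE. e g) e)) = e"
    using End_expand[OF e] by simp
qed

text \<open>For the right \<open>B\<close>-structure \<open>RD\<close> takes the place of
  \<open>M\<close>: compose with each \<open>p g\<close> and return by \<open>T g f\<close>, so that
  \<open>End_expand'\<close> gives the identity.\<close>

lemma has_right_dual_basis_End:
  assumes "has_right_dual_basis B RD" shows "has_right_dual_basis B EEB"
proof (rule has_right_dual_basis_retract[OF _ RD.right_module_axioms assms finite_G])
  interpret EEB: bimodule E B EEB by (rule EEB)
  show "right_module B EEB" by (rule EEB.right_module_axioms)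
  show "(\<lambda>e\<in>carrier EEB. p g \<circ>\<^sub>M e) \<in> right_hom B EEB RD" if g: "g \<in> G" for g
  proof (intro right_homI EEB.right_module_axioms)
    fix e assume "e \<in> carrier EEB"
    then have e: "e \<in> carrier E" by simp
    show "p g \<circ>\<^sub>M e \<in> carrier RD" by (intro comp_RD p_RD g e)
    show "p g \<circ>\<^sub>M (e \<oplus>\<^bsub>EEB\<^esub> d) = (p g \<circ>\<^sub>M e) \<oplus>\<^bsub>RD\<^esub> (p g \<circ>\<^sub>M d)" if "d \<in> carrier EEB" for d
      using add_hom_add[OF comp_add_hom_right[OF p_RD[OF g]], of e d] that e by simp
    show "p g \<circ>\<^sub>M (e \<odot>\<^sub>r\<^bsub>EEB\<^esub> b) = (p g \<circ>\<^sub>M e) \<odot>\<^sub>r\<^bsub>RD\<^esub> b" if b: "b \<in> carrier B" for b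
      using comp_assoc[OF lm_End[OF b], of "p g" e] comp_lm[OF b, of "p g \<circ>\<^sub>M e"] by simp
  qed
  show "(\<lambda>f\<in>carrier RD. T g f) \<in> right_hom B RD EEB" if g: "g \<in> G" for g
  proof (intro right_homI RD.right_module_axioms)
    fix f assume f: "f \<in> carrier RD"
    show "T g f \<in> carrier EEB" using T_closed[OF G_closed[OF g] f] by simp
    show "T g (f \<oplus>\<^bsub>RD\<^esub> f') = T g f \<oplus>\<^bsub>EEB\<^esub> T g f'" if "f' \<in> carrier RD" for f'
      using add_hom_add[OF T_add_hom_right[OF G_closed[OF g]] f that] by simp
    show "T g (f \<odot>\<^sub>r\<^bsub>RD\<^esub> b) = T g f \<odot>\<^sub>r\<^bsub>EEB\<^esub> b" if b: "b \<in> carrier B" for b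
      using T_comp[OF lm_End[OF b], of g f] comp_lm[OF b, of f] by simp
  qed
  fix e assume "e \<in> carrier EEB"
  then have e: "e \<in> carrier E" by simp
  have "(\<Oplus>\<^bsub>E\<^esub>g\<in>G. (\<lambda>f\<in>carrier RD. T g f) ((\<lambda>e\<in>carrier EEB. p g \<circ>\<^sub>M e) e)) = (\<Oplus>\<^bsub>E\<^esub>g\<in>G. T g (p g \<circ>\<^sub>M e))"
    using e comp_RD[OF p_RD e] by (intro finsum_eqI E.abelian_group_axioms T_closed p_RD G_closed) auto
  then show "(\<Oplus>\<^bsub>EEB\<^esub>g\<in>G. (\<lambda>f\<in>carrier RD. T g f) ((\<lambda>e\<in>carrier EEB. p g \<circ>\<^sub>M e) e)) = e"
    using End_expand'[OF e] by simp
qed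

end

section \<open>Functionals on the endomorphism ring\<close>

context bimodule_right_dual_basis
begin

abbreviation LBE :: "('m \<Rightarrow> 'm, 'b, ('m \<Rightarrow> 'm) \<Rightarrow> 'b) bimodule" where "LBE \<equiv> left_dual B BEE"
abbreviation REB :: "('b, 'm \<Rightarrow> 'm, ('m \<Rightarrow> 'm) \<Rightarrow> 'b) bimodule" where "REB \<equiv> right_dual B EEB"

sublocale LBE: bimodule E B LBE by (rule bimodule_left_dual) (rule BEE)
sublocale REB: bimodule B E REB by (rule bimodule_right_dual) (rule EEB)

lemma comp_End: "\<lbrakk>d \<in> carrier E; e \<in> carrier E\<rbrakk> \<Longrightarrow> d \<circ>\<^sub>M e \<in> carrier E"
  using E.m_closed[of d e] by simp

lemma LBE_closed: "\<lbrakk>\<phi> \<in> carrier LBE; e \<in> carrier E\<rbrakk> \<Longrightarrow> \<phi> e \<in> carrier B"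
  by (auto simp: left_hom_def)

lemma REB_closed: "\<lbrakk>\<gamma> \<in> carrier REB; e \<in> carrier E\<rbrakk> \<Longrightarrow> \<gamma> e \<in> carrier B"
  by (auto simp: right_hom_def)

lemma LBE_add_hom: "\<phi> \<in> carrier LBE \<Longrightarrow> \<phi> \<in> add_hom E B"
  by (auto simp: left_hom_def add_hom_def)

lemma REB_add_hom: "\<gamma> \<in> carrier REB \<Longrightarrow> \<gamma> \<in> add_hom E B"
  by (rule add_homI) (auto simp: right_hom_regularD[of \<gamma> B EEB, simplified])

lemma LBE_lm: "\<lbrakk>\<phi> \<in> carrier LBE; b \<in> carrier B; e \<in> carrier E\<rbrakk> \<Longrightarrow> \<phi> (lm b \<circ>\<^sub>M e) = b \<otimes>\<^bsub>B\<^esub> \<phi> e"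
  using left_hom_regular_smult[of \<phi> B BEE b e] by simp

lemma REB_lm: "\<lbrakk>\<gamma> \<in> carrier REB; b \<in> carrier B; e \<in> carrier E\<rbrakk> \<Longrightarrow> \<gamma> (e \<circ>\<^sub>M lm b) = \<gamma> e \<otimes>\<^bsub>B\<^esub> b"
  using right_hom_regular_rsmult[of \<gamma> B EEB e b] by simp

lemma eval_LBE: "e \<in> carrier E \<Longrightarrow> (\<lambda>\<phi>. \<phi> e) \<in> add_hom LBE B"
  by (rule add_homI) (auto simp: left_hom_def)

lemma eval_REB: "e \<in> carrier E \<Longrightarrow> (\<lambda>\<gamma>. \<gamma> e) \<in> add_hom REB B"
  by (rule add_homI) (auto simp: right_hom_def)

lemma LBE_eqI:
  assumes "\<phi> \<in> carrier LBE" "\<psi> \<in> carrier LBE"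
    and eq: "\<And>m f. \<lbrakk>m \<in> carrier M; f \<in> carrier RD\<rbrakk> \<Longrightarrow> \<phi> (T m f) = \<psi> (T m f)"
  shows "\<phi> = \<psi>"
proof (rule left_hom_eqI)
  fix e assume "e \<in> carrier BEE"
  then show "\<phi> e = \<psi> e"
    by (intro add_hom_End_eqI[OF B.abelian_group_axioms LBE_add_hom[OF assms(1)] LBE_add_hom[OF assms(2)] _ eq]) simp
qed (use assms in simp_all)

lemma REB_eqI:
  assumes "\<gamma> \<in> carrier REB" "\<delta> \<in> carrier REB"
    and eq: "\<And>m f. \<lbrakk>m \<in> carrier M; f \<in> carrier RD\<rbrakk> \<Longrightarrow> \<gamma> (T m f) = \<delta> (T m f)"
  shows "\<gamma> = \<delta>"
proof (rule right_hom_eqI)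
  fix e assume "e \<in> carrier EEB"
  then show "\<gamma> e = \<delta> e"
    by (intro add_hom_End_eqI[OF B.abelian_group_axioms REB_add_hom[OF assms(1)] REB_add_hom[OF assms(2)] _ eq]) simp
qed (use assms in simp_all)

lemma LBE_smult_apply: "x \<in> carrier E \<Longrightarrow> (e \<odot>\<^bsub>LBE\<^esub> \<phi>) x = \<phi> (x \<circ>\<^sub>M e)"
  by simp

lemma REB_rsmult_apply: "x \<in> carrier E \<Longrightarrow> (\<gamma> \<odot>\<^sub>r\<^bsub>REB\<^esub> e) x = \<gamma> (e \<circ>\<^sub>M x)"
  by simp

lemma T_smult: "\<lbrakk>b \<in> carrier B; m \<in> carrier M; f \<in> carrier RD\<rbrakk> \<Longrightarrow> T (b \<odot>\<^bsub>M\<^esub> m) f = lm b \<circ>\<^sub>M T m f"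
  using comp_T[OF lm_End, of b m f] by (simp add: left_mult_map_def)

text \<open>This is \<open>RD_expand\<close> precomposed with \<open>e\<close>; it collects the sum
  that arises when \<open>left_dual_of_End s e\<close> is evaluated at \<open>T m f\<close>.\<close>

lemma comp_expand:
  assumes f: "f \<in> carrier RD" and e: "e \<in> carrier E"
  shows "(\<Oplus>\<^bsub>RD\<^esub>g\<in>G. f g \<odot>\<^bsub>RD\<^esub> (p g \<circ>\<^sub>M e)) = f \<circ>\<^sub>M e"
proof -
  have c: "f g \<odot>\<^bsub>RD\<^esub> p g \<in> carrier RD" if "g \<in> G" for g
    by (intro RD.lsmult_closed RD_closed[OF f] p_RD G_closed that)
  have "(\<Oplus>\<^bsub>RD\<^esub>g\<in>G. f g \<odot>\<^bsub>RD\<^esub> (p g \<circ>\<^sub>M e)) = (\<Oplus>\<^bsub>RD\<^esub>g\<in>G. (f g \<odot>\<^bsub>RD\<^esub> p g) \<circ>\<^sub>M e)"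
    by (intro finsum_eqI RD.M.abelian_group_axioms comp_smult[symmetric] RD_closed[OF f] G_closed e comp_RD c)
  also have "\<dots> = (\<Oplus>\<^bsub>RD\<^esub>g\<in>G. f g \<odot>\<^bsub>RD\<^esub> p g) \<circ>\<^sub>M e"
    by (rule add_hom_finsum[symmetric, OF RD.M.abelian_group_axioms RD.M.abelian_group_axioms
          comp_add_hom_left[OF e]]) (use c in blast)
  finally show ?thesis by (simp only: RD_expand[OF f])
qed

subsection \<open>The left dual of the endomorphism ring\<close>

text \<open>Currying: a functional on \<open>E\<close>, read on pairs of an element and a functional
  of \<open>M\<close>, becomes a left \<open>A\<close>-linear map from \<open>RD\<close> to
  \<open>LD\<close>.\<close>

definition left_hat :: "(('m \<Rightarrow> 'm) \<Rightarrow> 'b) \<Rightarrow> ('m \<Rightarrow> 'a) \<Rightarrow> 'm \<Rightarrow> 'b"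
  where "left_hat \<phi> f = (\<lambda>m\<in>carrier M. \<phi> (T m f))"

lemma left_hat_LD:
  assumes \<phi>: "\<phi> \<in> carrier LBE" and f: "f \<in> carrier RD"
  shows "left_hat \<phi> f \<in> carrier LD"
  unfolding left_dual_simps left_hat_def
proof (rule left_hom_regularI[OF left_module_axioms])
  fix m assume m: "m \<in> carrier M"
  show "\<phi> (T m f) \<in> carrier B" by (intro LBE_closed[OF \<phi>] T_closed m f)
  show "\<phi> (T (m \<oplus>\<^bsub>M\<^esub> n) f) = \<phi> (T m f) \<oplus>\<^bsub>B\<^esub> \<phi> (T n f)" if n: "n \<in> carrier M" for n
    using add_hom_add[OF T_add_hom_left[OF f] m n]
      add_hom_add[OF LBE_add_hom[OF \<phi>] T_closed[OF m f] T_closed[OF n f]] by (simp only:)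
  show "\<phi> (T (b \<odot>\<^bsub>M\<^esub> m) f) = b \<otimes>\<^bsub>B\<^esub> \<phi> (T m f)" if b: "b \<in> carrier B" for b
    by (simp only: T_smult[OF b m f] LBE_lm[OF \<phi> b T_closed[OF m f]])
qed

lemma left_hat_add_hom:
  assumes \<phi>: "\<phi> \<in> carrier LBE" shows "left_hat \<phi> \<in> add_hom RD LD"
proof (rule add_homI)
  fix f f' assume f: "f \<in> carrier RD" "f' \<in> carrier RD"
  have "\<phi> (T m (f \<oplus>\<^bsub>RD\<^esub> f')) = \<phi> (T m f) \<oplus>\<^bsub>B\<^esub> \<phi> (T m f')" if m: "m \<in> carrier M" for m
    using add_hom_add[OF T_add_hom_right[OF m] f]
      add_hom_add[OF LBE_add_hom[OF \<phi>] T_closed[OF m f(1)] T_closed[OF m f(2)]] by (simp only:)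
  then show "left_hat \<phi> (f \<oplus>\<^bsub>RD\<^esub> f') = left_hat \<phi> f \<oplus>\<^bsub>LD\<^esub> left_hat \<phi> f'"
    unfolding left_hat_def left_dual_simps by (auto simp del: right_dual_simps intro!: restrict_ext)
qed (rule left_hat_LD[OF \<phi>])

lemma left_hat_smult:
  assumes \<phi>: "\<phi> \<in> carrier LBE" and a: "a \<in> carrier A" and f: "f \<in> carrier RD"
  shows "left_hat \<phi> (a \<odot>\<^bsub>RD\<^esub> f) = a \<odot>\<^bsub>LD\<^esub> left_hat \<phi> f"
  unfolding left_hat_def left_dual_simps
  by (rule restrict_ext) (simp del: right_dual_simps add: T_rsmult[OF _ a f, symmetric] rsmult_closed a)

text \<open>The formula is forced: \<open>End_expand\<close> writes \<open>x\<close> as the sum of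
  the \<open>T (x g) (p g)\<close>, and \<open>T m f\<close> has to go to
  \<open>s (f \<circ>\<^sub>M e) m\<close>.\<close>

definition left_dual_of_End :: "(('m \<Rightarrow> 'a) \<Rightarrow> 'm \<Rightarrow> 'b) \<Rightarrow> ('m \<Rightarrow> 'm) \<Rightarrow> ('m \<Rightarrow> 'm) \<Rightarrow> 'b"
  where "left_dual_of_End s e = (\<Oplus>\<^bsub>LBE\<^esub>g\<in>G. (\<lambda>x\<in>carrier E. s (p g \<circ>\<^sub>M e) (x g)))"

text \<open>Also forced: \<open>End_expand'\<close> recovers an endomorphism from its composites
  with the \<open>p g\<close>, here prescribed as \<open>t (left_hat \<phi> (p g))\<close>.\<close>

definition End_of_left_dual :: "(('m \<Rightarrow> 'b) \<Rightarrow> 'm \<Rightarrow> 'a) \<Rightarrow> (('m \<Rightarrow> 'm) \<Rightarrow> 'b) \<Rightarrow> 'm \<Rightarrow> 'm"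
  where "End_of_left_dual t \<phi> = (\<Oplus>\<^bsub>E\<^esub>g\<in>G. T g (t (left_hat \<phi> (p g))))"

context
  fixes s assumes s: "s \<in> bimod_hom A B RD LD"
begin

lemmas s_closed = left_hom_closed[OF bimod_hom_left[OF s]]
lemmas s_add_hom = left_hom_add_hom[OF bimod_hom_left[OF s]]
lemmas s_smult = left_hom_smult[OF bimod_hom_left[OF s]]
lemmas s_rsmult = right_hom_rsmult[OF bimod_hom_right[OF s]]

text \<open>Evaluation at \<open>g\<close> is left \<open>B\<close>-linear on \<open>E\<close>, and
  \<open>s\<close> supplies a left \<open>B\<close>-linear functional to follow it.\<close>

lemma left_dual_of_End_term:
  assumes e: "e \<in> carrier E" and g: "g \<in> G"
  shows "(\<lambda>x\<in>carrier E. s (p g \<circ>\<^sub>M e) (x g)) \<in> carrier LBE"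
proof -
  interpret BEE: bimodule B E BEE by (rule BEE)
  have d: "s (p g \<circ>\<^sub>M e) \<in> left_hom B M (regular B)"
    using s_closed[OF comp_RD[OF p_RD[OF g] e]] by simp
  have "(\<lambda>x\<in>carrier BEE. s (p g \<circ>\<^sub>M e) (x g)) \<in> left_hom B BEE (regular B)"
    using left_hom_regularD[OF d] G_closed[OF g]
    by (intro left_hom_regularI BEE.left_module_axioms)
      (simp_all add: right_hom_closed compose_apply left_mult_map_def)
  then show ?thesis by simp
qed

lemma left_dual_of_End_closed: "e \<in> carrier E \<Longrightarrow> left_dual_of_End s e \<in> carrier LBE"
  unfolding left_dual_of_End_def
  by (intro LBE.M.finsum_closed Pi_I left_dual_of_End_term)

text \<open>Here \<open>T m f\<close> sends \<open>g\<close> to \<open>m\<close> times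
  \<open>f g\<close>. The scalar passes into the left action on \<open>LD\<close>, then through
  \<open>s\<close> by \<open>A\<close>-linearity, and \<open>comp_expand\<close> sums the result.
  The basis has vanished from the value.\<close>

lemma left_dual_of_End_T:
  assumes e: "e \<in> carrier E" and m: "m \<in> carrier M" and f: "f \<in> carrier RD"
  shows "left_dual_of_End s e (T m f) = s (f \<circ>\<^sub>M e) m"
proof -
  note sc = s_closed[OF comp_RD[OF p_RD e]] and fg = RD_closed[OF f G_closed]
  have c: "f g \<odot>\<^bsub>LD\<^esub> s (p g \<circ>\<^sub>M e) \<in> carrier LD" if "g \<in> G" for g
    by (intro LD.lsmult_closed fg sc that)
  have c': "f g \<odot>\<^bsub>RD\<^esub> (p g \<circ>\<^sub>M e) \<in> carrier RD" if "g \<in> G" for g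
    by (intro RD.lsmult_closed fg comp_RD p_RD e that)
  have "left_dual_of_End s e (T m f) = (\<Oplus>\<^bsub>B\<^esub>g\<in>G. (\<lambda>x\<in>carrier E. s (p g \<circ>\<^sub>M e) (x g)) (T m f))"
    unfolding left_dual_of_End_def
    by (rule add_hom_finsum[OF LBE.M.abelian_group_axioms B.abelian_group_axioms eval_LBE[OF T_closed[OF m f]]])
      (intro Pi_I left_dual_of_End_term e)
  also have "\<dots> = (\<Oplus>\<^bsub>B\<^esub>g\<in>G. (f g \<odot>\<^bsub>LD\<^esub> s (p g \<circ>\<^sub>M e)) m)"
  proof (intro finsum_eqI B.abelian_group_axioms LD_closed m c)
    fix g assume "g \<in> G"
    then show "(\<lambda>x\<in>carrier E. s (p g \<circ>\<^sub>M e) (x g)) (T m f) = (f g \<odot>\<^bsub>LD\<^esub> s (p g \<circ>\<^sub>M e)) m"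
      using T_closed[OF m f] m by (simp add: T_apply G_closed del: right_End_simps)
  qed
  also have "\<dots> = (\<Oplus>\<^bsub>LD\<^esub>g\<in>G. f g \<odot>\<^bsub>LD\<^esub> s (p g \<circ>\<^sub>M e)) m"
    by (rule add_hom_finsum[symmetric, OF LD.M.abelian_group_axioms B.abelian_group_axioms eval_LD[OF m]])
      (intro Pi_I c)
  also have "(\<Oplus>\<^bsub>LD\<^esub>g\<in>G. f g \<odot>\<^bsub>LD\<^esub> s (p g \<circ>\<^sub>M e)) = (\<Oplus>\<^bsub>LD\<^esub>g\<in>G. s (f g \<odot>\<^bsub>RD\<^esub> (p g \<circ>\<^sub>M e)))"
    by (intro finsum_eqI LD.M.abelian_group_axioms s_smult[symmetric] fg comp_RD p_RD e s_closed c')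
  also have "\<dots> = s (\<Oplus>\<^bsub>RD\<^esub>g\<in>G. f g \<odot>\<^bsub>RD\<^esub> (p g \<circ>\<^sub>M e))"
    by (rule add_hom_finsum[symmetric, OF RD.M.abelian_group_axioms LD.M.abelian_group_axioms s_add_hom])
      (intro Pi_I c')
  finally show ?thesis by (simp only: comp_expand[OF f e])
qed

text \<open>All laws are compared on rank-one maps. The action of \<open>E\<close> moves into the
  functional by \<open>T_comp\<close>; the action of \<open>B\<close> becomes that on
  \<open>RD\<close> by \<open>comp_lm\<close> and then passes through \<open>s\<close>.\<close>

lemma left_dual_of_End_hom: "(\<lambda>e\<in>carrier EEB. left_dual_of_End s e) \<in> bimod_hom E B EEB LBE"
proof (rule bimod_homI[OF EEB])
  interpret EEB: bimodule E B EEB by (rule EEB)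
  fix e assume "e \<in> carrier EEB"
  then have e: "e \<in> carrier E" by simp
  show "left_dual_of_End s e \<in> carrier LBE" by (rule left_dual_of_End_closed[OF e])
  show "left_dual_of_End s (e \<oplus>\<^bsub>EEB\<^esub> d) = left_dual_of_End s e \<oplus>\<^bsub>LBE\<^esub> left_dual_of_End s d"
    if "d \<in> carrier EEB" for d
  proof (rule LBE_eqI)
    have d: "d \<in> carrier E" using that by simp
    have ed: "e \<oplus>\<^bsub>E\<^esub> d \<in> carrier E" by (rule E.a_closed[OF e d])
    then show "left_dual_of_End s (e \<oplus>\<^bsub>EEB\<^esub> d) \<in> carrier LBE"
      by (simp only: via_bimod_simps left_dual_of_End_closed)
    show "left_dual_of_End s e \<oplus>\<^bsub>LBE\<^esub> left_dual_of_End s d \<in> carrier LBE"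
      by (intro LBE.M.a_closed left_dual_of_End_closed e d)
    fix m f assume m: "m \<in> carrier M" and f: "f \<in> carrier RD"
    have "s (f \<circ>\<^sub>M (e \<oplus>\<^bsub>E\<^esub> d)) m = s (f \<circ>\<^sub>M e) m \<oplus>\<^bsub>B\<^esub> s (f \<circ>\<^sub>M d) m"
      by (simp only: add_hom_add[OF comp_add_hom_right[OF f] e d] add_hom_add[OF s_add_hom comp_RD[OF f e] comp_RD[OF f d]]
          add_hom_add[OF eval_LD[OF m] s_closed[OF comp_RD[OF f e]] s_closed[OF comp_RD[OF f d]]])
    then show "left_dual_of_End s (e \<oplus>\<^bsub>EEB\<^esub> d) (T m f) = (left_dual_of_End s e \<oplus>\<^bsub>LBE\<^esub> left_dual_of_End s d) (T m f)"
      by (simp only: via_bimod_simps left_dual_of_End_T[OF ed m f] left_dual_of_End_T[OF e m f] left_dual_of_End_T[OF d m f]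
          add_hom_add[OF eval_LBE[OF T_closed[OF m f]] left_dual_of_End_closed[OF e] left_dual_of_End_closed[OF d]])
  qed
  show "left_dual_of_End s (a \<odot>\<^bsub>EEB\<^esub> e) = a \<odot>\<^bsub>LBE\<^esub> left_dual_of_End s e" if a: "a \<in> carrier E" for a
  proof (rule LBE_eqI)
    have ae: "a \<circ>\<^sub>M e \<in> carrier E" by (rule comp_End[OF a e])
    have eq: "a \<odot>\<^bsub>EEB\<^esub> e = a \<circ>\<^sub>M e" by simp
    show "left_dual_of_End s (a \<odot>\<^bsub>EEB\<^esub> e) \<in> carrier LBE"
      unfolding eq by (rule left_dual_of_End_closed[OF ae])
    show "a \<odot>\<^bsub>LBE\<^esub> left_dual_of_End s e \<in> carrier LBE"
      by (intro LBE.lsmult_closed left_dual_of_End_closed e a)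
    fix m f assume m: "m \<in> carrier M" and f: "f \<in> carrier RD"
    show "left_dual_of_End s (a \<odot>\<^bsub>EEB\<^esub> e) (T m f) = (a \<odot>\<^bsub>LBE\<^esub> left_dual_of_End s e) (T m f)"
      by (simp only: eq LBE_smult_apply[OF T_closed[OF m f]] T_comp[OF a] left_dual_of_End_T[OF ae m f]
          left_dual_of_End_T[OF e m comp_RD[OF f a]] comp_assoc[OF e])
  qed
  show "left_dual_of_End s (e \<odot>\<^sub>r\<^bsub>EEB\<^esub> b) = left_dual_of_End s e \<odot>\<^sub>r\<^bsub>LBE\<^esub> b" if b: "b \<in> carrier B" for b
  proof (rule LBE_eqI)
    have eb: "e \<circ>\<^sub>M lm b \<in> carrier E" by (rule comp_End[OF e lm_End[OF b]])
    have eq: "e \<odot>\<^sub>r\<^bsub>EEB\<^esub> b = e \<circ>\<^sub>M lm b" by simp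
    show "left_dual_of_End s (e \<odot>\<^sub>r\<^bsub>EEB\<^esub> b) \<in> carrier LBE"
      unfolding eq by (rule left_dual_of_End_closed[OF eb])
    show "left_dual_of_End s e \<odot>\<^sub>r\<^bsub>LBE\<^esub> b \<in> carrier LBE"
      by (intro LBE.rsmult_closed left_dual_of_End_closed e b)
    fix m f assume m: "m \<in> carrier M" and f: "f \<in> carrier RD"
    have "left_dual_of_End s (e \<odot>\<^sub>r\<^bsub>EEB\<^esub> b) (T m f) = (s (f \<circ>\<^sub>M e) \<odot>\<^sub>r\<^bsub>LD\<^esub> b) m"
      by (simp only: eq left_dual_of_End_T[OF eb m f] comp_assoc[OF lm_End[OF b], symmetric] comp_lm[OF b]
          s_rsmult[OF comp_RD[OF f e] b])
    also have "\<dots> = (left_dual_of_End s e \<odot>\<^sub>r\<^bsub>LBE\<^esub> b) (T m f)"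
      using m T_closed[OF m f] by (simp add: left_dual_of_End_T[OF e m f])
    finally show "left_dual_of_End s (e \<odot>\<^sub>r\<^bsub>EEB\<^esub> b) (T m f) = (left_dual_of_End s e \<odot>\<^sub>r\<^bsub>LBE\<^esub> b) (T m f)" .
  qed
qed

text \<open>After currying, the induced map is plain postcomposition with \<open>s\<close>, which
  makes the composite with \<open>End_of_left_dual\<close> computable.\<close>

lemma left_hat_left_dual_of_End:
  assumes e: "e \<in> carrier E" and f: "f \<in> carrier RD"
  shows "left_hat (left_dual_of_End s e) f = s (f \<circ>\<^sub>M e)"
  by (rule LD_eqI[OF left_hat_LD[OF left_dual_of_End_closed[OF e] f] s_closed[OF comp_RD[OF f e]]])
    (simp only: left_hat_def restrict_apply' left_dual_of_End_T[OF e _ f])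

end

context
  fixes t assumes t: "t \<in> bimod_hom A B LD RD"
begin

lemmas t_closed = left_hom_closed[OF bimod_hom_left[OF t]]
lemmas t_add_hom = left_hom_add_hom[OF bimod_hom_left[OF t]]
lemmas t_smult = left_hom_smult[OF bimod_hom_left[OF t]]
lemmas t_rsmult = right_hom_rsmult[OF bimod_hom_right[OF t]]

lemma End_of_left_dual_term:
  "\<lbrakk>\<phi> \<in> carrier LBE; g \<in> G\<rbrakk> \<Longrightarrow> T g (t (left_hat \<phi> (p g))) \<in> carrier E"
  by (intro T_closed G_closed t_closed left_hat_LD p_RD)

lemma End_of_left_dual_closed: "\<phi> \<in> carrier LBE \<Longrightarrow> End_of_left_dual t \<phi> \<in> carrier E"
  unfolding End_of_left_dual_def by (intro E.finsum_closed Pi_I End_of_left_dual_term)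

text \<open>The definition prescribes this for the \<open>p g\<close>. It extends to every
  \<open>f\<close> because \<open>left_hat \<phi>\<close> and \<open>t\<close> are left
  \<open>A\<close>-linear and the \<open>p g\<close> generate \<open>RD\<close>.\<close>

lemma comp_End_of_left_dual:
  assumes \<phi>: "\<phi> \<in> carrier LBE" and f: "f \<in> carrier RD"
  shows "f \<circ>\<^sub>M End_of_left_dual t \<phi> = t (left_hat \<phi> f)"
proof -
  note hc = left_hat_LD[OF \<phi> p_RD] and fg = RD_closed[OF f G_closed]
  have c: "f g \<odot>\<^bsub>RD\<^esub> p g \<in> carrier RD" if "g \<in> G" for g
    by (intro RD.lsmult_closed fg p_RD that)
  have "f \<circ>\<^sub>M End_of_left_dual t \<phi> = (\<Oplus>\<^bsub>RD\<^esub>g\<in>G. f \<circ>\<^sub>M T g (t (left_hat \<phi> (p g))))"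
    unfolding End_of_left_dual_def
    by (rule add_hom_finsum[OF E.abelian_group_axioms RD.M.abelian_group_axioms comp_add_hom_right[OF f]])
      (intro Pi_I End_of_left_dual_term \<phi>)
  also have "\<dots> = (\<Oplus>\<^bsub>RD\<^esub>g\<in>G. t (left_hat \<phi> (f g \<odot>\<^bsub>RD\<^esub> p g)))"
  proof (intro finsum_eqI RD.M.abelian_group_axioms t_closed left_hat_LD \<phi> c)
    fix g assume g: "g \<in> G"
    show "f \<circ>\<^sub>M T g (t (left_hat \<phi> (p g))) = t (left_hat \<phi> (f g \<odot>\<^bsub>RD\<^esub> p g))"
      by (simp only: RD_comp_T[OF f G_closed[OF g] t_closed[OF hc[OF g]]] left_hat_smult[OF \<phi> fg[OF g] p_RD[OF g]]
          t_smult[OF fg[OF g] hc[OF g]])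
  qed
  also have "\<dots> = t (\<Oplus>\<^bsub>LD\<^esub>g\<in>G. left_hat \<phi> (f g \<odot>\<^bsub>RD\<^esub> p g))"
    by (rule add_hom_finsum[symmetric, OF LD.M.abelian_group_axioms RD.M.abelian_group_axioms t_add_hom])
      (intro Pi_I left_hat_LD \<phi> c)
  also have "(\<Oplus>\<^bsub>LD\<^esub>g\<in>G. left_hat \<phi> (f g \<odot>\<^bsub>RD\<^esub> p g)) = left_hat \<phi> (\<Oplus>\<^bsub>RD\<^esub>g\<in>G. f g \<odot>\<^bsub>RD\<^esub> p g)"
    by (rule add_hom_finsum[symmetric, OF RD.M.abelian_group_axioms LD.M.abelian_group_axioms left_hat_add_hom[OF \<phi>]])
      (intro Pi_I c)
  finally show ?thesis by (simp only: RD_expand[OF f])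
qed

text \<open>It suffices to compare composites with each \<open>f\<close> in \<open>RD\<close>. Under
  currying, the action of \<open>E\<close> is precomposition on \<open>RD\<close> and the action of
  \<open>B\<close> is the one on \<open>LD\<close>.\<close>

lemma End_of_left_dual_hom: "(\<lambda>\<phi>\<in>carrier LBE. End_of_left_dual t \<phi>) \<in> bimod_hom E B LBE EEB"
proof (rule bimod_homI[OF LBE.bimodule_axioms])
  fix \<phi> assume \<phi>: "\<phi> \<in> carrier LBE"
  note G\<phi> = End_of_left_dual_closed[OF \<phi>]
  show "End_of_left_dual t \<phi> \<in> carrier EEB" using G\<phi> by simp
  show "End_of_left_dual t (\<phi> \<oplus>\<^bsub>LBE\<^esub> \<psi>) = End_of_left_dual t \<phi> \<oplus>\<^bsub>EEB\<^esub> End_of_left_dual t \<psi>"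
    if \<psi>: "\<psi> \<in> carrier LBE" for \<psi>
    unfolding via_bimod_simps
  proof (rule End_eqI_RD)
    have sum: "\<phi> \<oplus>\<^bsub>LBE\<^esub> \<psi> \<in> carrier LBE" by (intro LBE.M.a_closed \<phi> \<psi>)
    show "End_of_left_dual t (\<phi> \<oplus>\<^bsub>LBE\<^esub> \<psi>) \<in> carrier E" by (rule End_of_left_dual_closed[OF sum])
    show "End_of_left_dual t \<phi> \<oplus>\<^bsub>E\<^esub> End_of_left_dual t \<psi> \<in> carrier E"
      by (intro E.a_closed End_of_left_dual_closed \<phi> \<psi>)
    fix f assume f: "f \<in> carrier RD"
    have "left_hat (\<phi> \<oplus>\<^bsub>LBE\<^esub> \<psi>) f = left_hat \<phi> f \<oplus>\<^bsub>LD\<^esub> left_hat \<psi> f"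
      unfolding left_hat_def left_dual_simps(3)
      by (rule restrict_ext) (simp add: T_closed[OF _ f, simplified])
    then show "f \<circ>\<^sub>M End_of_left_dual t (\<phi> \<oplus>\<^bsub>LBE\<^esub> \<psi>) = f \<circ>\<^sub>M (End_of_left_dual t \<phi> \<oplus>\<^bsub>E\<^esub> End_of_left_dual t \<psi>)"
      by (simp only: comp_End_of_left_dual[OF sum f] comp_End_of_left_dual[OF \<phi> f] comp_End_of_left_dual[OF \<psi> f]
          add_hom_add[OF comp_add_hom_right[OF f] G\<phi> End_of_left_dual_closed[OF \<psi>]]
          add_hom_add[OF t_add_hom left_hat_LD[OF \<phi> f] left_hat_LD[OF \<psi> f]])
  qed
  show "End_of_left_dual t (a \<odot>\<^bsub>LBE\<^esub> \<phi>) = a \<odot>\<^bsub>EEB\<^esub> End_of_left_dual t \<phi>" if a: "a \<in> carrier E" for a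
  proof (rule End_eqI_RD)
    have a\<phi>: "a \<odot>\<^bsub>LBE\<^esub> \<phi> \<in> carrier LBE" by (intro LBE.lsmult_closed a \<phi>)
    have eq: "a \<odot>\<^bsub>EEB\<^esub> End_of_left_dual t \<phi> = a \<circ>\<^sub>M End_of_left_dual t \<phi>" by simp
    show "End_of_left_dual t (a \<odot>\<^bsub>LBE\<^esub> \<phi>) \<in> carrier E" by (rule End_of_left_dual_closed[OF a\<phi>])
    show "a \<odot>\<^bsub>EEB\<^esub> End_of_left_dual t \<phi> \<in> carrier E" unfolding eq by (rule comp_End[OF a G\<phi>])
    fix f assume f: "f \<in> carrier RD"
    have "left_hat (a \<odot>\<^bsub>LBE\<^esub> \<phi>) f = left_hat \<phi> (f \<circ>\<^sub>M a)"
      unfolding left_hat_def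
      by (rule restrict_ext) (simp only: LBE_smult_apply[OF T_closed[OF _ f]] T_comp[OF a])
    then show "f \<circ>\<^sub>M End_of_left_dual t (a \<odot>\<^bsub>LBE\<^esub> \<phi>) = f \<circ>\<^sub>M (a \<odot>\<^bsub>EEB\<^esub> End_of_left_dual t \<phi>)"
      by (simp only: eq comp_End_of_left_dual[OF a\<phi> f] comp_assoc[OF G\<phi>, symmetric]
          comp_End_of_left_dual[OF \<phi> comp_RD[OF f a]])
  qed
  show "End_of_left_dual t (\<phi> \<odot>\<^sub>r\<^bsub>LBE\<^esub> b) = End_of_left_dual t \<phi> \<odot>\<^sub>r\<^bsub>EEB\<^esub> b" if b: "b \<in> carrier B" for b
  proof (rule End_eqI_RD)
    have \<phi>b: "\<phi> \<odot>\<^sub>r\<^bsub>LBE\<^esub> b \<in> carrier LBE" by (intro LBE.rsmult_closed b \<phi>)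
    have eq: "End_of_left_dual t \<phi> \<odot>\<^sub>r\<^bsub>EEB\<^esub> b = End_of_left_dual t \<phi> \<circ>\<^sub>M lm b" by simp
    show "End_of_left_dual t (\<phi> \<odot>\<^sub>r\<^bsub>LBE\<^esub> b) \<in> carrier E" by (rule End_of_left_dual_closed[OF \<phi>b])
    show "End_of_left_dual t \<phi> \<odot>\<^sub>r\<^bsub>EEB\<^esub> b \<in> carrier E" unfolding eq by (rule comp_End[OF G\<phi> lm_End[OF b]])
    fix f assume f: "f \<in> carrier RD"
    have "left_hat (\<phi> \<odot>\<^sub>r\<^bsub>LBE\<^esub> b) f = left_hat \<phi> f \<odot>\<^sub>r\<^bsub>LD\<^esub> b"
      unfolding left_hat_def left_dual_simps(5)
      by (rule restrict_ext) (simp add: T_closed[OF _ f, simplified])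
    then show "f \<circ>\<^sub>M End_of_left_dual t (\<phi> \<odot>\<^sub>r\<^bsub>LBE\<^esub> b) = f \<circ>\<^sub>M (End_of_left_dual t \<phi> \<odot>\<^sub>r\<^bsub>EEB\<^esub> b)"
      by (simp only: eq comp_End_of_left_dual[OF \<phi>b f] comp_assoc[OF lm_End[OF b], symmetric] comp_lm[OF b]
          comp_End_of_left_dual[OF \<phi> f] t_rsmult[OF left_hat_LD[OF \<phi> f] b])
  qed
qed

end

theorem End_divides_left_dual:
  assumes "bimod_divides A B RD LD"
  shows "bimod_divides E B EEB LBE"
proof -
  obtain n :: nat and s t where s: "\<And>i. i < n \<Longrightarrow> s i \<in> bimod_hom A B RD LD"
    and t: "\<And>i. i < n \<Longrightarrow> t i \<in> bimod_hom A B LD RD"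
    and ts: "\<And>f. f \<in> carrier RD \<Longrightarrow> f = (\<Oplus>\<^bsub>RD\<^esub>i\<in>{..<n}. t i (s i f))"
    using bimod_divides_imp_family[OF RD.bimodule_axioms LD.bimodule_axioms assms] by blast
  show ?thesis
  proof (rule bimod_dividesI[OF EEB LBE.bimodule_axioms])
    fix i assume i: "i < n"
    show "(\<lambda>e\<in>carrier EEB. left_dual_of_End (s i) e) \<in> bimod_hom E B EEB LBE"
      by (rule left_dual_of_End_hom[OF s[OF i]])
    show "(\<lambda>\<phi>\<in>carrier LBE. End_of_left_dual (t i) \<phi>) \<in> bimod_hom E B LBE EEB"
      by (rule End_of_left_dual_hom[OF t[OF i]])
  next
    fix e assume "e \<in> carrier EEB"
    then have e: "e \<in> carrier E" by simp
    let ?c = "\<lambda>i. End_of_left_dual (t i) (left_dual_of_End (s i) e)"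
    have lc: "left_dual_of_End (s i) e \<in> carrier LBE" if "i \<in> {..<n}" for i
      using that by (intro left_dual_of_End_closed[OF s e]) simp
    have c: "?c i \<in> carrier E" if "i \<in> {..<n}" for i
      using that by (intro End_of_left_dual_closed[OF t] lc) simp_all
    have "(\<Oplus>\<^bsub>E\<^esub>i\<in>{..<n}. ?c i) = e"
    proof (rule End_eqI_RD[OF _ e])
      show "(\<Oplus>\<^bsub>E\<^esub>i\<in>{..<n}. ?c i) \<in> carrier E" by (intro E.finsum_closed Pi_I c)
      fix f assume f: "f \<in> carrier RD"
      \<comment> \<open>After composition with \<open>f\<close> the i-th term becomes
        \<open>t i (s i (f \<circ>\<^sub>M e))\<close>, so the family relation on \<open>RD\<close>,
        taken at \<open>f \<circ>\<^sub>M e\<close>, finishes.\<close>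
      have "f \<circ>\<^sub>M (\<Oplus>\<^bsub>E\<^esub>i\<in>{..<n}. ?c i) = (\<Oplus>\<^bsub>RD\<^esub>i\<in>{..<n}. f \<circ>\<^sub>M ?c i)"
        by (rule add_hom_finsum[OF E.abelian_group_axioms RD.M.abelian_group_axioms comp_add_hom_right[OF f]])
          (intro Pi_I c)
      also have "\<dots> = (\<Oplus>\<^bsub>RD\<^esub>i\<in>{..<n}. t i (s i (f \<circ>\<^sub>M e)))"
      proof (intro finsum_eqI RD.M.abelian_group_axioms)
        fix i assume "i \<in> {..<n}"
        then have i: "i < n" by simp
        show "f \<circ>\<^sub>M ?c i = t i (s i (f \<circ>\<^sub>M e))"
          by (simp only: comp_End_of_left_dual[OF t[OF i] left_dual_of_End_closed[OF s[OF i] e] f]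
              left_hat_left_dual_of_End[OF s[OF i] e f])
        show "t i (s i (f \<circ>\<^sub>M e)) \<in> carrier RD"
          by (intro t_closed[OF t[OF i]] s_closed[OF s[OF i]] comp_RD f e)
      qed
      also have "\<dots> = f \<circ>\<^sub>M e" by (rule ts[symmetric, OF comp_RD[OF f e]])
      finally show "f \<circ>\<^sub>M (\<Oplus>\<^bsub>E\<^esub>i\<in>{..<n}. ?c i) = f \<circ>\<^sub>M e" .
    qed
    moreover have "(\<Oplus>\<^bsub>E\<^esub>i\<in>{..<n}. (\<lambda>\<phi>\<in>carrier LBE. End_of_left_dual (t i) \<phi>)
        ((\<lambda>e\<in>carrier EEB. left_dual_of_End (s i) e) e)) = (\<Oplus>\<^bsub>E\<^esub>i\<in>{..<n}. ?c i)"
      by (intro finsum_eqI E.abelian_group_axioms c)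
        (simp only: restrict_apply' lc \<open>e \<in> carrier EEB\<close>)
    ultimately show "(\<Oplus>\<^bsub>EEB\<^esub>i\<in>{..<n}. (\<lambda>\<phi>\<in>carrier LBE. End_of_left_dual (t i) \<phi>)
        ((\<lambda>e\<in>carrier EEB. left_dual_of_End (s i) e) e)) = e"
      by (simp only: finsum_via_bimod)
  qed
qed

end

subsection \<open>The right dual of the endomorphism ring\<close>

text \<open>The left dual basis contributes two facts: \<open>LD\<close> separates the points of
  \<open>M\<close>, and \<open>LD\<close> is finitely generated projective over \<open>B\<close> on
  the right.\<close>

locale bimodule_dual_bases = bimodule_right_dual_basis B A M G p
  for B :: "('b, 'r) ring_scheme" (structure) and A :: "('a, 'q) ring_scheme" (structure)
    and M :: "('b, 'a, 'm, 's) bimodule_scheme" (structure) and G :: "'m set" and p :: "'m \<Rightarrow> 'm \<Rightarrow> 'a" +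
  fixes H :: "'m set" and q :: "'m \<Rightarrow> 'm \<Rightarrow> 'b"
  assumes finite_H: "finite H" and H_sub: "H \<subseteq> carrier M"
    and q: "h \<in> H \<Longrightarrow> q h \<in> left_hom B M (regular B)"
    and left_dual_basis: "m \<in> carrier M \<Longrightarrow> (\<Oplus>\<^bsub>M\<^esub>h\<in>H. q h m \<odot>\<^bsub>M\<^esub> h) = m"
begin

lemma H_closed: "h \<in> H \<Longrightarrow> h \<in> carrier M"
  using H_sub by blast

lemma q_LD: "h \<in> H \<Longrightarrow> q h \<in> carrier LD"
  by (simp add: q)

text \<open>\<open>M\<close> is torsionless over \<open>B\<close>, because the values
  \<open>q h m\<close> already recover \<open>m\<close>. Identities for
  \<open>End_of_right_dual\<close> are tested this way.\<close>

lemma M_eqI_LD: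
  assumes m: "m \<in> carrier M" "m' \<in> carrier M" and eq: "\<And>d. d \<in> carrier LD \<Longrightarrow> d m = d m'"
  shows "m = m'"
proof -
  have "(\<Oplus>\<^bsub>M\<^esub>h\<in>H. q h m \<odot>\<^bsub>M\<^esub> h) = (\<Oplus>\<^bsub>M\<^esub>h\<in>H. q h m' \<odot>\<^bsub>M\<^esub> h)"
    by (intro finsum_eqI M.abelian_group_axioms lsmult_closed LD_closed[OF q_LD] H_closed m)
      (simp only: eq[OF q_LD])
  then show ?thesis by (simp only: left_dual_basis m)
qed

text \<open>The \<open>q h\<close> generate \<open>LD\<close> as a right \<open>B\<close>-module:
  apply \<open>d\<close> to the left dual basis expansion of \<open>m\<close>.\<close>

lemma LD_expand:
  assumes d: "d \<in> carrier LD"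
  shows "(\<Oplus>\<^bsub>LD\<^esub>h\<in>H. q h \<odot>\<^sub>r\<^bsub>LD\<^esub> d h) = d"
proof (rule LD_eqI[OF _ d])
  have c: "q h \<odot>\<^sub>r\<^bsub>LD\<^esub> d h \<in> carrier LD" if "h \<in> H" for h
    by (intro LD.rsmult_closed q_LD LD_closed[OF d] H_closed that)
  show "(\<Oplus>\<^bsub>LD\<^esub>h\<in>H. q h \<odot>\<^sub>r\<^bsub>LD\<^esub> d h) \<in> carrier LD"
    by (intro LD.M.finsum_closed Pi_I c)
  fix m assume m: "m \<in> carrier M"
  have qh: "q h m \<odot>\<^bsub>M\<^esub> h \<in> carrier M" if "h \<in> H" for h
    by (intro lsmult_closed LD_closed[OF q_LD] H_closed m that)
  have d': "d \<in> left_hom B M (regular B)" using d by simp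
  have "(\<Oplus>\<^bsub>LD\<^esub>h\<in>H. q h \<odot>\<^sub>r\<^bsub>LD\<^esub> d h) m = (\<Oplus>\<^bsub>B\<^esub>h\<in>H. (q h \<odot>\<^sub>r\<^bsub>LD\<^esub> d h) m)"
    by (rule add_hom_finsum[OF LD.M.abelian_group_axioms B.abelian_group_axioms eval_LD[OF m]])
      (intro Pi_I c)
  also have "\<dots> = (\<Oplus>\<^bsub>B\<^esub>h\<in>H. d (q h m \<odot>\<^bsub>M\<^esub> h))"
    by (intro finsum_eqI B.abelian_group_axioms LD_closed[OF d] qh)
      (simp add: m left_hom_regular_smult[OF d'] LD_closed[OF q_LD] H_closed)
  also have "\<dots> = d (\<Oplus>\<^bsub>M\<^esub>h\<in>H. q h m \<odot>\<^bsub>M\<^esub> h)"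
    by (rule add_hom_finsum[symmetric, OF M.abelian_group_axioms B.abelian_group_axioms LD_add_hom[OF d]])
      (intro Pi_I qh)
  finally show "(\<Oplus>\<^bsub>LD\<^esub>h\<in>H. q h \<odot>\<^sub>r\<^bsub>LD\<^esub> d h) m = d m"
    by (simp only: left_dual_basis[OF m])
qed

text \<open>By \<open>LD_expand\<close>, the \<open>q h\<close> together with evaluation at the
  \<open>h\<close> form a dual basis of \<open>LD\<close>. Some \<open>q h\<close> may coincide, so
  the identity is assembled as a sum of rank-one maps.\<close>

lemma has_right_dual_basis_LD: "has_right_dual_basis B LD"
proof -
  interpret O: left_module "opp_ring B" "opp_mod LD"
    using LD.right_module_axioms by (simp only: right_module_iff_opp[OF B.ring_axioms])
  have ev: "(\<lambda>d\<in>carrier LD. d h) \<in> right_hom B LD (regular B)" if h: "h \<in> H" for h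
    using H_closed[OF h]
    by (intro right_hom_regularI LD.right_module_axioms) (simp_all add: left_hom_regular_closed)
  have ev': "(\<lambda>d\<in>carrier LD. d h) \<in> left_hom (opp_ring B) (opp_mod LD) (regular (opp_ring B))"
    if "h \<in> H" for h
    using ev[OF that] by (simp only: right_hom_opp regular_opp_ring)
  have fin: "finsum (opp_mod LD) = finsum LD"
    by (rule finsum_record_cong) simp_all
  have "left_finite_rank (opp_ring B) (opp_mod LD)
    (\<lambda>d. \<Oplus>\<^bsub>opp_mod LD\<^esub>h\<in>H. (\<lambda>d\<in>carrier LD. d h) d \<odot>\<^bsub>opp_mod LD\<^esub> q h)"
    by (intro O.left_finite_rank_finsum O.left_finite_rank_one finite_H ev') (simp only: opp_mod_simps q_LD)
  then show ?thesis
    unfolding has_right_dual_basis_def has_left_dual_basis_def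
  proof (rule left_finite_rank_cong)
    fix d assume "d \<in> carrier (opp_mod LD)"
    then have d: "d \<in> carrier LD" by simp
    then show "d = (\<Oplus>\<^bsub>opp_mod LD\<^esub>h\<in>H. (\<lambda>d\<in>carrier LD. d h) d \<odot>\<^bsub>opp_mod LD\<^esub> q h)"
      by (simp only: fin opp_mod_simps restrict_apply' LD_expand)
  qed
qed

text \<open>Finiteness of \<open>RD\<close> over \<open>B\<close> is not given directly; it is
  inherited from \<open>LD\<close> as a retract of one of its powers.\<close>

lemma has_right_dual_basis_RD:
  assumes "bimod_divides A B RD LD" shows "has_right_dual_basis B RD"
proof -
  obtain n :: nat and s t where s: "\<And>i. i < n \<Longrightarrow> s i \<in> bimod_hom A B RD LD"
    and t: "\<And>i. i < n \<Longrightarrow> t i \<in> bimod_hom A B LD RD"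
    and ts: "\<And>f. f \<in> carrier RD \<Longrightarrow> f = (\<Oplus>\<^bsub>RD\<^esub>i\<in>{..<n}. t i (s i f))"
    using bimod_divides_imp_family[OF RD.bimodule_axioms LD.bimodule_axioms assms] by blast
  show ?thesis
  proof (rule has_right_dual_basis_retract[OF RD.right_module_axioms LD.right_module_axioms
        has_right_dual_basis_LD finite_lessThan[of n]])
    fix i assume "i \<in> {..<n}"
    then show "s i \<in> right_hom B RD LD" "t i \<in> right_hom B LD RD"
      using bimod_hom_right[OF s] bimod_hom_right[OF t] by simp_all
  qed (rule ts[symmetric])
qed

text \<open>Forced by the other expansion: \<open>End_expand'\<close> writes \<open>x\<close> as the
  sum of the \<open>T g (p g \<circ>\<^sub>M x)\<close>, and \<open>T m f\<close> has to go to
  \<open>v f (e m)\<close>.\<close>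

definition right_dual_of_End :: "(('m \<Rightarrow> 'a) \<Rightarrow> 'm \<Rightarrow> 'b) \<Rightarrow> ('m \<Rightarrow> 'm) \<Rightarrow> ('m \<Rightarrow> 'm) \<Rightarrow> 'b"
  where "right_dual_of_End v e = (\<Oplus>\<^bsub>REB\<^esub>g\<in>G. (\<lambda>x\<in>carrier E. v (p g \<circ>\<^sub>M x) (e g)))"

text \<open>Reflexivity of \<open>M\<close> over \<open>B\<close> made explicit: the value at
  \<open>m\<close> is the element on which each \<open>d\<close> in \<open>LD\<close> takes the
  value \<open>\<gamma> (T m (u d))\<close>, rebuilt from \<open>d = q h\<close> by the left dual
  basis.\<close>

definition End_of_right_dual :: "(('m \<Rightarrow> 'b) \<Rightarrow> 'm \<Rightarrow> 'a) \<Rightarrow> (('m \<Rightarrow> 'm) \<Rightarrow> 'b) \<Rightarrow> 'm \<Rightarrow> 'm"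
  where "End_of_right_dual u \<gamma> = (\<lambda>m\<in>carrier M. \<Oplus>\<^bsub>M\<^esub>h\<in>H. \<gamma> (T m (u (q h))) \<odot>\<^bsub>M\<^esub> h)"

context
  fixes v assumes v: "v \<in> bimod_hom A B RD LD"
begin

lemmas v_closed = left_hom_closed[OF bimod_hom_left[OF v]]
lemmas v_add_hom = left_hom_add_hom[OF bimod_hom_left[OF v]]
lemmas v_smult = left_hom_smult[OF bimod_hom_left[OF v]]
lemmas v_rsmult = right_hom_rsmult[OF bimod_hom_right[OF v]]

lemma right_dual_of_End_term:
  assumes e: "e \<in> carrier E" and g: "g \<in> G"
  shows "(\<lambda>x\<in>carrier E. v (p g \<circ>\<^sub>M x) (e g)) \<in> carrier REB"
proof -
  interpret EEB: bimodule E B EEB by (rule EEB)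
  note pg = p_RD[OF g] and eg = End_closed[OF e G_closed[OF g]]
  have "(\<lambda>x\<in>carrier EEB. v (p g \<circ>\<^sub>M x) (e g)) \<in> right_hom B EEB (regular B)"
  proof (intro right_hom_regularI EEB.right_module_axioms)
    fix x assume "x \<in> carrier EEB"
    then have x: "x \<in> carrier E" by simp
    note px = comp_RD[OF pg x]
    show "v (p g \<circ>\<^sub>M x) (e g) \<in> carrier B" by (rule LD_closed[OF v_closed[OF px] eg])
    show "v (p g \<circ>\<^sub>M (x \<oplus>\<^bsub>EEB\<^esub> y)) (e g) = v (p g \<circ>\<^sub>M x) (e g) \<oplus>\<^bsub>B\<^esub> v (p g \<circ>\<^sub>M y) (e g)"
      if "y \<in> carrier EEB" for y
    proof -
      have y: "y \<in> carrier E" using that by simp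
      note py = comp_RD[OF pg y]
      show ?thesis
        by (simp only: via_bimod_simps add_hom_add[OF comp_add_hom_right[OF pg] x y]
            add_hom_add[OF v_add_hom px py] add_hom_add[OF eval_LD[OF eg] v_closed[OF px] v_closed[OF py]])
    qed
    show "v (p g \<circ>\<^sub>M (x \<odot>\<^sub>r\<^bsub>EEB\<^esub> b)) (e g) = v (p g \<circ>\<^sub>M x) (e g) \<otimes>\<^bsub>B\<^esub> b" if b: "b \<in> carrier B" for b
    proof -
      have "v (p g \<circ>\<^sub>M (x \<odot>\<^sub>r\<^bsub>EEB\<^esub> b)) = v (p g \<circ>\<^sub>M x) \<odot>\<^sub>r\<^bsub>LD\<^esub> b"
        by (simp only: via_bimod_simps right_End_simps(2) comp_assoc[OF lm_End[OF b], symmetric] comp_lm[OF b]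
            v_rsmult[OF px b])
      then show ?thesis using eg by simp
    qed
  qed
  then show ?thesis by simp
qed

lemma right_dual_of_End_closed: "e \<in> carrier E \<Longrightarrow> right_dual_of_End v e \<in> carrier REB"
  unfolding right_dual_of_End_def
  by (intro REB.M.finsum_closed Pi_I right_dual_of_End_term)

text \<open>Composing \<open>p g\<close> with \<open>T m f\<close> leaves the scalar
  \<open>p g m\<close> on \<open>f\<close>. Linearity of \<open>v\<close> turns it into a scalar on
  the argument \<open>e g\<close>, linearity of \<open>e\<close> brings it to \<open>g\<close>, and
  the dual basis sums to \<open>m\<close>.\<close>

lemma right_dual_of_End_T:
  assumes e: "e \<in> carrier E" and m: "m \<in> carrier M" and f: "f \<in> carrier RD"
  shows "right_dual_of_End v e (T m f) = v f (e m)"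
proof -
  note vf = v_closed[OF f]
  have e': "e \<in> right_hom A M M" using e by simp
  have gp: "g \<odot>\<^sub>r\<^bsub>M\<^esub> p g m \<in> carrier M" if "g \<in> G" for g
    by (intro rsmult_closed G_closed RD_closed[OF p_RD] m that)
  have vfe: "(\<lambda>m. v f (e m)) \<in> add_hom M B"
    using right_homD[OF e'] add_hom_closed[OF LD_add_hom[OF vf]] add_hom_add[OF LD_add_hom[OF vf]] by (intro add_homI) simp_all
  have "right_dual_of_End v e (T m f) = (\<Oplus>\<^bsub>B\<^esub>g\<in>G. (\<lambda>x\<in>carrier E. v (p g \<circ>\<^sub>M x) (e g)) (T m f))"
    unfolding right_dual_of_End_def
    by (rule add_hom_finsum[OF REB.M.abelian_group_axioms B.abelian_group_axioms eval_REB[OF T_closed[OF m f]]])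
      (intro Pi_I right_dual_of_End_term e)
  also have "\<dots> = (\<Oplus>\<^bsub>B\<^esub>g\<in>G. v f (e (g \<odot>\<^sub>r\<^bsub>M\<^esub> p g m)))"
  proof (intro finsum_eqI B.abelian_group_axioms LD_closed[OF vf] End_closed[OF e] gp)
    fix g assume g: "g \<in> G"
    note pm = RD_closed[OF p_RD[OF g] m] and eg = End_closed[OF e G_closed[OF g]]
    have "(\<lambda>x\<in>carrier E. v (p g \<circ>\<^sub>M x) (e g)) (T m f) = (p g m \<odot>\<^bsub>LD\<^esub> v f) (e g)"
      by (simp only: restrict_apply' T_closed[OF m f] RD_comp_T[OF p_RD[OF g] m f] v_smult[OF pm f])
    also have "\<dots> = v f (e (g \<odot>\<^sub>r\<^bsub>M\<^esub> p g m))"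
      using eg by (simp add: right_hom_rsmult[OF e' G_closed[OF g] pm])
    finally show "(\<lambda>x\<in>carrier E. v (p g \<circ>\<^sub>M x) (e g)) (T m f) = v f (e (g \<odot>\<^sub>r\<^bsub>M\<^esub> p g m))" .
  qed
  also have "\<dots> = v f (e (\<Oplus>\<^bsub>M\<^esub>g\<in>G. g \<odot>\<^sub>r\<^bsub>M\<^esub> p g m))"
    by (rule add_hom_finsum[symmetric, OF M.abelian_group_axioms B.abelian_group_axioms vfe])
      (intro Pi_I gp)
  finally show ?thesis by (simp only: dual_basis[OF m])
qed

text \<open>On rank-one maps the left action of \<open>B\<close> is the linearity of the functional
  \<open>v f\<close>, and right multiplication in \<open>E\<close> is carried to the element by
  \<open>comp_T\<close>.\<close>

lemma right_dual_of_End_hom: "(\<lambda>e\<in>carrier BEE. right_dual_of_End v e) \<in> bimod_hom B E BEE REB"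
proof (rule bimod_homI[OF BEE])
  fix e assume "e \<in> carrier BEE"
  then have e: "e \<in> carrier E" by simp
  show "right_dual_of_End v e \<in> carrier REB" by (rule right_dual_of_End_closed[OF e])
  show "right_dual_of_End v (e \<oplus>\<^bsub>BEE\<^esub> d) = right_dual_of_End v e \<oplus>\<^bsub>REB\<^esub> right_dual_of_End v d"
    if "d \<in> carrier BEE" for d
    unfolding via_bimod_simps
  proof (rule REB_eqI)
    have d: "d \<in> carrier E" using that by simp
    have ed: "e \<oplus>\<^bsub>E\<^esub> d \<in> carrier E" by (rule E.a_closed[OF e d])
    then show "right_dual_of_End v (e \<oplus>\<^bsub>E\<^esub> d) \<in> carrier REB" by (rule right_dual_of_End_closed)
    show "right_dual_of_End v e \<oplus>\<^bsub>REB\<^esub> right_dual_of_End v d \<in> carrier REB"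
      by (intro REB.M.a_closed right_dual_of_End_closed e d)
    fix m f assume m: "m \<in> carrier M" and f: "f \<in> carrier RD"
    show "right_dual_of_End v (e \<oplus>\<^bsub>E\<^esub> d) (T m f) = (right_dual_of_End v e \<oplus>\<^bsub>REB\<^esub> right_dual_of_End v d) (T m f)"
      by (simp only: right_dual_of_End_T[OF ed m f] right_dual_of_End_T[OF e m f] right_dual_of_End_T[OF d m f]
          add_hom_add[OF eval_REB[OF T_closed[OF m f]] right_dual_of_End_closed[OF e] right_dual_of_End_closed[OF d]]
          add_hom_add[OF eval_End[OF m] e d]
          add_hom_add[OF LD_add_hom[OF v_closed[OF f]] End_closed[OF e m] End_closed[OF d m]])
  qed
  show "right_dual_of_End v (b \<odot>\<^bsub>BEE\<^esub> e) = b \<odot>\<^bsub>REB\<^esub> right_dual_of_End v e" if b: "b \<in> carrier B" for b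
  proof (rule REB_eqI)
    have be: "lm b \<circ>\<^sub>M e \<in> carrier E" by (rule comp_End[OF lm_End[OF b] e])
    have eq: "b \<odot>\<^bsub>BEE\<^esub> e = lm b \<circ>\<^sub>M e" by simp
    show "right_dual_of_End v (b \<odot>\<^bsub>BEE\<^esub> e) \<in> carrier REB"
      unfolding eq by (rule right_dual_of_End_closed[OF be])
    show "b \<odot>\<^bsub>REB\<^esub> right_dual_of_End v e \<in> carrier REB"
      by (intro REB.lsmult_closed right_dual_of_End_closed e b)
    fix m f assume m: "m \<in> carrier M" and f: "f \<in> carrier RD"
    have vf: "v f \<in> left_hom B M (regular B)" using v_closed[OF f] by simp
    have "(lm b \<circ>\<^sub>M e) m = b \<odot>\<^bsub>M\<^esub> e m"
      using End_closed[OF e m] m by (simp add: compose_apply left_mult_map_def)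
    then have "right_dual_of_End v (b \<odot>\<^bsub>BEE\<^esub> e) (T m f) = b \<otimes>\<^bsub>B\<^esub> v f (e m)"
      by (simp only: eq right_dual_of_End_T[OF be m f] left_hom_regular_smult[OF vf b End_closed[OF e m]])
    then show "right_dual_of_End v (b \<odot>\<^bsub>BEE\<^esub> e) (T m f) = (b \<odot>\<^bsub>REB\<^esub> right_dual_of_End v e) (T m f)"
      using T_closed[OF m f] by (simp add: right_dual_of_End_T[OF e m f])
  qed
  show "right_dual_of_End v (e \<odot>\<^sub>r\<^bsub>BEE\<^esub> a) = right_dual_of_End v e \<odot>\<^sub>r\<^bsub>REB\<^esub> a" if a: "a \<in> carrier E" for a
  proof (rule REB_eqI)
    have ea: "e \<circ>\<^sub>M a \<in> carrier E" by (rule comp_End[OF e a])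
    have eq: "e \<odot>\<^sub>r\<^bsub>BEE\<^esub> a = e \<circ>\<^sub>M a" by simp
    show "right_dual_of_End v (e \<odot>\<^sub>r\<^bsub>BEE\<^esub> a) \<in> carrier REB"
      unfolding eq by (rule right_dual_of_End_closed[OF ea])
    show "right_dual_of_End v e \<odot>\<^sub>r\<^bsub>REB\<^esub> a \<in> carrier REB"
      by (intro REB.rsmult_closed right_dual_of_End_closed e a)
    fix m f assume m: "m \<in> carrier M" and f: "f \<in> carrier RD"
    show "right_dual_of_End v (e \<odot>\<^sub>r\<^bsub>BEE\<^esub> a) (T m f) = (right_dual_of_End v e \<odot>\<^sub>r\<^bsub>REB\<^esub> a) (T m f)"
      by (simp only: eq REB_rsmult_apply[OF T_closed[OF m f]] comp_T[OF a m f] right_dual_of_End_T[OF ea m f]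
          right_dual_of_End_T[OF e End_closed[OF a m] f] compose_apply[OF m])
  qed
qed

end

context
  fixes u assumes u: "u \<in> bimod_hom A B LD RD"
begin

lemmas u_closed = left_hom_closed[OF bimod_hom_left[OF u]]
lemmas u_add_hom = left_hom_add_hom[OF bimod_hom_left[OF u]]
lemmas u_smult = left_hom_smult[OF bimod_hom_left[OF u]]
lemmas u_rsmult = right_hom_rsmult[OF bimod_hom_right[OF u]]

lemma REB_T_u_add_hom:
  assumes \<gamma>: "\<gamma> \<in> carrier REB" and m: "m \<in> carrier M"
  shows "(\<lambda>d. \<gamma> (T m (u d))) \<in> add_hom LD B"
proof (rule add_homI)
  fix d assume d: "d \<in> carrier LD"
  note Td = T_closed[OF m u_closed[OF d]]
  show "\<gamma> (T m (u d)) \<in> carrier B" by (rule REB_closed[OF \<gamma> Td])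
  show "\<gamma> (T m (u (d \<oplus>\<^bsub>LD\<^esub> d'))) = \<gamma> (T m (u d)) \<oplus>\<^bsub>B\<^esub> \<gamma> (T m (u d'))" if d': "d' \<in> carrier LD" for d'
    by (simp only: add_hom_add[OF u_add_hom d d'] add_hom_add[OF T_add_hom_right[OF m] u_closed[OF d] u_closed[OF d']]
        add_hom_add[OF REB_add_hom[OF \<gamma>] Td T_closed[OF m u_closed[OF d']]])
qed

lemma End_of_right_dual_in_M:
  assumes \<gamma>: "\<gamma> \<in> carrier REB" and m: "m \<in> carrier M"
  shows "End_of_right_dual u \<gamma> m \<in> carrier M"
  unfolding End_of_right_dual_def restrict_apply'[OF m]
  by (intro M.finsum_closed Pi_I lsmult_closed REB_closed[OF \<gamma>] T_closed m u_closed q_LD H_closed)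

text \<open>Applying \<open>d\<close> leaves factors \<open>d h\<close> on the right. They enter
  \<open>\<gamma>\<close> as composition with \<open>lm (d h)\<close>, pass through \<open>T\<close>
  and \<open>u\<close> by right \<open>B\<close>-linearity, and \<open>LD_expand\<close> reassembles
  \<open>d\<close>.\<close>

lemma LD_End_of_right_dual:
  assumes \<gamma>: "\<gamma> \<in> carrier REB" and m: "m \<in> carrier M" and d: "d \<in> carrier LD"
  shows "d (End_of_right_dual u \<gamma> m) = \<gamma> (T m (u d))"
proof -
  have Tq: "T m (u (q h)) \<in> carrier E" if "h \<in> H" for h
    by (intro T_closed m u_closed q_LD that)
  note \<gamma>q = REB_closed[OF \<gamma> Tq] and dh = LD_closed[OF d H_closed]
  have c: "q h \<odot>\<^sub>r\<^bsub>LD\<^esub> d h \<in> carrier LD" if "h \<in> H" for h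
    by (intro LD.rsmult_closed q_LD dh that)
  have d': "d \<in> left_hom B M (regular B)" using d by simp
  have "d (End_of_right_dual u \<gamma> m) = (\<Oplus>\<^bsub>B\<^esub>h\<in>H. d (\<gamma> (T m (u (q h))) \<odot>\<^bsub>M\<^esub> h))"
    unfolding End_of_right_dual_def restrict_apply'[OF m]
    by (rule add_hom_finsum[OF M.abelian_group_axioms B.abelian_group_axioms LD_add_hom[OF d]])
      (intro Pi_I lsmult_closed \<gamma>q H_closed)
  also have "\<dots> = (\<Oplus>\<^bsub>B\<^esub>h\<in>H. \<gamma> (T m (u (q h \<odot>\<^sub>r\<^bsub>LD\<^esub> d h))))"
  proof (intro finsum_eqI B.abelian_group_axioms)
    fix h assume h: "h \<in> H"
    show "d (\<gamma> (T m (u (q h))) \<odot>\<^bsub>M\<^esub> h) = \<gamma> (T m (u (q h \<odot>\<^sub>r\<^bsub>LD\<^esub> d h)))"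
      by (simp only: left_hom_regular_smult[OF d' \<gamma>q[OF h] H_closed[OF h]] u_rsmult[OF q_LD[OF h] dh[OF h]]
          comp_lm[OF dh[OF h], symmetric] T_comp[OF lm_End[OF dh[OF h]], symmetric] REB_lm[OF \<gamma> dh[OF h] Tq[OF h]])
    show "\<gamma> (T m (u (q h \<odot>\<^sub>r\<^bsub>LD\<^esub> d h))) \<in> carrier B"
      by (intro REB_closed[OF \<gamma>] T_closed m u_closed c h)
  qed
  also have "\<dots> = \<gamma> (T m (u (\<Oplus>\<^bsub>LD\<^esub>h\<in>H. q h \<odot>\<^sub>r\<^bsub>LD\<^esub> d h)))"
    by (rule add_hom_finsum[symmetric, OF LD.M.abelian_group_axioms B.abelian_group_axioms REB_T_u_add_hom[OF \<gamma> m]])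
      (intro Pi_I c)
  finally show ?thesis by (simp only: LD_expand[OF d])
qed

text \<open>Linearity is tested against \<open>LD\<close>. A scalar on the value becomes one on
  \<open>d\<close>, passes through \<open>u\<close>, and returns to \<open>m\<close> by
  \<open>T_rsmult\<close>.\<close>

lemma End_of_right_dual_closed:
  assumes \<gamma>: "\<gamma> \<in> carrier REB" shows "End_of_right_dual u \<gamma> \<in> carrier E"
proof -
  note cl = End_of_right_dual_in_M[OF \<gamma>] and ev = LD_End_of_right_dual[OF \<gamma>]
  have "(\<lambda>m\<in>carrier M. End_of_right_dual u \<gamma> m) \<in> right_hom A M M"
  proof (rule right_homI[OF right_module_axioms])
    fix m assume m: "m \<in> carrier M"
    show "End_of_right_dual u \<gamma> m \<in> carrier M" by (rule cl[OF m])
    show "End_of_right_dual u \<gamma> (m \<oplus>\<^bsub>M\<^esub> n) = End_of_right_dual u \<gamma> m \<oplus>\<^bsub>M\<^esub> End_of_right_dual u \<gamma> n"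
      if n: "n \<in> carrier M" for n
    proof (rule M_eqI_LD)
      have mn: "m \<oplus>\<^bsub>M\<^esub> n \<in> carrier M" using m n by simp
      show "End_of_right_dual u \<gamma> (m \<oplus>\<^bsub>M\<^esub> n) \<in> carrier M" by (rule cl[OF mn])
      show "End_of_right_dual u \<gamma> m \<oplus>\<^bsub>M\<^esub> End_of_right_dual u \<gamma> n \<in> carrier M" by (intro M.a_closed cl m n)
      fix d assume d: "d \<in> carrier LD"
      note ud = u_closed[OF d]
      show "d (End_of_right_dual u \<gamma> (m \<oplus>\<^bsub>M\<^esub> n)) = d (End_of_right_dual u \<gamma> m \<oplus>\<^bsub>M\<^esub> End_of_right_dual u \<gamma> n)"
        by (simp only: add_hom_add[OF LD_add_hom[OF d] cl[OF m] cl[OF n]] ev[OF mn d] ev[OF m d] ev[OF n d]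
            add_hom_add[OF T_add_hom_left[OF ud] m n]
            add_hom_add[OF REB_add_hom[OF \<gamma>] T_closed[OF m ud] T_closed[OF n ud]])
    qed
    show "End_of_right_dual u \<gamma> (m \<odot>\<^sub>r\<^bsub>M\<^esub> a) = End_of_right_dual u \<gamma> m \<odot>\<^sub>r\<^bsub>M\<^esub> a" if a: "a \<in> carrier A" for a
    proof (rule M_eqI_LD)
      note ma = rsmult_closed[OF m a]
      show "End_of_right_dual u \<gamma> (m \<odot>\<^sub>r\<^bsub>M\<^esub> a) \<in> carrier M" by (rule cl[OF ma])
      show "End_of_right_dual u \<gamma> m \<odot>\<^sub>r\<^bsub>M\<^esub> a \<in> carrier M" by (intro rsmult_closed cl m a)
      fix d assume d: "d \<in> carrier LD"
      have "d (End_of_right_dual u \<gamma> m \<odot>\<^sub>r\<^bsub>M\<^esub> a) = (a \<odot>\<^bsub>LD\<^esub> d) (End_of_right_dual u \<gamma> m)"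
        using cl[OF m] by simp
      then show "d (End_of_right_dual u \<gamma> (m \<odot>\<^sub>r\<^bsub>M\<^esub> a)) = d (End_of_right_dual u \<gamma> m \<odot>\<^sub>r\<^bsub>M\<^esub> a)"
        by (simp only: ev[OF ma d] ev[OF m LD.lsmult_closed[OF a d]] T_rsmult[OF m a u_closed[OF d]] u_smult[OF a d])
    qed
  qed
  then show ?thesis by (simp add: End_of_right_dual_def cong: restrict_cong)
qed

text \<open>Endomorphisms are compared pointwise and points by functionals in \<open>LD\<close>, so
  only the values \<open>\<gamma> (T m (u d))\<close> have to agree.\<close>

lemma End_of_right_dual_hom: "(\<lambda>\<gamma>\<in>carrier REB. End_of_right_dual u \<gamma>) \<in> bimod_hom B E REB BEE"
proof (rule bimod_homI[OF REB.bimodule_axioms])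
  fix \<gamma> assume \<gamma>: "\<gamma> \<in> carrier REB"
  note G\<gamma> = End_of_right_dual_closed[OF \<gamma>] and cl = End_of_right_dual_in_M[OF \<gamma>]
    and ev = LD_End_of_right_dual[OF \<gamma>]
  show "End_of_right_dual u \<gamma> \<in> carrier BEE" using G\<gamma> by simp
  show "End_of_right_dual u (\<gamma> \<oplus>\<^bsub>REB\<^esub> \<delta>) = End_of_right_dual u \<gamma> \<oplus>\<^bsub>BEE\<^esub> End_of_right_dual u \<delta>"
    if \<delta>: "\<delta> \<in> carrier REB" for \<delta>
    unfolding via_bimod_simps
  proof (rule End_eqI)
    note G\<delta> = End_of_right_dual_closed[OF \<delta>]
    have sum: "\<gamma> \<oplus>\<^bsub>REB\<^esub> \<delta> \<in> carrier REB" by (rule REB.M.a_closed[OF \<gamma> \<delta>])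
    show "End_of_right_dual u (\<gamma> \<oplus>\<^bsub>REB\<^esub> \<delta>) \<in> carrier E" by (rule End_of_right_dual_closed[OF sum])
    show sumE: "End_of_right_dual u \<gamma> \<oplus>\<^bsub>E\<^esub> End_of_right_dual u \<delta> \<in> carrier E" by (rule E.a_closed[OF G\<gamma> G\<delta>])
    fix m assume m: "m \<in> carrier M"
    show "End_of_right_dual u (\<gamma> \<oplus>\<^bsub>REB\<^esub> \<delta>) m = (End_of_right_dual u \<gamma> \<oplus>\<^bsub>E\<^esub> End_of_right_dual u \<delta>) m"
    proof (rule M_eqI_LD[OF End_of_right_dual_in_M[OF sum m] End_closed[OF sumE m]])
      fix d assume d: "d \<in> carrier LD"
      show "d (End_of_right_dual u (\<gamma> \<oplus>\<^bsub>REB\<^esub> \<delta>) m) = d ((End_of_right_dual u \<gamma> \<oplus>\<^bsub>E\<^esub> End_of_right_dual u \<delta>) m)"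
        by (simp only: LD_End_of_right_dual[OF sum m d] ev[OF m d] LD_End_of_right_dual[OF \<delta> m d]
            add_hom_add[OF eval_End[OF m] G\<gamma> G\<delta>] add_hom_add[OF LD_add_hom[OF d] cl[OF m] End_of_right_dual_in_M[OF \<delta> m]]
            add_hom_add[OF eval_REB[OF T_closed[OF m u_closed[OF d]]] \<gamma> \<delta>])
    qed
  qed
  show "End_of_right_dual u (b \<odot>\<^bsub>REB\<^esub> \<gamma>) = b \<odot>\<^bsub>BEE\<^esub> End_of_right_dual u \<gamma>" if b: "b \<in> carrier B" for b
  proof (rule End_eqI)
    have b\<gamma>: "b \<odot>\<^bsub>REB\<^esub> \<gamma> \<in> carrier REB" by (rule REB.lsmult_closed[OF b \<gamma>])
    have eq: "b \<odot>\<^bsub>BEE\<^esub> End_of_right_dual u \<gamma> = lm b \<circ>\<^sub>M End_of_right_dual u \<gamma>" by simp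
    show "End_of_right_dual u (b \<odot>\<^bsub>REB\<^esub> \<gamma>) \<in> carrier E" by (rule End_of_right_dual_closed[OF b\<gamma>])
    show "b \<odot>\<^bsub>BEE\<^esub> End_of_right_dual u \<gamma> \<in> carrier E"
      unfolding eq by (rule comp_End[OF lm_End[OF b] G\<gamma>])
    fix m assume m: "m \<in> carrier M"
    have eq': "(b \<odot>\<^bsub>BEE\<^esub> End_of_right_dual u \<gamma>) m = b \<odot>\<^bsub>M\<^esub> End_of_right_dual u \<gamma> m"
      unfolding eq using cl[OF m] by (simp add: compose_apply[OF m] left_mult_map_def)
    show "End_of_right_dual u (b \<odot>\<^bsub>REB\<^esub> \<gamma>) m = (b \<odot>\<^bsub>BEE\<^esub> End_of_right_dual u \<gamma>) m"
      unfolding eq'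
    proof (rule M_eqI_LD[OF End_of_right_dual_in_M[OF b\<gamma> m] lsmult_closed[OF b cl[OF m]]])
      fix d assume d: "d \<in> carrier LD"
      have "d (b \<odot>\<^bsub>M\<^esub> End_of_right_dual u \<gamma> m) = b \<otimes>\<^bsub>B\<^esub> \<gamma> (T m (u d))"
        using left_hom_regular_smult[of d B M b "End_of_right_dual u \<gamma> m"] d b cl[OF m] by (simp add: ev[OF m d])
      then show "d (End_of_right_dual u (b \<odot>\<^bsub>REB\<^esub> \<gamma>) m) = d (b \<odot>\<^bsub>M\<^esub> End_of_right_dual u \<gamma> m)"
        using T_closed[OF m u_closed[OF d]] by (simp add: LD_End_of_right_dual[OF b\<gamma> m d, simplified])
    qed
  qed
  show "End_of_right_dual u (\<gamma> \<odot>\<^sub>r\<^bsub>REB\<^esub> a) = End_of_right_dual u \<gamma> \<odot>\<^sub>r\<^bsub>BEE\<^esub> a" if a: "a \<in> carrier E" for a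
  proof (rule End_eqI)
    have \<gamma>a: "\<gamma> \<odot>\<^sub>r\<^bsub>REB\<^esub> a \<in> carrier REB" by (rule REB.rsmult_closed[OF \<gamma> a])
    have eq: "End_of_right_dual u \<gamma> \<odot>\<^sub>r\<^bsub>BEE\<^esub> a = End_of_right_dual u \<gamma> \<circ>\<^sub>M a" by simp
    show "End_of_right_dual u (\<gamma> \<odot>\<^sub>r\<^bsub>REB\<^esub> a) \<in> carrier E" by (rule End_of_right_dual_closed[OF \<gamma>a])
    show "End_of_right_dual u \<gamma> \<odot>\<^sub>r\<^bsub>BEE\<^esub> a \<in> carrier E"
      unfolding eq by (rule comp_End[OF G\<gamma> a])
    fix m assume m: "m \<in> carrier M"
    note am = End_closed[OF a m]
    show "End_of_right_dual u (\<gamma> \<odot>\<^sub>r\<^bsub>REB\<^esub> a) m = (End_of_right_dual u \<gamma> \<odot>\<^sub>r\<^bsub>BEE\<^esub> a) m"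
      unfolding eq compose_apply[OF m]
    proof (rule M_eqI_LD[OF End_of_right_dual_in_M[OF \<gamma>a m] cl[OF am]])
      fix d assume d: "d \<in> carrier LD"
      note ud = u_closed[OF d]
      show "d (End_of_right_dual u (\<gamma> \<odot>\<^sub>r\<^bsub>REB\<^esub> a) m) = d (End_of_right_dual u \<gamma> (a m))"
        by (simp only: LD_End_of_right_dual[OF \<gamma>a m d] ev[OF am d] REB_rsmult_apply[OF T_closed[OF m ud]]
            comp_T[OF a m ud])
    qed
  qed
qed

end

theorem End_divides_right_dual:
  assumes "bimod_divides A B LD RD"
  shows "bimod_divides B E BEE REB"
proof -
  obtain n :: nat and u v where u: "\<And>i. i < n \<Longrightarrow> u i \<in> bimod_hom A B LD RD"
    and v: "\<And>i. i < n \<Longrightarrow> v i \<in> bimod_hom A B RD LD"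
    and vu: "\<And>d. d \<in> carrier LD \<Longrightarrow> d = (\<Oplus>\<^bsub>LD\<^esub>i\<in>{..<n}. v i (u i d))"
    using bimod_divides_imp_family[OF LD.bimodule_axioms RD.bimodule_axioms assms] by blast
  show ?thesis
  proof (rule bimod_dividesI[OF BEE REB.bimodule_axioms])
    fix i assume i: "i < n"
    show "(\<lambda>e\<in>carrier BEE. right_dual_of_End (v i) e) \<in> bimod_hom B E BEE REB"
      by (rule right_dual_of_End_hom[OF v[OF i]])
    show "(\<lambda>\<gamma>\<in>carrier REB. End_of_right_dual (u i) \<gamma>) \<in> bimod_hom B E REB BEE"
      by (rule End_of_right_dual_hom[OF u[OF i]])
  next
    fix e assume "e \<in> carrier BEE"
    then have e: "e \<in> carrier E" by simp
    let ?c = "\<lambda>i. End_of_right_dual (u i) (right_dual_of_End (v i) e)"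
    have rc: "right_dual_of_End (v i) e \<in> carrier REB" if "i \<in> {..<n}" for i
      using that by (intro right_dual_of_End_closed[OF v e]) simp
    have c: "?c i \<in> carrier E" if "i \<in> {..<n}" for i
      using that by (intro End_of_right_dual_closed[OF u] rc) simp_all
    have sumE: "(\<Oplus>\<^bsub>E\<^esub>i\<in>{..<n}. ?c i) \<in> carrier E" by (intro E.finsum_closed Pi_I c)
    have "(\<Oplus>\<^bsub>E\<^esub>i\<in>{..<n}. ?c i) = e"
    proof (rule End_eqI[OF sumE e])
      fix m assume m: "m \<in> carrier M"
      note em = End_closed[OF e m]
      show "(\<Oplus>\<^bsub>E\<^esub>i\<in>{..<n}. ?c i) m = e m"
      proof (rule M_eqI_LD[OF End_closed[OF sumE m] em])
        fix d assume d: "d \<in> carrier LD"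
        \<comment> \<open>Under \<open>d\<close> the i-th term becomes
          \<open>v i (u i d) (e m)\<close>, so the relation needed is the one on \<open>LD\<close>,
          evaluated at \<open>e m\<close>.\<close>
        have "d ((\<Oplus>\<^bsub>E\<^esub>i\<in>{..<n}. ?c i) m) = d (\<Oplus>\<^bsub>M\<^esub>i\<in>{..<n}. ?c i m)"
          by (rule arg_cong[of _ _ d], rule add_hom_finsum[OF E.abelian_group_axioms M.abelian_group_axioms eval_End[OF m]])
            (intro Pi_I c)
        also have "\<dots> = (\<Oplus>\<^bsub>B\<^esub>i\<in>{..<n}. d (?c i m))"
          by (rule add_hom_finsum[OF M.abelian_group_axioms B.abelian_group_axioms LD_add_hom[OF d]])
            (intro Pi_I End_closed[OF c m])
        also have "\<dots> = (\<Oplus>\<^bsub>B\<^esub>i\<in>{..<n}. v i (u i d) (e m))"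
        proof (intro finsum_eqI B.abelian_group_axioms)
          fix i assume i': "i \<in> {..<n}"
          then have i: "i < n" by simp
          note ud = u_closed[OF u[OF i] d]
          show "d (?c i m) = v i (u i d) (e m)"
            by (simp only: LD_End_of_right_dual[OF u[OF i] rc[OF i'] m d] right_dual_of_End_T[OF v[OF i] e m ud])
          show "v i (u i d) (e m) \<in> carrier B"
            by (rule LD_closed[OF v_closed[OF v[OF i] ud] em])
        qed
        also have "\<dots> = (\<Oplus>\<^bsub>LD\<^esub>i\<in>{..<n}. v i (u i d)) (e m)"
          by (rule add_hom_finsum[symmetric, OF LD.M.abelian_group_axioms B.abelian_group_axioms eval_LD[OF em]])
            (use v_closed[OF v u_closed[OF u d]] in blast)
        also have "\<dots> = d (e m)" by (simp only: vu[OF d, symmetric])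
        finally show "d ((\<Oplus>\<^bsub>E\<^esub>i\<in>{..<n}. ?c i) m) = d (e m)" .
      qed
    qed
    moreover have "(\<Oplus>\<^bsub>E\<^esub>i\<in>{..<n}. (\<lambda>\<gamma>\<in>carrier REB. End_of_right_dual (u i) \<gamma>)
        ((\<lambda>e\<in>carrier BEE. right_dual_of_End (v i) e) e)) = (\<Oplus>\<^bsub>E\<^esub>i\<in>{..<n}. ?c i)"
      by (intro finsum_eqI E.abelian_group_axioms c)
        (simp only: restrict_apply' rc \<open>e \<in> carrier BEE\<close>)
    ultimately show "(\<Oplus>\<^bsub>BEE\<^esub>i\<in>{..<n}. (\<lambda>\<gamma>\<in>carrier REB. End_of_right_dual (u i) \<gamma>)
        ((\<lambda>e\<in>carrier BEE. right_dual_of_End (v i) e) e)) = e"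
      by (simp only: finsum_via_bimod)
  qed
qed

end

theorem mainTheorem3:
  fixes A :: "('a, 'q) ring_scheme"
    and B :: "('b, 'r) ring_scheme"
    and M :: "('b, 'a, 'm, 's) bimodule_scheme"
  assumes "ring A" and "ring B" and "bimodule B A M"
    and "QF_bimodule B A M"
  shows "QF_extension B (right_End A M) (left_mult_map M)"
proof -
  interpret M: bimodule B A M by fact
  have fgp: "left_fin_gen B M" "left_projective B M" "right_fin_gen A M" "right_projective A M"
    and sim: "bimod_divides A B (left_dual B M) (right_dual A M)" "bimod_divides A B (right_dual A M) (left_dual B M)"
    using assms(4) by (simp_all add: QF_bimodule_def bimod_similar_def)
  have ldb: "has_left_dual_basis B M"
    by (intro has_left_dual_basisI M.left_module_axioms fgp)
  obtain H q where H: "finite H" "H \<subseteq> carrier M" "\<And>h. h \<in> H \<Longrightarrow> q h \<in> left_hom B M (regular B)"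
    "\<And>m. m \<in> carrier M \<Longrightarrow> (\<Oplus>\<^bsub>M\<^esub>h\<in>H. q h m \<odot>\<^bsub>M\<^esub> h) = m"
    using has_left_dual_basisE[OF ldb] by blast
  have "has_right_dual_basis A M"
    by (intro has_right_dual_basisI M.right_module_axioms fgp)
  then obtain G p where G: "finite G" "G \<subseteq> carrier M" "\<And>g. g \<in> G \<Longrightarrow> p g \<in> right_hom A M (regular A)"
    "\<And>m. m \<in> carrier M \<Longrightarrow> (\<Oplus>\<^bsub>M\<^esub>g\<in>G. g \<odot>\<^sub>r\<^bsub>M\<^esub> p g m) = m"
    using has_right_dual_basisE by blast
  interpret D: bimodule_dual_bases B A M G p H q
    by unfold_locales (use G H in auto)
  interpret EEB: bimodule D.E B D.EEB by (rule D.EEB)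
  interpret BEE: bimodule B D.E D.BEE by (rule D.BEE)
  note hom = left_mult_map_hom[OF assms(3)]
  have left: "has_left_dual_basis B D.BEE" by (rule D.has_left_dual_basis_End[OF ldb])
  \<comment> \<open>The chain is: \<open>LD\<close> inherits a right dual basis from the left one of
    \<open>M\<close>, \<open>RD\<close> is a retract of a power of \<open>LD\<close>, and
    \<open>E\<close> one of a power of \<open>RD\<close>.\<close>
  have right: "has_right_dual_basis B D.EEB"
    by (rule D.has_right_dual_basis_End[OF D.has_right_dual_basis_RD[OF sim(2)]])
  \<comment> \<open>The halves of the similarity are used separately: \<open>RD\<close> dividing
    \<open>LD\<close> gives the left divisibility, \<open>LD\<close> dividing \<open>RD\<close> the
    right one.\<close>
  show ?thesis
    unfolding QF_extension_def left_QF_extension_def right_QF_extension_def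
    by (intro conjI hom has_left_dual_basis_imp_fin_gen[OF left]
        has_left_dual_basis_imp_projective[OF BEE.left_module_axioms left]
        has_right_dual_basis_imp[OF EEB.right_module_axioms right]
        D.End_divides_left_dual[OF sim(2)] D.End_divides_right_dual[OF sim(1)])
qed

end
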